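(* Let $d,k\ge1$ be integers with $k\le d-1$. Consider the Veronese variety $\mathrm{Ver}(d-1,k)$, with defining matrix $A$, embedded with scaling vector $c=(1,1,\ldots,1,1)$. Then $c\notin\Sigma_A$ and $\mathrm{mldeg}(\mathrm{Ver}(d-1,k))=k^{d-1}$.
   Context: Veronese: $A$ is the $(d-1)\times n$ integer matrix whose columns $a_1,\ldots,a_n$ are all the non-negative integer vectors in $\mathbb{Z}^{d-1}$ with coordinate sum $\le k$. For $c\in(\mathbb{C}^* )^n$, let $V^c\subset\mathbb{P}^{n-1}$ be the projective variety over $\mathbb{C}$ whose affine cone is the Zariski closure in $\mathbb{C}^n$ of the image of $\psi^c:(\mathbb{C}^* )^d\to(\mathbb{C}^* )^n$, $(s,\theta_1,\ldots,\theta_{d-1})\mapsto(c_1s\theta^{a_1},\ldots,c_ns\theta^{a_n})$. $\mathrm{Ver}(d-1,k)$ is $V=V^{(1,\ldots,1)}$. ML degree: for a projective variety $X\subset\mathbb{P}^{n-1}$ with homogeneous coordinates $[p_1:\cdots:p_n]$ and a vector $u=(u_1,\ldots,u_n)$, let $\ell_u(p)=p_1^{u_1}\cdots p_n^{u_n}/(p_1+\cdots+p_n)^{u_1+\cdots+u_n}$. Let $X_{\mathrm{reg}}$ be the set of smooth points of $X$ and let $\mathcal{H}$ be the union of the coordinate hyperplanes and the hyperplane $p_1+\cdots+p_n=0$. Then $\mathrm{mldeg}(X)$ is the number of complex critical points of $\ell_u$ on $X_{\mathrm{reg}}\setminus\mathcal{H}$ for generic $u$ (this number is well-defined). $A$-resultant: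 for $g=\sum_i b_i\theta^{a_i}$ write $L_g(p)=\sum_i b_ip_i$. Given $f_1,\ldots,f_d$ with $f_j=\sum_{i=1}^n c_{i,j}\theta^{a_i}$, the $A$-resultant $R_A(f_1,\ldots,f_d)$ is the irreducible polynomial in the coefficients $c_{i,j}$ (unique up to a scalar) which vanishes at $(c_{i,j})$ if and only if $L_{f_1}=\cdots=L_{f_d}=0$ has a solution on the projective variety $V$. Principal $A$-determinant: for $f=\sum_{i=1}^n c_i\theta^{a_i}$, $E_A(f)=R_A\bigl(f,\theta_1\frac{\partial f}{\partial\theta_1},\ldots,\theta_{d-1}\frac{\partial f}{\partial\theta_{d-1}}\bigr)$, a polynomial in $c_1,\ldots,c_n$; $\Sigma_A\subset\mathbb{C}^n$ is its zero locus. *)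

theory Defs
  imports
    "HOL-Analysis.Complex_Transcendental"
    "HOL-Library.Poly_Mapping"
    "Jordan_Normal_Form.DL_Rank"
begin

no_notation vec_nth (infixl "$" 90)

subsection \<open>Multivariate polynomials over the complex numbers\<close>

type_synonym 'v cpoly = "('v \<Rightarrow>\<^sub>0 nat) \<Rightarrow>\<^sub>0 complex"

definition pvars :: "'v cpoly \<Rightarrow> 'v set" where
  "pvars F = (\<Union>m\<in>Poly_Mapping.keys F. Poly_Mapping.keys m)"

definition peval :: "'v cpoly \<Rightarrow> ('v \<Rightarrow> complex) \<Rightarrow> complex" where
  "peval F x = (\<Sum>m\<in>Poly_Mapping.keys F. Poly_Mapping.lookup F m *
      (\<Prod>i\<in>Poly_Mapping.keys m. x i ^ Poly_Mapping.lookup m i))"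

definition poly_ring :: "nat \<Rightarrow> nat cpoly set" where
  "poly_ring n = {F. pvars F \<subseteq> {..<n}}"

abbreviation evalv :: "nat cpoly \<Rightarrow> complex vec \<Rightarrow> complex" where
  "evalv F p \<equiv> peval F (\<lambda>i. p $ i)"

definition vanishing_ideal :: "nat \<Rightarrow> complex vec set \<Rightarrow> nat cpoly set" where
  "vanishing_ideal n S = {F \<in> poly_ring n. \<forall>q\<in>S. evalv F q = 0}"

definition zariski_closure :: "nat \<Rightarrow> complex vec set \<Rightarrow> complex vec set" where
  "zariski_closure n S = {p \<in> carrier_vec n. \<forall>F\<in>vanishing_ideal n S. evalv F p = 0}"

definition gradient :: "nat \<Rightarrow> nat cpoly \<Rightarrow> complex vec \<Rightarrow> complex vec" where
  "gradient n F p = vec n (\<lambda>i. deriv (\<lambda>t. evalv F (p + t \<cdot>\<^sub>v unit_vec n i)) 0)"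


subsection \<open>Points and subsets of projective space\<close>

text \<open>A point of projective \<open>(n-1)\<close>-space is represented by the set of its homogeneous
  coordinate vectors, i.e. by a punctured line through the origin. Subsets of projective space
  are sets of such points.\<close>

definition proj_point :: "complex vec \<Rightarrow> complex vec set" where
  "proj_point p = {t \<cdot>\<^sub>v p | t. t \<noteq> 0}"

definition projectivization :: "nat \<Rightarrow> complex vec set \<Rightarrow> complex vec set set" where
  "projectivization n C = proj_point ` (C - {0\<^sub>v n})"

definition affine_cone :: "nat \<Rightarrow> complex vec set set \<Rightarrow> complex vec set" where
  "affine_cone n X = insert (0\<^sub>v n) (\<Union>X)"


subsection \<open>Smooth points and tangent spaces\<close>

text \<open>A point \<open>p\<close> of a Zariski closed set \<open>C\<close> is smooth if on a Zariski neighbourhood of \<open>p\<close>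
  (a basic open set \<open>h \<noteq> 0\<close>) the set \<open>C\<close> is cut out by \<open>r\<close> polynomials whose Jacobian at \<open>p\<close>
  has rank \<open>r\<close>.\<close>

definition jacobian :: "nat \<Rightarrow> nat cpoly list \<Rightarrow> complex vec \<Rightarrow> complex mat" where
  "jacobian n Fs p = mat_of_rows n (map (\<lambda>F. gradient n F p) Fs)"

definition smooth_at :: "nat \<Rightarrow> complex vec set \<Rightarrow> complex vec \<Rightarrow> bool" where
  "smooth_at n C p \<longleftrightarrow> p \<in> C \<and>
     (\<exists>h Fs. h \<in> poly_ring n \<and> set Fs \<subseteq> poly_ring n \<and> evalv h p \<noteq> 0 \<and>
        (\<forall>q\<in>carrier_vec n. evalv h q \<noteq> 0 \<longrightarrow> (q \<in> C \<longleftrightarrow> (\<forall>F\<in>set Fs. evalv F q = 0))) \<and>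
        vec_space.rank (length Fs) (jacobian n Fs p) = length Fs)"

definition tangent_space :: "nat \<Rightarrow> complex vec set \<Rightarrow> complex vec \<Rightarrow> complex vec set" where
  "tangent_space n C p =
     {v \<in> carrier_vec n. \<forall>F\<in>vanishing_ideal n C. scalar_prod (gradient n F p) v = 0}"

text \<open>For \<open>p \<noteq> 0\<close> the projective variety is smooth at the point \<open>[p]\<close> iff its affine cone is
  smooth at \<open>p\<close>.\<close>

definition reg_points :: "nat \<Rightarrow> complex vec set set \<Rightarrow> complex vec set set" where
  "reg_points n X = {P \<in> X. \<forall>p\<in>P. smooth_at n (affine_cone n X) p}"

definition coord_sum :: "complex vec \<Rightarrow> complex" where
  "coord_sum p = (\<Sum>i<dim_vec p. p $ i)"

definition hyperplane_arrangement :: "nat \<Rightarrow> complex vec set set" where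
  "hyperplane_arrangement n =
     projectivization n {p \<in> carrier_vec n. (\<exists>i<n. p $ i = 0) \<or> coord_sum p = 0}"


subsection \<open>The maximum likelihood degree\<close>

text \<open>For a complex exponent vector \<open>u\<close>, \<open>likelihood_at u p\<close> is the local branch near \<open>p\<close> of the
  function \<open>x\<^sub>1\<^bsup>u\<^sub>1\<^esup> \<cdots> x\<^sub>n\<^bsup>u\<^sub>n\<^esup> / (x\<^sub>1 + \<cdots> + x\<^sub>n)\<^bsup>u\<^sub>1 + \<cdots> + u\<^sub>n\<^esup>\<close>, scaled by a non-zero constant so that
  its value at \<open>p\<close> is \<open>1\<close>: all quotients \<open>x\<^sub>i / p\<^sub>i\<close> are close to \<open>1\<close>, where the principal branch
  of the power function is holomorphic. For integral \<open>u\<close> it is the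
  rational function itself divided by its value at \<open>p\<close>.\<close>

definition likelihood_at :: "complex vec \<Rightarrow> complex vec \<Rightarrow> complex vec \<Rightarrow> complex" where
  "likelihood_at u p x =
     (\<Prod>i<dim_vec u. (x $ i / p $ i) powr (u $ i)) / (coord_sum x / coord_sum p) powr coord_sum u"

text \<open>The likelihood function is homogeneous of degree \<open>0\<close>, so \<open>[p]\<close> is a critical point on the
  projective variety iff \<open>p\<close> is a critical point on its affine cone.\<close>

definition likelihood_critical :: "nat \<Rightarrow> complex vec set \<Rightarrow> complex vec \<Rightarrow> complex vec \<Rightarrow> bool" where
  "likelihood_critical n C u p \<longleftrightarrow>
     (\<forall>v\<in>tangent_space n C p.
        ((\<lambda>t. likelihood_at u p (p + t \<cdot>\<^sub>v v)) has_field_derivative 0) (at 0))"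

definition critical_points :: "nat \<Rightarrow> complex vec set set \<Rightarrow> complex vec \<Rightarrow> complex vec set set" where
  "critical_points n X u = {P \<in> reg_points n X - hyperplane_arrangement n.
     \<forall>p\<in>P. likelihood_critical n (affine_cone n X) u p}"

definition generically :: "nat \<Rightarrow> (complex vec \<Rightarrow> bool) \<Rightarrow> bool" where
  "generically n Q \<longleftrightarrow>
     (\<exists>D\<in>poly_ring n. D \<noteq> 0 \<and> (\<forall>u\<in>carrier_vec n. evalv D u \<noteq> 0 \<longrightarrow> Q u))"

definition mldeg :: "nat \<Rightarrow> complex vec set set \<Rightarrow> nat" where
  "mldeg n X =
     (THE N. generically n (\<lambda>u. finite (critical_points n X u) \<and> card (critical_points n X u) = N))"


subsection \<open>Scaled toric varieties\<close>

definition torus :: "nat \<Rightarrow> complex vec set" where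
  "torus m = {\<theta> \<in> carrier_vec m. \<forall>j<m. \<theta> $ j \<noteq> 0}"

definition laurent_monom :: "complex vec \<Rightarrow> int vec \<Rightarrow> complex" where
  "laurent_monom \<theta> a = (\<Prod>j<dim_vec a. (\<theta> $ j) powi (a $ j))"

definition toric_param :: "int mat \<Rightarrow> complex vec \<Rightarrow> complex \<Rightarrow> complex vec \<Rightarrow> complex vec" where
  "toric_param A c s \<theta> = vec (dim_col A) (\<lambda>i. c $ i * s * laurent_monom \<theta> (col A i))"

definition toric_variety :: "int mat \<Rightarrow> complex vec \<Rightarrow> complex vec set set" where
  "toric_variety A c = projectivization (dim_col A)
     (zariski_closure (dim_col A) {toric_param A c s \<theta> | s \<theta>. s \<noteq> 0 \<and> \<theta> \<in> torus (dim_row A)})"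

definition ones_vec :: "nat \<Rightarrow> complex vec" where
  "ones_vec n = vec n (\<lambda>_. 1)"

text \<open>The order of the columns of a Veronese matrix is left open.\<close>

definition veronese_matrix :: "nat \<Rightarrow> nat \<Rightarrow> int mat \<Rightarrow> bool" where
  "veronese_matrix m k A \<longleftrightarrow> dim_row A = m \<and> distinct (cols A) \<and>
     set (cols A) = {a \<in> carrier_vec m. (\<forall>j<m. 0 \<le> a $ j) \<and> (\<Sum>j<m. a $ j) \<le> int k}"


subsection \<open>The A-resultant and the principal A-determinant\<close>

text \<open>A Laurent polynomial with exponents among the columns of \<open>A\<close> is given by its
  coefficient vector \<open>b\<close>; then \<open>L\<^sub>g(p)\<close> is the scalar product of \<open>b\<close> and \<open>p\<close>.\<close>

definition laurent_eval :: "int mat \<Rightarrow> complex vec \<Rightarrow> complex vec \<Rightarrow> complex" where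
  "laurent_eval A b \<theta> = (\<Sum>i<dim_col A. b $ i * laurent_monom \<theta> (col A i))"

text \<open>The coefficient vector of \<open>\<theta>\<^sub>j \<partial>f/\<partial>\<theta>\<^sub>j\<close>; see lemma \<open>laurent_eval_euler_coeffs\<close>.\<close>

definition euler_coeffs :: "int mat \<Rightarrow> nat \<Rightarrow> complex vec \<Rightarrow> complex vec" where
  "euler_coeffs A j b = vec (dim_col A) (\<lambda>i. of_int (A $$ (j, i)) * b $ i)"

lemma laurent_eval_euler_coeffs:
  assumes "\<theta> \<in> torus (dim_row A)" "j < dim_row A"
  shows "((\<lambda>t. laurent_eval A b (vec (dim_row A) (\<lambda>l. if l = j then t else \<theta> $ l)))
           has_field_derivative D) (at (\<theta> $ j)) \<longleftrightarrow>
         laurent_eval A (euler_coeffs A j b) \<theta> = \<theta> $ j * D"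
proof -
  define M where "M i = (\<Prod>l\<in>{..<dim_row A} - {j}. (\<theta> $ l) powi (A $$ (l, i)))" for i
  have nz: "\<theta> $ j \<noteq> 0" using assms by (auto simp: torus_def)
  have split: "laurent_monom (vec (dim_row A) (\<lambda>l. if l = j then t else \<theta> $ l)) (col A i)
      = t powi (A $$ (j, i)) * M i" if "i < dim_col A" for i t
    using assms(2) that unfolding laurent_monom_def M_def
    by (subst prod.remove[of _ j]) auto
  have split': "laurent_monom \<theta> (col A i) = (\<theta> $ j) powi (A $$ (j, i)) * M i"
    if "i < dim_col A" for i
    using assms(2) that unfolding laurent_monom_def M_def
    by (subst prod.remove[of _ j]) auto
  define E where "E = (\<Sum>i<dim_col A. b $ i *
      (of_int (A $$ (j, i)) * (\<theta> $ j) powi (A $$ (j, i) - 1) * M i))"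
  have eq: "(\<lambda>t. laurent_eval A b (vec (dim_row A) (\<lambda>l. if l = j then t else \<theta> $ l)))
      = (\<lambda>t. \<Sum>i<dim_col A. b $ i * (t powi (A $$ (j, i)) * M i))"
    unfolding laurent_eval_def using split by (intro ext sum.cong) auto
  have der: "((\<lambda>t. laurent_eval A b (vec (dim_row A) (\<lambda>l. if l = j then t else \<theta> $ l)))
      has_field_derivative E) (at (\<theta> $ j))"
    unfolding eq E_def using nz
    by (auto intro!: derivative_eq_intros sum.cong simp: mult_ac)
  have "laurent_eval A (euler_coeffs A j b) \<theta> = \<theta> $ j * E"
    unfolding laurent_eval_def E_def euler_coeffs_def sum_distrib_left
    using nz by (intro sum.cong) (auto simp: split' power_int_diff)
  thus ?thesis using der nz by (auto dest: DERIV_unique)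
qed

text \<open>The coefficient \<open>c\<^sub>i\<^sub>,\<^sub>j\<close> of \<open>f\<^sub>j\<close> is the variable \<open>(i, j)\<close>, and \<open>f\<^sub>j\<close> is the \<open>j\<close>-th column of
  the coefficient matrix. The A-resultant is determined by the following property up to a
  non-zero constant factor.\<close>

definition is_A_resultant :: "int mat \<Rightarrow> (nat \<times> nat) cpoly \<Rightarrow> bool" where
  "is_A_resultant A R \<longleftrightarrow>
     pvars R \<subseteq> {..<dim_col A} \<times> {..<dim_row A + 1} \<and> Factorial_Ring.irreducible R \<and>
     (\<forall>M\<in>carrier_mat (dim_col A) (dim_row A + 1).
        peval R (\<lambda>ij. M $$ ij) = 0 \<longleftrightarrow>
        (\<exists>P\<in>toric_variety A (ones_vec (dim_col A)).
           \<forall>p\<in>P. \<forall>j<dim_row A + 1. scalar_prod (col M j) p = 0))"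

definition principal_A_det :: "int mat \<Rightarrow> (nat \<times> nat) cpoly \<Rightarrow> complex vec \<Rightarrow> complex" where
  "principal_A_det A R c = peval R (\<lambda>ij.
     mat_of_cols (dim_col A) (c # map (\<lambda>j. euler_coeffs A j c) [0..<dim_row A]) $$ ij)"

definition Sigma_locus :: "int mat \<Rightarrow> (nat \<times> nat) cpoly \<Rightarrow> complex vec set" where
  "Sigma_locus A R = {c \<in> carrier_vec (dim_col A). principal_A_det A R c = 0}"

end

theory Submission
  imports Defs "Jordan_Normal_Form.Char_Poly"
begin

text \<open>On the cone over the Veronese variety, parametrised by the monomials of degree \<open>k\<close> in
  \<open>x\<^sub>0, \<dots>, x\<^sub>m\<close> (with \<open>m = d - 1\<close>), the likelihood equations for the data \<open>u\<close> read
  \<open>G\<^sub>j(x) = \<beta>\<^sub>j\<close>, where \<open>G\<^sub>j = x\<^sub>j \<partial>h\<^sub>k/\<partial>x\<^sub>j\<close> for the complete homogeneous polynomial \<open>h\<^sub>k\<close> and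
  \<open>\<beta>\<close> is linear in \<open>u\<close>. By Newton's identities a power of every variable lies in the ideal
  \<open>(G\<^sub>0, \<dots>, G\<^sub>m)\<close>. So the \<open>G\<^sub>j\<close> have no common zero except \<open>0\<close>, which is the statement on
  \<open>\<Sigma>\<^sub>A\<close>, and \<open>\<complex>[x]\<close> is a finite module over the polynomial ring \<open>\<complex>[G]\<close>; comparing the
  dimensions of the spaces of polynomials of bounded degree shows that its rank is \<open>k\<^bsup>m + 1\<^esup>\<close>. A primitive
  element turns the generic fibre of \<open>G\<close> into the set of roots of a separable polynomial of that
  degree. The fibre maps to the critical points by forgetting \<open>k\<close>-th roots of unity,
  which leaves \<open>k\<^sup>m\<close> critical points.\<close>

section \<open>Polynomial algebra and dimension counts\<close>

subsection \<open>Substitution into multivariate polynomials\<close>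

text \<open>Dimension counts need degrees, not mere membership in an ideal. Hence the power
  \<open>N = k + r - 1\<close> of a variable (with \<open>r = m + 1\<close>) is written through the
  \<open>G\<^sub>j\<close> with cofactors of degree at most \<open>N - k\<close>, and reducing a
  monomial never raises its degree. Only leading coefficients of the counts matter: up to bounded
  shifts, \<open>M\<^sup>r / r!\<close> monomials in the \<open>G\<^sub>j\<close> face
  \<open>(k M)\<^sup>r / r!\<close> monomials in the \<open>x\<^sub>j\<close>, and each inequality
  for the rank is one such comparison. That the \<open>G\<^sub>j\<close> are algebraically
  independent is seen from weights under which \<open>G\<^sub>j\<close> has the degree of
  \<open>x\<^sub>0\<^sup>k\<^sup>-\<^sup>1 x\<^sub>j\<close>. Homogeneity of the
  \<open>G\<^sub>j\<close> also clears the denominators when a root of the primitive element's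
  relation is turned back into a point of the fibre. On the likelihood side the equations determine
  a point only up to scaling; since \<open>\<Sum>\<^sub>j G\<^sub>j\<close> is \<open>k\<close>
  times the coordinate sum, demanding the coordinate sum of \<open>u\<close> turns proportionality
  into the equations \<open>G\<^sub>j = \<beta>\<^sub>j\<close>.\<close>

abbreviation (input) lookup where "lookup \<equiv> Poly_Mapping.lookup"

abbreviation (input) keys where "keys \<equiv> Poly_Mapping.keys"

abbreviation (input) single where "single \<equiv> Poly_Mapping.single"

abbreviation Cst :: "complex \<Rightarrow> 'v cpoly" where
  "Cst c \<equiv> single 0 c"

abbreviation Var :: "'v \<Rightarrow> 'v cpoly" where
  "Var i \<equiv> single (single i (Suc 0)) 1"

definition mono_eval :: "('v \<Rightarrow> 'b::comm_monoid_mult) \<Rightarrow> ('v \<Rightarrow>\<^sub>0 nat) \<Rightarrow> 'b" where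
  "mono_eval g m = (\<Prod>i\<in>keys m. g i ^ lookup m i)"

text \<open>The coefficient map \<open>\<kappa>\<close> is a parameter so that one definition covers
  evaluation at complex numbers, substitution of polynomials (\<open>\<kappa> = Cst\<close>), and
  passage to univariate polynomials over \<open>complex\<close> or over \<open>nat cpoly\<close>
  (\<open>[:c:]\<close>, \<open>[:Cst c:]\<close>).\<close>

definition psubst :: "(complex \<Rightarrow> 'b::comm_ring_1) \<Rightarrow> ('v \<Rightarrow> 'b) \<Rightarrow> 'v cpoly \<Rightarrow> 'b" where
  "psubst \<kappa> g F = (\<Sum>m\<in>keys F. \<kappa> (lookup F m) * mono_eval g m)"

lemma mono_eval_superset:
  assumes "finite I" "keys m \<subseteq> I"
  shows "mono_eval g m = (\<Prod>i\<in>I. g i ^ lookup m i)"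
  unfolding mono_eval_def using assms
  by (intro prod.mono_neutral_left) (auto simp: in_keys_iff)

lemma mono_eval_0 [simp]: "mono_eval g 0 = 1"
  by (simp add: mono_eval_def)

lemma mono_eval_add: "mono_eval g (m + m') = mono_eval g m * mono_eval g m'"
proof -
  let ?I = "keys m \<union> keys m'"
  have "keys (m + m') \<subseteq> ?I"
    by (rule Poly_Mapping.keys_add)
  then show ?thesis
    by (subst (1 2 3) mono_eval_superset[of ?I]) (auto simp: lookup_add power_add prod.distrib)
qed

lemma mono_eval_single [simp]: "mono_eval g (single i n) = g i ^ n"
  by (cases "n = 0") (auto simp: mono_eval_def)

lemma peval_eq_psubst: "peval F x = psubst (\<lambda>c. c) x F"
  by (simp add: peval_def psubst_def mono_eval_def)

lemma sum_monomials_lookup: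
  "F = (\<Sum>m\<in>keys F. single m (lookup F m))"
proof (rule poly_mapping_eqI)
  fix k
  have "(\<Sum>m\<in>keys F. lookup (single m (lookup F m)) k)
     = (\<Sum>m\<in>keys F. if m = k then lookup F m else 0)"
    by (intro sum.cong) (auto simp: lookup_single when_def)
  then show "lookup F k = lookup
     (\<Sum>m\<in>keys F. single m (lookup F m)) k"
    by (auto simp: lookup_sum in_keys_iff)
qed


locale const_hom = comm_ring_hom \<kappa> for \<kappa> :: "complex \<Rightarrow> 'b::comm_ring_1"
begin

lemma psubst_superset:
  assumes "finite A" "keys F \<subseteq> A"
  shows "psubst \<kappa> g F = (\<Sum>m\<in>A. \<kappa> (lookup F m) * mono_eval g m)"
  unfolding psubst_def using assms
  by (intro sum.mono_neutral_left) (auto simp: in_keys_iff)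

lemma psubst_single: "psubst \<kappa> g (single m c) = \<kappa> c * mono_eval g m"
  by (subst psubst_superset[of "{m}"]) auto

lemma psubst_add: "psubst \<kappa> g (F + G) = psubst \<kappa> g F + psubst \<kappa> g G"
proof -
  let ?A = "keys F \<union> keys G"
  have "keys (F + G) \<subseteq> ?A"
    by (rule Poly_Mapping.keys_add)
  then show ?thesis
    by (subst (1 2 3) psubst_superset[of ?A])
      (auto simp: lookup_add hom_add algebra_simps sum.distrib)
qed

lemma psubst_0 [simp]: "psubst \<kappa> g 0 = 0"
  by (simp add: psubst_def)

lemma psubst_sum: "psubst \<kappa> g (sum F A) = (\<Sum>i\<in>A. psubst \<kappa> g (F i))"
  by (induction A rule: infinite_finite_induct) (auto simp: psubst_add)

lemma psubst_mult: "psubst \<kappa> g (F * G) = psubst \<kappa> g F * psubst \<kappa> g G"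
proof -
  have "F * G = (\<Sum>m\<in>keys F. \<Sum>m'\<in>keys G.
      single (m + m') (lookup F m * lookup G m'))"
    by (subst (1) sum_monomials_lookup[of F], subst (1) sum_monomials_lookup[of G])
      (simp add: sum_product mult_single)
  then have "psubst \<kappa> g (F * G) = (\<Sum>m\<in>keys F. \<Sum>m'\<in>keys G.
      \<kappa> (lookup F m) * mono_eval g m * (\<kappa> (lookup G m') * mono_eval g m'))"
    by (simp add: psubst_sum psubst_single hom_mult mono_eval_add mult_ac)
  then show ?thesis
    by (simp add: psubst_def sum_product)
qed

lemma comm_ring_hom_psubst: "comm_ring_hom (psubst \<kappa> g)"
proof
  show "psubst \<kappa> g 1 = 1"
    using psubst_single[of g 0 1] by simp
qed (auto simp: psubst_add psubst_mult)

end

lemma const_hom_id: "const_hom (\<lambda>c. c)"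
  by standard auto

lemma const_hom_Cst: "const_hom (Cst :: complex \<Rightarrow> 'v cpoly)"
  by standard (auto simp: single_add mult_single)

lemma const_hom_pCons: "const_hom (\<lambda>c. [:c:])"
  by standard auto

lemma comm_ring_hom_peval: "comm_ring_hom (\<lambda>F. peval F x)"
  unfolding peval_eq_psubst by (rule const_hom.comm_ring_hom_psubst[OF const_hom_id])

global_interpretation peval: comm_ring_hom "\<lambda>F. peval F x" for x
  by (rule comm_ring_hom_peval)

lemma peval_single: "peval (single m c) x = c * mono_eval x m"
  unfolding peval_eq_psubst by (rule const_hom.psubst_single[OF const_hom_id])

lemma hom_psubst:
  assumes "comm_ring_hom f"
  shows "f (psubst \<kappa> g F) = psubst (\<lambda>c. f (\<kappa> c)) (\<lambda>i. f (g i)) F"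
proof -
  interpret comm_ring_hom f by fact
  show ?thesis by (simp add: psubst_def mono_eval_def hom_distribs)
qed

lemma peval_psubst: "peval (psubst Cst g F) x = peval F (\<lambda>i. peval (g i) x)"
  by (subst hom_psubst[OF comm_ring_hom_peval]) (simp add: peval_single, simp add: peval_eq_psubst)

lemma mono_eval_cong:
  "(\<And>i. i \<in> keys m \<Longrightarrow> g i = g' i) \<Longrightarrow> mono_eval g m = mono_eval g' m"
  by (simp add: mono_eval_def)

lemma psubst_cong:
  "(\<And>i. i \<in> pvars F \<Longrightarrow> g i = g' i) \<Longrightarrow> psubst \<kappa> g F = psubst \<kappa> g' F"
  unfolding psubst_def pvars_def
  by (intro sum.cong arg_cong2[where f="(*)"] mono_eval_cong refl) auto

lemma peval_cong: "(\<And>i. i \<in> pvars F \<Longrightarrow> x i = y i) \<Longrightarrow> peval F x = peval F y"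
  unfolding peval_eq_psubst by (rule psubst_cong)

subsection \<open>Total degree\<close>

definition mdeg :: "('v \<Rightarrow>\<^sub>0 nat) \<Rightarrow> nat" where
  "mdeg m = (\<Sum>i\<in>keys m. lookup m i)"

text \<open>The stages of the degree filtration. Membership with a bound, instead of a degree
  function, makes \<open>0\<close> unproblematic and lets bounds be weakened freely.\<close>

definition polys_upto :: "nat \<Rightarrow> nat \<Rightarrow> nat cpoly set" where
  "polys_upto r M = {F. \<forall>m\<in>keys F. keys m \<subseteq> {..<r} \<and> mdeg m \<le> M}"

lemma mdeg_superset:
  assumes "finite I" "keys m \<subseteq> I"
  shows "mdeg m = (\<Sum>i\<in>I. lookup m i)"
  unfolding mdeg_def using assms by (intro sum.mono_neutral_left) (auto simp: in_keys_iff)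

lemma mdeg_0 [simp]: "mdeg 0 = 0"
  by (simp add: mdeg_def)

lemma mdeg_single [simp]: "mdeg (single i n) = n"
  by (cases "n = 0") (auto simp: mdeg_def)

lemma mdeg_add: "mdeg (m + m') = mdeg m + mdeg m'"
proof -
  let ?I = "keys m \<union> keys m'"
  have "keys (m + m') \<subseteq> ?I"
    by (rule Poly_Mapping.keys_add)
  then show ?thesis
    by (subst (1 2 3) mdeg_superset[of ?I]) (auto simp: lookup_add sum.distrib)
qed

lemma mono_eval_scale: "mono_eval (\<lambda>i. t * g i) m = t ^ mdeg m * mono_eval g m"
  by (simp add: mono_eval_def mdeg_def power_mult_distrib prod.distrib power_sum)

lemma polys_upto_single:
  "keys m \<subseteq> {..<r} \<Longrightarrow> mdeg m \<le> M \<Longrightarrow> single m c \<in> polys_upto r M"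
  by (auto simp: polys_upto_def)

lemma polys_upto_Cst [simp]: "Cst c \<in> polys_upto r M"
  by (rule polys_upto_single) auto

lemma polys_upto_0 [simp]: "0 \<in> polys_upto r M"
  by (simp add: polys_upto_def)

lemma polys_upto_1 [simp]: "1 \<in> polys_upto r M"
  by (simp add: polys_upto_def)

lemma polys_upto_Var: "i < r \<Longrightarrow> 1 \<le> M \<Longrightarrow> Var i \<in> polys_upto r M"
  by (rule polys_upto_single) auto

lemma polys_upto_mono: "F \<in> polys_upto r M \<Longrightarrow> M \<le> M' \<Longrightarrow> F \<in> polys_upto r M'"
  by (auto simp: polys_upto_def)

lemma polys_upto_add: "F \<in> polys_upto r M \<Longrightarrow> G \<in> polys_upto r M \<Longrightarrow> F + G \<in> polys_upto r M"
  using Poly_Mapping.keys_add[of F G] by (auto simp: polys_upto_def)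

lemma polys_upto_sum: "(\<And>i. i \<in> A \<Longrightarrow> F i \<in> polys_upto r M) \<Longrightarrow> sum F A \<in> polys_upto r M"
  by (induction A rule: infinite_finite_induct) (auto simp: polys_upto_add)

lemma polys_upto_mult:
  assumes "F \<in> polys_upto r M" "G \<in> polys_upto r M'"
  shows "F * G \<in> polys_upto r (M + M')"
  unfolding polys_upto_def
proof (intro CollectI ballI)
  fix m assume "m \<in> keys (F * G)"
  then obtain a b where "m = a + b" "a \<in> keys F" "b \<in> keys G"
    using Poly_Mapping.keys_mult[of F G] by blast
  then show "keys m \<subseteq> {..<r} \<and> mdeg m \<le> M + M'"
    using assms Poly_Mapping.keys_add[of a b] by (fastforce simp: polys_upto_def mdeg_add)
qed

lemma polys_upto_uminus: "F \<in> polys_upto r M \<Longrightarrow> - F \<in> polys_upto r M"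
  by (auto simp: polys_upto_def in_keys_iff)

lemma polys_upto_power: "F \<in> polys_upto r M \<Longrightarrow> F ^ j \<in> polys_upto r (j * M)"
  by (induction j) (auto intro: polys_upto_mult)

lemma polys_upto_prod:
  "finite A \<Longrightarrow> (\<And>i. i \<in> A \<Longrightarrow> F i \<in> polys_upto r (M i)) \<Longrightarrow> prod F A \<in> polys_upto r (sum M A)"
  by (induction A rule: finite_induct) (auto intro: polys_upto_mult)

lemma poly_ring_iff: "F \<in> poly_ring r \<longleftrightarrow> (\<forall>m\<in>keys F. keys m \<subseteq> {..<r})"
  by (auto simp: poly_ring_def pvars_def)

lemma poly_ring_upto: "F \<in> polys_upto r M \<Longrightarrow> F \<in> poly_ring r"
  by (auto simp: poly_ring_iff polys_upto_def)

lemma poly_ring_obtain_upto: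
  assumes "F \<in> poly_ring r" obtains M where "F \<in> polys_upto r M"
proof
  show "F \<in> polys_upto r (\<Sum>m\<in>keys F. mdeg m)"
    using assms by (auto simp: poly_ring_iff polys_upto_def intro!: member_le_sum)
qed

lemma poly_ring_obtain_upto_finite:
  assumes "finite A" "\<And>i. i \<in> A \<Longrightarrow> F i \<in> poly_ring r"
  obtains M where "\<And>i. i \<in> A \<Longrightarrow> F i \<in> polys_upto r M"
proof -
  have "\<exists>M. F i \<in> polys_upto r M" if "i \<in> A" for i
    using assms(2)[OF that] by (meson poly_ring_obtain_upto)
  then obtain M where M: "\<And>i. i \<in> A \<Longrightarrow> F i \<in> polys_upto r (M i)" by metis
  have "F i \<in> polys_upto r (sum M A)" if "i \<in> A" for i
    using M[OF that] assms(1) that by (meson member_le_sum polys_upto_mono zero_le)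
  then show thesis by (rule that)
qed

lemma poly_ring_simps [simp]: "0 \<in> poly_ring r" "1 \<in> poly_ring r" "Cst c \<in> poly_ring r"
  by (auto simp: poly_ring_iff)

lemma poly_ring_Var: "i < r \<Longrightarrow> Var i \<in> poly_ring r"
  by (auto simp: poly_ring_iff)

lemma poly_ring_add: "F \<in> poly_ring r \<Longrightarrow> G \<in> poly_ring r \<Longrightarrow> F + G \<in> poly_ring r"
  using Poly_Mapping.keys_add[of F G] by (fastforce simp: poly_ring_iff)

lemma poly_ring_uminus: "F \<in> poly_ring r \<Longrightarrow> - F \<in> poly_ring r"
  by (auto simp: poly_ring_iff in_keys_iff)

lemma poly_ring_diff: "F \<in> poly_ring r \<Longrightarrow> G \<in> poly_ring r \<Longrightarrow> F - G \<in> poly_ring r"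
  using poly_ring_add[of F r "- G"] poly_ring_uminus by simp

lemma poly_ring_mult: "F \<in> poly_ring r \<Longrightarrow> G \<in> poly_ring r \<Longrightarrow> F * G \<in> poly_ring r"
  by (meson poly_ring_obtain_upto poly_ring_upto polys_upto_mult)

lemma poly_ring_sum: "(\<And>i. i \<in> A \<Longrightarrow> F i \<in> poly_ring r) \<Longrightarrow> sum F A \<in> poly_ring r"
  by (induction A rule: infinite_finite_induct) (auto simp: poly_ring_add)

lemma poly_ring_prod: "(\<And>i. i \<in> A \<Longrightarrow> F i \<in> poly_ring r) \<Longrightarrow> prod F A \<in> poly_ring r"
  by (induction A rule: infinite_finite_induct) (auto simp: poly_ring_mult)

lemma poly_ring_power: "F \<in> poly_ring r \<Longrightarrow> F ^ j \<in> poly_ring r"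
  by (induction j) (auto simp: poly_ring_mult)

lemma psubst_Cst_poly_ring:
  assumes "F \<in> poly_ring s" "\<And>i. i < s \<Longrightarrow> g i \<in> poly_ring r"
  shows "psubst Cst g F \<in> poly_ring r"
  unfolding psubst_def mono_eval_def using assms
  by (intro poly_ring_sum poly_ring_mult poly_ring_prod poly_ring_power)
    (auto simp: poly_ring_iff[of F])

lemma mono_eval_polys_upto:
  assumes "keys m \<subseteq> {..<s}" "\<And>i. i < s \<Longrightarrow> g i \<in> polys_upto r k"
  shows "mono_eval g m \<in> polys_upto r (mdeg m * k)"
  unfolding mono_eval_def mdeg_def sum_distrib_right using assms
  by (intro polys_upto_prod polys_upto_power) auto

subsection \<open>Linear algebra and monomial counts\<close>

interpretation cvs: vector_space "\<lambda>c F. Cst c * F :: 'v cpoly"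
  by standard (auto simp: algebra_simps single_add mult_single mult.assoc[symmetric])

text \<open>Stated for indexed families, since different indices may give the same polynomial; a
  repetition \<open>f i = f j\<close> is itself a dependence with coefficients \<open>1\<close> and
  \<open>- 1\<close>.\<close>

lemma linear_dependence:
  fixes f :: "'i \<Rightarrow> 'v cpoly"
  assumes "finite I" "finite B" "card B < card I" "\<And>i. i \<in> I \<Longrightarrow> f i \<in> cvs.span B"
  shows "\<exists>c. (\<exists>i\<in>I. c i \<noteq> 0) \<and> (\<Sum>i\<in>I. Cst (c i) * f i) = 0"
proof (cases "inj_on f I")
  case True
  have "cvs.dependent (f ` I)"
  proof (rule ccontr)
    assume "cvs.independent (f ` I)"
    then have "card (f ` I) \<le> card B"
      using cvs.independent_span_bound[OF assms(2), of "f ` I"] assms(4) by blast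
    then show False using card_image[OF True] assms(3) by simp
  qed
  then obtain u where u: "\<exists>v\<in>f ` I. u v \<noteq> 0" "(\<Sum>v\<in>f ` I. Cst (u v) * v) = 0"
    using cvs.dependent_finite[of "f ` I"] assms(1) by auto
  then have "(\<Sum>i\<in>I. Cst (u (f i)) * f i) = 0"
    by (simp add: sum.reindex[OF True])
  then show ?thesis using u(1) by (intro exI[of _ "\<lambda>i. u (f i)"]) auto
next
  case False
  then obtain i j where ij: "i \<in> I" "j \<in> I" "i \<noteq> j" "f i = f j"
    by (auto simp: inj_on_def)
  define c where "c = (\<lambda>l. if l = i then 1 else if l = j then - 1 else (0::complex))"
  have "(\<Sum>l\<in>I. Cst (c l) * f l) = (\<Sum>l\<in>{i, j}. Cst (c l) * f l)"
    using ij assms(1) by (intro sum.mono_neutral_right) (auto simp: c_def)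
  also have "\<dots> = Cst 1 * f i + Cst (- 1) * f i"
    using ij by (simp add: c_def)
  also have "\<dots> = (Cst 1 + Cst (- 1)) * f i"
    by (simp add: distrib_right)
  also have "Cst (1::complex) + Cst (- 1) = (0 :: 'v cpoly)"
    unfolding single_add[symmetric] by simp
  also have "0 * f i = 0" by simp
  finally show ?thesis
    using ij(1) by (intro exI[of _ c]) (auto simp: c_def)
qed

definition exps_upto :: "nat \<Rightarrow> nat \<Rightarrow> (nat \<Rightarrow>\<^sub>0 nat) set" where
  "exps_upto r M = {m. keys m \<subseteq> {..<r} \<and> mdeg m \<le> M}"

lemma exps_upto_0_left: "exps_upto 0 M = {0}"
  by (auto simp: exps_upto_def)

lemma exps_upto_0_right: "exps_upto r 0 = {0}"
proof -
  have "m = 0" if "mdeg m = 0" for m :: "nat \<Rightarrow>\<^sub>0 nat"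
    using that by (intro poly_mapping_eqI) (auto simp: mdeg_def in_keys_iff)
  then show ?thesis by (auto simp: exps_upto_def)
qed

text \<open>Pascal's rule on the level of sets: either variable \<open>r\<close> is absent, or one
  copy of it can be removed.\<close>

lemma exps_upto_Suc_Suc:
  "exps_upto (Suc r) (Suc M) = exps_upto r (Suc M) \<union> (\<lambda>m. m + single r 1) ` exps_upto (Suc r) M"
  (is "?L = ?A \<union> ?f ` ?B")
proof
  show "?L \<subseteq> ?A \<union> ?f ` ?B"
  proof
    fix m assume m: "m \<in> ?L"
    show "m \<in> ?A \<union> ?f ` ?B"
    proof (cases "r \<in> keys m")
      case False
      then show ?thesis using m by (auto simp: exps_upto_def less_Suc_eq)
    next
      case True
      define m' where "m' = m - single r 1"
      have eq: "m = m' + single r 1"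
        using True by (intro poly_mapping_eqI)
          (auto simp: m'_def lookup_add lookup_minus lookup_single when_def in_keys_iff)
      have "keys m' \<subseteq> keys m"
        by (auto simp: m'_def in_keys_iff lookup_minus)
      then have "m' \<in> ?B"
        using m mdeg_add[of m' "single r 1"] eq by (auto simp: exps_upto_def)
      then show ?thesis using eq by blast
    qed
  qed
  show "?A \<union> ?f ` ?B \<subseteq> ?L"
  proof -
    have "?f m \<in> ?L" if "m \<in> ?B" for m
      using that Poly_Mapping.keys_add[of m "single r 1"]
      by (auto simp: exps_upto_def mdeg_add)
    then show ?thesis by (auto simp: exps_upto_def)
  qed
qed

lemma finite_card_exps_upto: "finite (exps_upto r M) \<and> card (exps_upto r M) = (M + r) choose r"
proof (induction "M + r" arbitrary: r M rule: less_induct)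
  case less
  show ?case
  proof (cases r)
    case 0
    then show ?thesis by (simp add: exps_upto_0_left)
  next
    case (Suc r')
    show ?thesis
    proof (cases M)
      case 0
      then show ?thesis by (simp add: exps_upto_0_right)
    next
      case (Suc M')
      note r = \<open>r = Suc r'\<close>
      let ?f = "\<lambda>m. m + single r' 1"
      have 1: "finite (exps_upto r' M)" "card (exps_upto r' M) = (M + r') choose r'"
        using less[of M r'] r by auto
      have 2: "finite (exps_upto r M')" "card (exps_upto r M') = (M' + r) choose r"
        using less[of M' r] Suc by auto
      have inj: "inj_on ?f (exps_upto r M')" by (auto simp: inj_on_def)
      have "exps_upto r' M \<inter> ?f ` exps_upto r M' = {}"
      proof -
        have "r' \<in> keys (?f m)" for m :: "nat \<Rightarrow>\<^sub>0 nat"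
          by (auto simp: in_keys_iff lookup_add)
        then show ?thesis by (auto simp: exps_upto_def)
      qed
      then have "card (exps_upto r' M \<union> ?f ` exps_upto r M') = ((M + r') choose r') + ((M' + r) choose r)"
        using 1 2 card_image[OF inj] by (subst card_Un_disjoint) simp_all
      moreover have "exps_upto r M = exps_upto r' M \<union> ?f ` exps_upto r M'"
        unfolding r Suc by (rule exps_upto_Suc_Suc)
      ultimately show ?thesis
        using 1 2 r Suc by simp
    qed
  qed
qed

lemmas finite_exps_upto [simp] = finite_card_exps_upto[THEN conjunct1]
lemmas card_exps_upto = finite_card_exps_upto[THEN conjunct2]

lemma polys_upto_span: "F \<in> polys_upto r M \<Longrightarrow> F \<in> cvs.span ((\<lambda>m. single m 1) ` exps_upto r M)"
proof -
  assume F: "F \<in> polys_upto r M"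
  have "F = (\<Sum>m\<in>keys F. Cst (lookup F m) * single m 1)"
    by (subst (1) sum_monomials_lookup) (simp add: mult_single)
  also have "\<dots> \<in> cvs.span ((\<lambda>m. single m 1) ` exps_upto r M)"
    using F by (intro cvs.span_sum cvs.span_scale cvs.span_base) (auto simp: polys_upto_def exps_upto_def)
  finally show ?thesis .
qed

lemma Suc_times_binomial_add: "Suc r * ((n + Suc r) choose Suc r) = (n + Suc r) * ((n + r) choose r)"
  using Suc_times_binomial_eq[of "n + r" r] by (simp add: mult.commute)

text \<open>Both binomials are products of \<open>r\<close> factors over the same denominator, and
  factor by factor \<open>c * M + i \<le> c * (M + i)\<close>.\<close>

lemma binomial_scale_le:
  assumes "1 \<le> (c::nat)"
  shows "(c * M + r) choose r \<le> c ^ r * ((M + r) choose r)"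
proof (induction r)
  case (Suc r)
  have "Suc r * ((c * M + Suc r) choose Suc r) = (c * M + Suc r) * ((c * M + r) choose r)"
    by (rule Suc_times_binomial_add)
  also have "\<dots> \<le> (c * (M + Suc r)) * (c ^ r * ((M + r) choose r))"
  proof (intro mult_le_mono Suc)
    have "1 * Suc r \<le> c * Suc r" using assms by (rule mult_le_mono1)
    then show "c * M + Suc r \<le> c * (M + Suc r)" by (simp add: distrib_left)
  qed
  also have "\<dots> = c ^ Suc r * ((M + Suc r) * ((M + r) choose r))"
    by (simp only: power_Suc mult_ac)
  also have "\<dots> = Suc r * (c ^ Suc r * ((M + Suc r) choose Suc r))"
    by (subst Suc_times_binomial_add[symmetric]) (simp only: mult_ac)
  finally show ?case by (simp only: mult_le_cancel1)
qed simp

text \<open>The leading coefficient of a Hilbert polynomial. Each induction step multiplies by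
  \<open>(a * M + c + Suc r) / (M * Suc r)\<close>, which tends to \<open>a / Suc r\<close>; the
  shift \<open>c\<close> is lost in the limit.\<close>

lemma binomial_asymp:
  "(\<lambda>M. real ((a * M + c + r) choose r) / real M ^ r) \<longlonglongrightarrow> real a ^ r / fact r"
proof (induction r)
  case (Suc r)
  have eq: "real ((a * M + c + Suc r) choose Suc r) / real M ^ Suc r =
      real ((a * M + c + r) choose r) / real M ^ r *
      (real (a * M + c + Suc r) / real M) / real (Suc r)" for M
  proof -
    have "real (Suc r) * real ((a * M + c + Suc r) choose Suc r) =
        real (a * M + c + Suc r) * real ((a * M + c + r) choose r)"
      using Suc_times_binomial_add[of r "a * M + c"] by (metis of_nat_mult)
    then have "real ((a * M + c + Suc r) choose Suc r) =
        real (a * M + c + Suc r) * real ((a * M + c + r) choose r) / real (Suc r)"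
      by (metis nonzero_mult_div_cancel_left of_nat_neq_0)
    then show ?thesis by (simp only: power_Suc times_divide_times_eq divide_divide_eq_left) (simp add: mult_ac)
  qed
  have "(\<lambda>M. real a + real (c + Suc r) * (1 / real M)) \<longlonglongrightarrow> real a + real (c + Suc r) * 0"
    by (intro tendsto_intros lim_1_over_n)
  moreover have "eventually (\<lambda>M. real a + real (c + Suc r) * (1 / real M) =
      real (a * M + c + Suc r) / real M) sequentially"
    using eventually_gt_at_top[of 0] by eventually_elim (simp add: field_simps)
  ultimately have "(\<lambda>M. real (a * M + c + Suc r) / real M) \<longlonglongrightarrow> real a"
    by (simp add: Lim_transform_eventually)
  then have "(\<lambda>M. real ((a * M + c + r) choose r) / real M ^ r *
      (real (a * M + c + Suc r) / real M) / real (Suc r)) \<longlonglongrightarrow> real a ^ r / fact r * real a / real (Suc r)"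
    by (intro tendsto_mult tendsto_divide Suc tendsto_const) auto
  then show ?case unfolding eq by (simp add: mult_ac)
qed simp

text \<open>Passing to leading coefficients turns an inequality of dimensions, valid for all
  \<open>M\<close>, into an inequality free of the shifts \<open>c\<close> and \<open>c'\<close>.
  All degree bounds that do not grow with \<open>M\<close> can therefore be put into the
  shifts.\<close>

lemma binomial_ratio_le:
  assumes "\<And>M. e * ((a * M + c + r) choose r) \<le> e' * ((a' * M + c' + r) choose r)"
  shows "e * a ^ r \<le> e' * (a' ^ r :: nat)"
proof -
  have "real e * (real a ^ r / fact r) \<le> real e' * (real a' ^ r / fact r)"
  proof (rule LIMSEQ_le)
    show "(\<lambda>M. real e * (real ((a * M + c + r) choose r) / real M ^ r)) \<longlonglongrightarrow> real e * (real a ^ r / fact r)"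
      by (intro tendsto_intros binomial_asymp)
    show "(\<lambda>M. real e' * (real ((a' * M + c' + r) choose r) / real M ^ r)) \<longlonglongrightarrow> real e' * (real a' ^ r / fact r)"
      by (intro tendsto_intros binomial_asymp)
    have "real e * (real ((a * M + c + r) choose r) / real M ^ r)
        \<le> real e' * (real ((a' * M + c' + r) choose r) / real M ^ r)" for M
      using assms[of M] unfolding times_divide_eq_right
      by (intro divide_right_mono) (auto simp flip: of_nat_mult)
    then show "\<exists>N. \<forall>M\<ge>N. real e * (real ((a * M + c + r) choose r) / real M ^ r)
        \<le> real e' * (real ((a' * M + c' + r) choose r) / real M ^ r)" by blast
  qed
  then have "real e * real a ^ r \<le> real e' * real a' ^ r"
    by (simp add: divide_le_cancel)
  then show ?thesis by (metis of_nat_le_iff of_nat_mult of_nat_power)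
qed

subsection \<open>Kronecker substitution\<close>

text \<open>The image of largest degree cannot be cancelled, because all other images have strictly
  smaller degree.\<close>

lemma psubst_nonzero_degree:
  assumes "F \<noteq> 0" "\<And>m. m \<in> keys F \<Longrightarrow> mono_eval g m \<noteq> 0"
    and inj: "inj_on (\<lambda>m. degree (mono_eval g m)) (keys F)"
  shows "psubst (\<lambda>c. [:c:]) g F \<noteq> (0 :: complex poly)"
proof -
  let ?K = "keys F" and ?d = "\<lambda>m. degree (mono_eval g m)"
  have K: "finite ?K" "?K \<noteq> {}" using assms(1) by auto
  then have "Max (?d ` ?K) \<in> ?d ` ?K" by (intro Max_in) auto
  then obtain m0 where m0: "m0 \<in> ?K" "?d m0 = Max (?d ` ?K)" by auto
  have lt: "?d m < ?d m0" if "m \<in> ?K" "m \<noteq> m0" for m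
  proof -
    have "?d m \<le> ?d m0" unfolding m0(2) using that K by auto
    moreover have "?d m \<noteq> ?d m0" using inj that m0(1) by (auto simp: inj_on_def)
    ultimately show ?thesis by simp
  qed
  have "coeff (psubst (\<lambda>c. [:c:]) g F) (?d m0)
      = (\<Sum>m\<in>?K. lookup F m * coeff (mono_eval g m) (?d m0))"
    by (simp add: psubst_def coeff_sum)
  also have "\<dots> = (\<Sum>m\<in>{m0}. lookup F m * coeff (mono_eval g m) (?d m0))"
    using m0(1) K(1) lt by (intro sum.mono_neutral_right) (auto simp: coeff_eq_0)
  also have "\<dots> \<noteq> 0"
    using m0(1) assms(2)[OF m0(1)] by (auto simp: in_keys_iff)
  finally show ?thesis by auto
qed

text \<open>Uniqueness of base \<open>B\<close> digits, except that the part \<open>q\<close> above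
  the \<open>r\<close> lowest digits is unrestricted; the independence proof for the Euler forms
  stores unbounded data there.\<close>

lemma digit_sum_unique:
  fixes B :: nat
  assumes "\<And>i. i < r \<Longrightarrow> d i < B" "\<And>i. i < r \<Longrightarrow> d' i < B"
    and "(\<Sum>i<r. B ^ i * d i) + B ^ r * q = (\<Sum>i<r. B ^ i * d' i) + B ^ r * q'"
  shows "(\<forall>i<r. d i = d' i) \<and> q = q'"
  using assms
proof (induction r arbitrary: q q')
  case (Suc r)
  have "(\<Sum>i<r. B ^ i * d i) + B ^ r * (d r + B * q) = (\<Sum>i<r. B ^ i * d' i) + B ^ r * (d' r + B * q')"
    using Suc.prems(3) by (simp add: algebra_simps)
  then have *: "(\<forall>i<r. d i = d' i) \<and> d r + B * q = d' r + B * q'"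
    using Suc.prems(1,2) by (intro Suc.IH) auto
  have "d r < B" "d' r < B" using Suc.prems by auto
  then have "d r = d' r \<and> q = q'"
    using * by (metis add_diff_cancel_left' mod_less mod_mult_self2 mult_cancel1 not_less_zero)
  then show ?case using * by (auto simp: less_Suc_eq)
qed simp

lemma lookup_bound_obtain:
  assumes "finite K"
  obtains B :: nat where "\<And>m i. m \<in> K \<Longrightarrow> lookup m i < B"
proof
  fix m i assume "m \<in> K"
  then have "mdeg m \<le> sum mdeg K" using assms by (intro member_le_sum) auto
  moreover have "lookup m i \<le> mdeg m"
    by (cases "i \<in> keys m") (auto simp: mdeg_def in_keys_iff intro!: member_le_sum)
  ultimately show "lookup m i < Suc (sum mdeg K)" by simp
qed

lemma poly_mapping_eqI_lessThan:
  assumes "keys m \<subseteq> {..<r}" "keys m' \<subseteq> {..<r}"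
    "\<And>i. i < r \<Longrightarrow> lookup m i = lookup m' i"
  shows "m = m'"
proof (rule poly_mapping_eqI)
  fix i show "lookup m i = lookup m' i"
  proof (cases "i < r")
    case False
    then have "i \<notin> keys m" "i \<notin> keys m'" using assms(1,2) by auto
    then show ?thesis by (simp add: in_keys_iff)
  qed (rule assms(3))
qed

lemma mono_eval_monom:
  "mono_eval (\<lambda>i. monom 1 (w i)) m = (monom 1 (\<Sum>i\<in>keys m. w i * lookup m i) :: complex poly)"
proof -
  have "(\<Prod>i\<in>I. monom 1 (w i) ^ e i) = (monom 1 (\<Sum>i\<in>I. w i * e i) :: complex poly)" if "finite I" for I e
    using that by (induction I rule: finite_induct) (auto simp: monom_power mult_monom mult.commute)
  then show ?thesis by (simp add: mono_eval_def)
qed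

text \<open>Substituting \<open>T ^ (B ^ i)\<close> for the \<open>i\<close>-th variable, with
  \<open>B\<close> larger than all exponents, sends distinct monomials to distinct powers of
  \<open>T\<close>, because the exponents are base \<open>B\<close> digits. A non-zero polynomial in
  \<open>T\<close> has a non-root.\<close>

lemma poly_ring_nonzero_peval:
  assumes "F \<in> poly_ring r" "F \<noteq> 0"
  obtains x where "peval F x \<noteq> 0"
proof -
  obtain B where B: "\<And>m i. m \<in> keys F \<Longrightarrow> lookup m i < B"
    using lookup_bound_obtain[of "keys F"] by auto
  define g where "g = (\<lambda>i. monom (1::complex) (B ^ i))"
  have deg: "mono_eval g m = monom 1 (\<Sum>i<r. B ^ i * lookup m i)"
    if "m \<in> keys F" for m
  proof -
    have "(\<Sum>i\<in>keys m. B ^ i * lookup m i) = (\<Sum>i<r. B ^ i * lookup m i)"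
      using that assms(1) by (intro sum.mono_neutral_left) (auto simp: poly_ring_iff in_keys_iff)
    then show ?thesis unfolding g_def mono_eval_monom by simp
  qed
  have "psubst (\<lambda>c. [:c:]) g F \<noteq> 0"
  proof (rule psubst_nonzero_degree[OF assms(2)])
    show "inj_on (\<lambda>m. degree (mono_eval g m)) (keys F)"
    proof (rule inj_onI)
      fix m m' assume mm: "m \<in> keys F" "m' \<in> keys F"
        "degree (mono_eval g m) = degree (mono_eval g m')"
      then have "(\<Sum>i<r. B ^ i * lookup m i) + B ^ r * 0 = (\<Sum>i<r. B ^ i * lookup m' i) + B ^ r * 0"
        by (simp add: deg degree_monom_eq)
      then have "\<forall>i<r. lookup m i = lookup m' i"
        using digit_sum_unique[of r "lookup m" B "lookup m'"] B mm by blast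
      then show "m = m'"
        using mm assms(1) by (intro poly_mapping_eqI_lessThan[of _ r]) (auto simp: poly_ring_iff)
    qed
  qed (simp add: deg)
  then obtain t where "poly (psubst (\<lambda>c. [:c:]) g F) t \<noteq> 0"
    using poly_all_0_iff_0 by blast
  moreover have "poly (psubst (\<lambda>c. [:c:]) g F) t = psubst (\<lambda>c. c) (\<lambda>i. poly (g i) t) F"
    by (subst hom_psubst[of "\<lambda>p. poly p t"]) (auto intro!: comm_ring_hom.intro ring_hom.intro simp: poly_hom.comm_ring_hom_axioms)
  ultimately show thesis using that by (simp add: peval_eq_psubst)
qed

lemma poly_ring_eqI:
  assumes "F \<in> poly_ring r" "G \<in> poly_ring r" "\<And>x. peval F x = peval G x"
  shows "F = G"
proof (rule ccontr)
  assume "F \<noteq> G"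
  then obtain x where "peval (F - G) x \<noteq> 0"
    using poly_ring_nonzero_peval[of "F - G" r] assms poly_ring_diff by auto
  then show False using assms(3)[of x] by (simp add: peval.hom_minus)
qed

subsection \<open>Algebraic dependence by counting\<close>

lemma comm_ring_hom_psubst_Cst: "comm_ring_hom (psubst Cst g :: 'v cpoly \<Rightarrow> 'w cpoly)"
  by (rule const_hom.comm_ring_hom_psubst[OF const_hom_Cst])

global_interpretation psub: comm_ring_hom "psubst Cst g :: 'v cpoly \<Rightarrow> 'w cpoly" for g
  by (rule comm_ring_hom_psubst_Cst)

lemma psubst_Cst_single: "psubst Cst g (single m c) = Cst c * mono_eval g m"
  by (rule const_hom.psubst_single[OF const_hom_Cst])

text \<open>More products than the dimension of a space containing them force a linear relation.
  Grouped by powers of \<open>\<alpha>\<close>, its coefficients become polynomials in the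
  \<open>g\<close>, and the bound \<open>e\<close> on the exponents of \<open>\<alpha>\<close>
  becomes the degree bound on \<open>\<Psi>\<close>.\<close>

lemma relation_by_counting:
  assumes "finite B" "card B < e * card (exps_upto s M)"
    and span: "\<And>i \<beta>. i < e \<Longrightarrow> \<beta> \<in> exps_upto s M \<Longrightarrow> mono_eval g \<beta> * \<alpha> ^ i \<in> cvs.span B"
  shows "\<exists>\<Psi>. \<Psi> \<noteq> 0 \<and> (\<forall>i. coeff \<Psi> i \<in> poly_ring s) \<and> degree \<Psi> < e \<and>
     eval_poly (psubst Cst g) \<Psi> \<alpha> = 0"
proof -
  let ?I = "{..<e} \<times> exps_upto s M"
  have "\<exists>c. (\<exists>i\<in>?I. c i \<noteq> 0) \<and> (\<Sum>i\<in>?I. Cst (c i) * (mono_eval g (snd i) * \<alpha> ^ fst i)) = 0"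
    using assms by (intro linear_dependence[of _ B]) auto
  then obtain c where c: "\<exists>i\<in>?I. c i \<noteq> 0"
    "(\<Sum>i\<in>?I. Cst (c i) * (mono_eval g (snd i) * \<alpha> ^ fst i)) = 0" by auto
  define C where "C i = (\<Sum>\<beta>\<in>exps_upto s M. single \<beta> (c (i, \<beta>)))" for i
  define \<Psi> where "\<Psi> = (\<Sum>i<e. monom (C i) i)"
  have coeff: "coeff \<Psi> i = (if i < e then C i else 0)" for i
    by (simp add: \<Psi>_def coeff_sum)
  have lookup: "lookup (C i) \<beta> = c (i, \<beta>)" if "\<beta> \<in> exps_upto s M" for i \<beta>
    using that by (simp add: C_def lookup_sum lookup_single when_def)
  obtain i \<beta> where i: "i < e" "\<beta> \<in> exps_upto s M" "c (i, \<beta>) \<noteq> 0" using c(1) by auto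
  then have "coeff \<Psi> i \<noteq> 0" using lookup[of \<beta> i] coeff by auto
  then have 1: "\<Psi> \<noteq> 0" by auto
  have 2: "\<forall>i. coeff \<Psi> i \<in> poly_ring s"
    unfolding coeff C_def
    by (auto intro!: poly_ring_sum poly_ring_upto[OF polys_upto_single] simp: exps_upto_def)
  have "degree \<Psi> \<le> e - 1"
    by (rule degree_le) (auto simp: coeff)
  then have 3: "degree \<Psi> < e" using i(1) by simp
  have "eval_poly (psubst Cst g) \<Psi> \<alpha> = (\<Sum>i<e. psubst Cst g (C i) * \<alpha> ^ i)"
    unfolding \<Psi>_def by (simp add: psub.eval_poly_sum psub.eval_poly_monom)
  also have "\<dots> = (\<Sum>i<e. \<Sum>\<beta>\<in>exps_upto s M. Cst (c (i, \<beta>)) * (mono_eval g \<beta> * \<alpha> ^ i))"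
    by (simp add: C_def psub.hom_sum psubst_Cst_single sum_distrib_right mult.assoc)
  also have "\<dots> = 0"
    using c(2) by (simp add: sum.cartesian_product case_prod_beta)
  finally show ?thesis using 1 2 3 by blast
qed

text \<open>The counting form of the bound on transcendence degree: \<open>r + 1\<close> polynomials
  in \<open>r\<close> variables are algebraically dependent. Whether \<open>\<alpha>\<close> really
  occurs in the relation is left open here.\<close>

lemma algebraic_over:
  assumes g: "\<And>i. i < r \<Longrightarrow> g i \<in> poly_ring r" and \<alpha>: "\<alpha> \<in> poly_ring r"
  shows "\<exists>\<Psi>. \<Psi> \<noteq> 0 \<and> (\<forall>i. coeff \<Psi> i \<in> poly_ring r) \<and> eval_poly (psubst Cst g) \<Psi> \<alpha> = 0"
proof -
  obtain \<kappa> where \<kappa>: "\<And>i. i < r \<Longrightarrow> g i \<in> polys_upto r \<kappa>"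
    using poly_ring_obtain_upto_finite[of "{..<r}" g r] g by auto
  obtain \<kappa>' where \<kappa>': "\<alpha> \<in> polys_upto r \<kappa>'" using \<alpha> poly_ring_obtain_upto by blast
  \<comment> \<open>All products below have degree at most \<open>c * M\<close>, so they lie in a
    space whose dimension is at most \<open>c ^ r\<close> times the number of exponent vectors
    \<open>\<beta>\<close>. With \<open>M = c ^ r\<close> the \<open>Suc M\<close> powers of
    \<open>\<alpha>\<close> exceed this factor.\<close>
  define c where "c = \<kappa> + \<kappa>' + 1"
  define M where "M = c ^ r"
  let ?B = "(\<lambda>m. single m (1::complex)) ` exps_upto r (c * M)"
  have "card ?B \<le> card (exps_upto r (c * M))" by (rule card_image_le) simp
  also have "\<dots> \<le> c ^ r * card (exps_upto r M)"
    unfolding card_exps_upto by (rule binomial_scale_le) (simp add: c_def)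
  also have "\<dots> < Suc M * card (exps_upto r M)"
    by (simp add: M_def card_exps_upto)
  finally have "card ?B < Suc M * card (exps_upto r M)" .
  moreover have "mono_eval g \<beta> * \<alpha> ^ i \<in> cvs.span ?B" if "i < Suc M" "\<beta> \<in> exps_upto r M" for i \<beta>
  proof (rule polys_upto_span)
    have "mono_eval g \<beta> * \<alpha> ^ i \<in> polys_upto r (mdeg \<beta> * \<kappa> + i * \<kappa>')"
      using that \<kappa> by (intro polys_upto_mult polys_upto_power mono_eval_polys_upto[of _ r] \<kappa>') (auto simp: exps_upto_def)
    moreover have "mdeg \<beta> * \<kappa> + i * \<kappa>' \<le> M * \<kappa> + M * \<kappa>'"
      using that by (intro add_mono mult_le_mono1) (auto simp: exps_upto_def)
    then have "mdeg \<beta> * \<kappa> + i * \<kappa>' \<le> c * M"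
      unfolding c_def by (simp add: algebra_simps)
    ultimately show "mono_eval g \<beta> * \<alpha> ^ i \<in> polys_upto r (c * M)" by (rule polys_upto_mono)
  qed
  ultimately show ?thesis
    using relation_by_counting[of ?B "Suc M" r M g \<alpha>] by auto
qed

subsection \<open>Partial derivatives\<close>

text \<open>The truncated subtraction is harmless: where it truncates, the factor
  \<open>lookup m i\<close> is \<open>0\<close>.\<close>

definition pdiff :: "'v \<Rightarrow> 'v cpoly \<Rightarrow> 'v cpoly" where
  "pdiff i F = (\<Sum>m\<in>keys F. single (m - single i 1)
      (lookup F m * of_nat (lookup m i)))"

lemma pdiff_0 [simp]: "pdiff i 0 = 0"
  by (simp add: pdiff_def)

lemma pdiff_poly_ring: "F \<in> poly_ring r \<Longrightarrow> pdiff i F \<in> poly_ring r"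
  unfolding pdiff_def
proof (rule poly_ring_sum)
  fix m assume F: "F \<in> poly_ring r" and m: "m \<in> keys F"
  have "keys (m - single i 1) \<subseteq> keys m"
    by (auto simp: in_keys_iff lookup_minus)
  then show "single (m - single i 1)
      (lookup F m * of_nat (lookup m i)) \<in> poly_ring r"
    using F m by (auto simp: poly_ring_iff)
qed

lemma mono_eval_has_field_derivative:
  fixes \<gamma> :: "'v \<Rightarrow> complex \<Rightarrow> complex"
  assumes "finite I" "keys m \<subseteq> I"
    and "\<And>i. i \<in> I \<Longrightarrow> (\<gamma> i has_field_derivative \<gamma>' i) (at t)"
  shows "((\<lambda>t. mono_eval (\<lambda>i. \<gamma> i t) m) has_field_derivative
     (\<Sum>i\<in>I. of_nat (lookup m i) * mono_eval (\<lambda>i. \<gamma> i t) (m - single i 1) * \<gamma>' i)) (at t)"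
proof -
  have "((\<lambda>t. \<Prod>i\<in>I. \<gamma> i t ^ lookup m i) has_field_derivative
     (\<Sum>i\<in>I. (of_nat (lookup m i) * (\<gamma>' i * \<gamma> i t ^ (lookup m i - Suc 0))) *
        (\<Prod>j\<in>I - {i}. \<gamma> j t ^ lookup m j))) (at t)"
    using assms(3) by (intro has_field_derivative_prod DERIV_power)
  moreover have "mono_eval (\<lambda>i. \<gamma> i t) (m - single i 1) =
      \<gamma> i t ^ (lookup m i - 1) * (\<Prod>j\<in>I - {i}. \<gamma> j t ^ lookup m j)"
    if "i \<in> I" for i
  proof -
    have "keys (m - single i 1) \<subseteq> I"
      using assms(2) by (auto simp: in_keys_iff lookup_minus)
    then have "mono_eval (\<lambda>i. \<gamma> i t) (m - single i 1) =
        (\<Prod>j\<in>I. \<gamma> j t ^ lookup (m - single i 1) j)"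
      by (rule mono_eval_superset[OF assms(1)])
    also have "\<dots> = \<gamma> i t ^ (lookup m i - 1) * (\<Prod>j\<in>I - {i}. \<gamma> j t ^ lookup m j)"
      using assms(1) that by (subst prod.remove[of _ i])
        (auto simp: lookup_minus lookup_single when_def intro!: prod.cong)
    finally show ?thesis .
  qed
  moreover have "(\<lambda>t. mono_eval (\<lambda>i. \<gamma> i t) m) = (\<lambda>t. \<Prod>i\<in>I. \<gamma> i t ^ lookup m i)"
    using assms(1,2) by (simp add: mono_eval_superset)
  ultimately show ?thesis
    by (simp add: mult_ac)
qed

lemma peval_has_field_derivative:
  fixes \<gamma> :: "'v \<Rightarrow> complex \<Rightarrow> complex"
  assumes "finite I" "pvars F \<subseteq> I"
    and "\<And>i. i \<in> I \<Longrightarrow> (\<gamma> i has_field_derivative \<gamma>' i) (at t)"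
  shows "((\<lambda>t. peval F (\<lambda>i. \<gamma> i t)) has_field_derivative
     (\<Sum>i\<in>I. peval (pdiff i F) (\<lambda>i. \<gamma> i t) * \<gamma>' i)) (at t)"
proof -
  let ?D = "\<lambda>m i. mono_eval (\<lambda>i. \<gamma> i t) (m - single i 1)"
  have "((\<lambda>t. \<Sum>m\<in>keys F. lookup F m * mono_eval (\<lambda>i. \<gamma> i t) m) has_field_derivative
     (\<Sum>m\<in>keys F. lookup F m *
        (\<Sum>i\<in>I. of_nat (lookup m i) * ?D m i * \<gamma>' i))) (at t)"
    using assms by (intro DERIV_sum DERIV_cmult mono_eval_has_field_derivative) (auto simp: pvars_def)
  also have "(\<Sum>m\<in>keys F. lookup F m *
        (\<Sum>i\<in>I. of_nat (lookup m i) * ?D m i * \<gamma>' i)) =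
      (\<Sum>i\<in>I. \<Sum>m\<in>keys F. lookup F m * of_nat (lookup m i) * ?D m i * \<gamma>' i)"
    by (subst sum.swap) (simp add: sum_distrib_left mult.assoc)
  also have "\<dots> = (\<Sum>i\<in>I. peval (pdiff i F) (\<lambda>i. \<gamma> i t) * \<gamma>' i)"
    by (simp add: pdiff_def peval.hom_sum peval_single sum_distrib_right)
  finally show ?thesis
    by (simp add: peval_eq_psubst psubst_def)
qed

lemma peval_fun_upd_has_field_derivative:
  fixes x :: "'v \<Rightarrow> complex"
  shows "((\<lambda>t. peval F (x(i := t))) has_field_derivative peval (pdiff i F) x) (at (x i))"
proof -
  let ?I = "insert i (pvars F)"
  have "finite ?I" by (auto simp: pvars_def)
  then have "((\<lambda>t. peval F (\<lambda>j. if j = i then t else x j)) has_field_derivative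
     (\<Sum>j\<in>?I. peval (pdiff j F) (\<lambda>j. if j = i then x i else x j) * (if j = i then 1 else 0))) (at (x i))"
    by (intro peval_has_field_derivative) auto
  moreover have "(\<lambda>t. peval F (\<lambda>j. if j = i then t else x j)) = (\<lambda>t. peval F (x(i := t)))"
    by (intro ext arg_cong2[where f=peval] refl) auto
  moreover have "(\<lambda>j. if j = i then x i else x j) = x" by auto
  ultimately show ?thesis using \<open>finite ?I\<close> by (simp add: if_distrib sum.delta cong: if_cong)
qed

section \<open>Algebraic elements over the ring generated by \<open>g\<close>, and generic
  fibres\<close>

subsection \<open>Polynomials in one further variable\<close>

text \<open>The coefficients stand for polynomials in the \<open>g i\<close>, kept formal so that
  they can also be evaluated at a point \<open>b\<close> of the target space.\<close>

definition poly_ring_ext :: "nat \<Rightarrow> nat cpoly poly set" where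
  "poly_ring_ext r = {\<Phi>. \<forall>i. coeff \<Phi> i \<in> poly_ring r}"

lemma poly_ring_ext_simps [simp]: "0 \<in> poly_ring_ext r" "1 \<in> poly_ring_ext r"
  by (auto simp: poly_ring_ext_def coeff_1)

lemma poly_ring_ext_add: "\<Phi> \<in> poly_ring_ext r \<Longrightarrow> \<Psi> \<in> poly_ring_ext r \<Longrightarrow> \<Phi> + \<Psi> \<in> poly_ring_ext r"
  by (auto simp: poly_ring_ext_def intro: poly_ring_add)

lemma poly_ring_ext_diff: "\<Phi> \<in> poly_ring_ext r \<Longrightarrow> \<Psi> \<in> poly_ring_ext r \<Longrightarrow> \<Phi> - \<Psi> \<in> poly_ring_ext r"
  by (auto simp: poly_ring_ext_def intro: poly_ring_diff)

lemma poly_ring_ext_mult: "\<Phi> \<in> poly_ring_ext r \<Longrightarrow> \<Psi> \<in> poly_ring_ext r \<Longrightarrow> \<Phi> * \<Psi> \<in> poly_ring_ext r"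
  by (auto simp: poly_ring_ext_def coeff_mult intro!: poly_ring_sum poly_ring_mult)

lemma poly_ring_ext_smult: "F \<in> poly_ring r \<Longrightarrow> \<Phi> \<in> poly_ring_ext r \<Longrightarrow> smult F \<Phi> \<in> poly_ring_ext r"
  by (auto simp: poly_ring_ext_def intro: poly_ring_mult)

lemma poly_ring_ext_monom: "F \<in> poly_ring r \<Longrightarrow> monom F i \<in> poly_ring_ext r"
  by (auto simp: poly_ring_ext_def)

lemma poly_ring_ext_const: "F \<in> poly_ring r \<Longrightarrow> [:F:] \<in> poly_ring_ext r"
  using poly_ring_ext_monom[of F r 0] by (simp add: monom_0)

lemma poly_ring_ext_sum: "(\<And>i. i \<in> A \<Longrightarrow> \<Phi> i \<in> poly_ring_ext r) \<Longrightarrow> sum \<Phi> A \<in> poly_ring_ext r"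
  by (induction A rule: infinite_finite_induct) (auto simp: poly_ring_ext_add)

lemma poly_ring_ext_prod: "(\<And>i. i \<in> A \<Longrightarrow> \<Phi> i \<in> poly_ring_ext r) \<Longrightarrow> prod \<Phi> A \<in> poly_ring_ext r"
  by (induction A rule: infinite_finite_induct) (auto simp: poly_ring_ext_mult)

lemma poly_ring_ext_power: "\<Phi> \<in> poly_ring_ext r \<Longrightarrow> \<Phi> ^ j \<in> poly_ring_ext r"
  by (induction j) (auto simp: poly_ring_ext_mult)

lemma poly_ring_ext_pderiv: "\<Phi> \<in> poly_ring_ext r \<Longrightarrow> pderiv \<Phi> \<in> poly_ring_ext r"
proof -
  assume \<Phi>: "\<Phi> \<in> poly_ring_ext r"
  have "of_nat n = (Cst (of_nat n) :: nat cpoly)" for n by simp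
  then have "of_nat n \<in> poly_ring r" for n by (metis poly_ring_simps(3))
  then show ?thesis
    using \<Phi> unfolding poly_ring_ext_def by (auto simp: coeff_pderiv simp del: of_nat_Suc intro!: poly_ring_mult)
qed

lemma poly_ring_ext_psubst:
  assumes "F \<in> poly_ring s" "\<And>i. i < s \<Longrightarrow> P i \<in> poly_ring_ext r"
  shows "psubst (\<lambda>c. [:Cst c:]) P F \<in> poly_ring_ext r"
  unfolding psubst_def mono_eval_def using assms
  by (intro poly_ring_ext_sum poly_ring_ext_mult poly_ring_ext_prod poly_ring_ext_power poly_ring_ext_const)
    (auto simp: poly_ring_iff[of F])

lemma comm_ring_hom_eval_poly:
  assumes "comm_ring_hom h" shows "comm_ring_hom (\<lambda>\<Phi>. eval_poly h \<Phi> a)"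
proof -
  interpret h: comm_ring_hom h by fact
  interpret map_poly_comm_ring_hom h ..
  show ?thesis
    by standard (auto simp: eval_poly_def hom_distribs)
qed

text \<open>The coefficients do not form a field, so each cancellation of a leading term costs one
  factor \<open>lead_coeff \<Phi>\<close>.\<close>

lemma pseudo_division:
  assumes "\<Phi> \<in> poly_ring_ext r" "\<Phi> \<noteq> 0" "W \<in> poly_ring_ext r"
  shows "\<exists>c U R. U \<in> poly_ring_ext r \<and> R \<in> poly_ring_ext r \<and>
     smult (lead_coeff \<Phi> ^ c) W = \<Phi> * U + R \<and> (R = 0 \<or> degree R < degree \<Phi>)"
  using assms(3)
proof (induction "degree W" arbitrary: W rule: less_induct)
  case less
  show ?case
  proof (cases "W = 0 \<or> degree W < degree \<Phi>")
    case True
    then show ?thesis using less.prems by (intro exI[of _ 0] exI[of _ 0] exI[of _ W]) auto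
  next
    case False
    define T where "T = monom (lead_coeff W) (degree W - degree \<Phi>)"
    define W' where "W' = smult (lead_coeff \<Phi>) W - \<Phi> * T"
    have lcW: "lead_coeff W \<in> poly_ring r" and lc: "lead_coeff \<Phi> \<in> poly_ring r"
      using less.prems assms(1) by (auto simp: poly_ring_ext_def)
    have T: "T \<in> poly_ring_ext r" unfolding T_def by (rule poly_ring_ext_monom[OF lcW])
    have W': "W' \<in> poly_ring_ext r"
      unfolding W'_def using less.prems assms(1) T lc
      by (intro poly_ring_ext_diff poly_ring_ext_smult poly_ring_ext_mult)
    have degT: "degree (\<Phi> * T) = degree W"
      using False assms(2) by (subst degree_mult_eq) (auto simp: T_def degree_monom_eq)
    have "lead_coeff (\<Phi> * T) = lead_coeff \<Phi> * lead_coeff W"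
      using False by (simp add: lead_coeff_mult T_def degree_monom_eq)
    then have "coeff W' (degree W) = 0" using degT by (simp add: W'_def)
    moreover have "degree W' \<le> degree W"
      unfolding W'_def using degT by (intro degree_diff_le) auto
    ultimately have "W' = 0 \<or> degree W' < degree W"
      by (metis leading_coeff_0_iff le_neq_implies_less)
    then have "\<exists>c U R. U \<in> poly_ring_ext r \<and> R \<in> poly_ring_ext r \<and>
       smult (lead_coeff \<Phi> ^ c) W' = \<Phi> * U + R \<and> (R = 0 \<or> degree R < degree \<Phi>)"
    proof
      assume "W' = 0"
      then show ?thesis by (intro exI[of _ 0]) auto
    qed (use less.hyps W' in blast)
    then obtain c U R where IH: "U \<in> poly_ring_ext r" "R \<in> poly_ring_ext r"
       "smult (lead_coeff \<Phi> ^ c) W' = \<Phi> * U + R" "R = 0 \<or> degree R < degree \<Phi>" by blast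
    have "smult (lead_coeff \<Phi> ^ Suc c) W = smult (lead_coeff \<Phi> ^ c) (W' + \<Phi> * T)"
      by (simp add: W'_def mult.commute)
    also have "\<dots> = \<Phi> * (U + smult (lead_coeff \<Phi> ^ c) T) + R"
      by (simp add: smult_add_right IH(3) algebra_simps)
    finally show ?thesis
      using IH T lc by (intro exI[of _ "Suc c"] exI[of _ "U + smult (lead_coeff \<Phi> ^ c) T"] exI[of _ R])
        (auto intro!: poly_ring_ext_add poly_ring_ext_smult poly_ring_power)
  qed
qed

subsection \<open>Primitive elements over algebraically independent polynomials\<close>

text \<open>\<open>indep\<close> makes \<open>\<sigma>\<close> below injective on
  \<open>poly_ring r\<close>. Elements of \<open>poly_ring r\<close> thus name elements of the
  subring \<open>\<complex>[g]\<close>, and \<open>ev \<alpha>\<close> evaluates a polynomial over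
  that subring at \<open>\<alpha>\<close>.\<close>

locale alg_indep =
  fixes r :: nat and g :: "nat \<Rightarrow> nat cpoly"
  assumes g_ring: "\<And>i. i < r \<Longrightarrow> g i \<in> poly_ring r"
    and indep: "\<And>F. F \<in> poly_ring r \<Longrightarrow> psubst Cst g F = 0 \<Longrightarrow> F = 0"
begin

abbreviation \<sigma> :: "nat cpoly \<Rightarrow> nat cpoly" where "\<sigma> \<equiv> psubst Cst g"

abbreviation ev :: "nat cpoly \<Rightarrow> nat cpoly poly \<Rightarrow> nat cpoly" where
  "ev \<alpha> \<Phi> \<equiv> eval_poly \<sigma> \<Phi> \<alpha>"

sublocale ev: comm_ring_hom "\<lambda>\<Phi>. eval_poly \<sigma> \<Phi> \<alpha>" for \<alpha>
  by (rule comm_ring_hom_eval_poly[OF comm_ring_hom_psubst_Cst])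

lemma map_poly_\<sigma>_pCons: "map_poly \<sigma> (pCons F \<Phi>) = pCons (\<sigma> F) (map_poly \<sigma> \<Phi>)"
  by (intro poly_eqI) (simp add: coeff_map_poly coeff_pCons split: nat.splits)

lemma ev_const [simp]: "ev \<alpha> [:F:] = \<sigma> F"
  by (simp add: eval_poly_def map_poly_\<sigma>_pCons)

lemma ev_smult: "ev \<alpha> (smult F \<Phi>) = \<sigma> F * ev \<alpha> \<Phi>"
  using ev.hom_mult[of "[:F:]" \<Phi>] by simp

lemma ev_X: "ev \<alpha> [:0, 1:] = \<alpha>"
  by (simp add: eval_poly_def map_poly_\<sigma>_pCons)

lemma ev_pCons: "ev \<alpha> (pCons F \<Phi>) = \<sigma> F + \<alpha> * ev \<alpha> \<Phi>"
  by (simp add: eval_poly_def map_poly_\<sigma>_pCons)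

lemma \<sigma>_ring: "F \<in> poly_ring r \<Longrightarrow> \<sigma> F \<in> poly_ring r"
  by (rule psubst_Cst_poly_ring[OF _ g_ring])

lemma ev_sum: "ev \<alpha> \<Phi> = (\<Sum>i\<le>degree \<Phi>. \<alpha> ^ i * \<sigma> (coeff \<Phi> i))"
  by (rule eval_poly_as_sum) simp

lemma ev_ring: "\<alpha> \<in> poly_ring r \<Longrightarrow> \<Phi> \<in> poly_ring_ext r \<Longrightarrow> ev \<alpha> \<Phi> \<in> poly_ring r"
  unfolding ev_sum by (intro poly_ring_sum poly_ring_mult poly_ring_power \<sigma>_ring) (auto simp: poly_ring_ext_def)

text \<open>A minimal polynomial of \<open>\<alpha>\<close> over the fraction field of
  \<open>\<complex>[g]\<close> with denominators cleared; neither a monic nor a primitive one is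
  demanded, so no fraction field has to be constructed.\<close>

definition minrel :: "nat cpoly \<Rightarrow> nat cpoly poly \<Rightarrow> bool" where
  "minrel \<alpha> \<Phi> \<longleftrightarrow> \<Phi> \<in> poly_ring_ext r \<and> \<Phi> \<noteq> 0 \<and> ev \<alpha> \<Phi> = 0 \<and> 0 < degree \<Phi> \<and>
     (\<forall>\<Psi>\<in>poly_ring_ext r. ev \<alpha> \<Psi> = 0 \<longrightarrow> \<Psi> = 0 \<or> degree \<Phi> \<le> degree \<Psi>)"

lemma minrel_exists:
  assumes "\<alpha> \<in> poly_ring r"
  obtains \<Phi> where "minrel \<alpha> \<Phi>"
proof -
  let ?P = "\<lambda>\<Psi>. \<Psi> \<in> poly_ring_ext r \<and> \<Psi> \<noteq> 0 \<and> ev \<alpha> \<Psi> = 0"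
  have "\<exists>\<Psi>. ?P \<Psi>"
    using algebraic_over[of r g, OF g_ring assms] unfolding poly_ring_ext_def by blast
  then obtain \<Phi> where \<Phi>: "?P \<Phi>" "\<And>\<Psi>. ?P \<Psi> \<Longrightarrow> degree \<Phi> \<le> degree \<Psi>"
    using ex_has_least_nat[of ?P _ degree] by blast
  \<comment> \<open>A constant relation would be a relation among the \<open>g\<close> alone,
    contrary to independence.\<close>
  have "0 < degree \<Phi>"
  proof (rule ccontr)
    assume "\<not> 0 < degree \<Phi>"
    then obtain F where F: "\<Phi> = [:F:]" by (auto elim: degree_eq_zeroE)
    then have "F \<in> poly_ring r" using \<Phi>(1) by (auto simp: poly_ring_ext_def split: nat.splits dest: spec[of _ 0])
    then show False using \<Phi>(1) indep[of F] F by simp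
  qed
  then show thesis using that[of \<Phi>] \<Phi> unfolding minrel_def by blast
qed

text \<open>Splitting off the constant term \<open>q\<close> of the minimal relation of
  \<open>\<beta> = ev \<alpha> A\<close> gives
  \<open>\<sigma> q + \<beta> * ev \<beta> \<Psi>' = 0\<close>, so
  \<open>- ev \<beta> \<Psi>'\<close> inverts \<open>\<beta>\<close> up to the denominator
  \<open>q\<close>.\<close>

lemma inverse_mod:
  assumes "\<alpha> \<in> poly_ring r" "A \<in> poly_ring_ext r" "ev \<alpha> A \<noteq> 0"
  obtains q C where "q \<in> poly_ring r" "q \<noteq> 0" "C \<in> poly_ring_ext r" "ev \<alpha> A * ev \<alpha> C = \<sigma> q"
proof -
  let ?\<beta> = "ev \<alpha> A"
  obtain \<Psi> where \<Psi>: "minrel ?\<beta> \<Psi>"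
    using minrel_exists[OF ev_ring[OF assms(1,2)]] .
  obtain q \<Psi>' where eq: "\<Psi> = pCons q \<Psi>'" by (cases \<Psi>)
  have q: "q \<in> poly_ring r" and \<Psi>': "\<Psi>' \<in> poly_ring_ext r"
  proof -
    have "coeff (pCons q \<Psi>') i \<in> poly_ring r" for i
      using \<Psi> unfolding eq minrel_def poly_ring_ext_def by blast
    from this[of 0] this[of "Suc _"] show "q \<in> poly_ring r" "\<Psi>' \<in> poly_ring_ext r"
      by (auto simp: poly_ring_ext_def)
  qed
  have rel: "\<sigma> q + ?\<beta> * ev ?\<beta> \<Psi>' = 0"
    using \<Psi> by (simp add: minrel_def eq ev_pCons)
  have "\<Psi>' \<noteq> 0" using \<Psi> by (auto simp: minrel_def eq)
  \<comment> \<open>Without constant term, \<open>\<beta>\<close> could be cancelled and a relation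
    of smaller degree would remain.\<close>
  have "q \<noteq> 0"
  proof
    assume "q = 0"
    then have "ev ?\<beta> \<Psi>' = 0" using rel assms(3) by simp
    then have "degree \<Psi> \<le> degree \<Psi>'" using \<Psi> \<Psi>' \<open>\<Psi>' \<noteq> 0\<close> by (auto simp: minrel_def)
    then show False using \<open>\<Psi>' \<noteq> 0\<close> by (simp add: eq)
  qed
  \<comment> \<open>\<open>- \<Psi>'\<close> composed with \<open>A\<close>: a polynomial in
    \<open>\<beta>\<close> is rewritten as a polynomial in \<open>\<alpha>\<close>.\<close>
  define C where "C = - (\<Sum>i\<le>degree \<Psi>'. A ^ i * [:coeff \<Psi>' i:])"
  have "ev \<alpha> C = - ev ?\<beta> \<Psi>'"
    unfolding C_def ev_sum[of \<Psi>' ?\<beta>] by (simp add: ev.hom_uminus ev.hom_sum ev_smult ev.hom_power mult.commute)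
  then have "?\<beta> * ev \<alpha> C = \<sigma> q" using rel by (simp add: add_eq_0_iff2)
  moreover have "C \<in> poly_ring_ext r"
  proof -
    have "(\<Sum>i\<le>degree \<Psi>'. A ^ i * [:coeff \<Psi>' i:]) \<in> poly_ring_ext r"
      using \<Psi>' assms(2) by (intro poly_ring_ext_sum poly_ring_ext_mult poly_ring_ext_power poly_ring_ext_const)
        (auto simp: poly_ring_ext_def)
    then show ?thesis unfolding C_def using poly_ring_ext_diff[of 0] by auto
  qed
  ultimately show thesis using that q \<open>q \<noteq> 0\<close> by blast
qed

lemma peval_ev:
  assumes "\<And>i. i < r \<Longrightarrow> peval (g i) x = b i" "\<Phi> \<in> poly_ring_ext r"
  shows "peval (ev \<alpha> \<Phi>) x = eval_poly (\<lambda>F. peval F b) \<Phi> (peval \<alpha> x)"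
proof -
  have "peval (\<sigma> (coeff \<Phi> i)) x = peval (coeff \<Phi> i) b" for i
    unfolding peval_psubst using assms by (intro peval_cong) (auto simp: poly_ring_ext_def poly_ring_def)
  then show ?thesis
    unfolding ev_sum by (subst eval_poly_as_sum)
      (auto simp: peval.hom_sum peval.hom_mult peval.hom_power)
qed

end

text \<open>The variables \<open>r, \<dots>, 2r - 1\<close> are the coefficients of a generic linear form.\<close>

definition with_params :: "nat \<Rightarrow> (nat \<Rightarrow> nat cpoly) \<Rightarrow> nat \<Rightarrow> nat cpoly" where
  "with_params r g i = (if i < r then g i else Var i)"

lemma poly_ring_mono: "r \<le> s \<Longrightarrow> F \<in> poly_ring r \<Longrightarrow> F \<in> poly_ring s"
  by (force simp: poly_ring_iff)

lemma peval_Var [simp]: "peval (Var i) x = x i"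
  by (simp add: peval_single)

lemma peval_Cst [simp]: "peval (Cst c) x = c"
  by (simp add: peval_single)

lemma poly_ring_pvars: "F \<in> poly_ring r \<Longrightarrow> i \<in> pvars F \<Longrightarrow> i < r"
  by (auto simp: poly_ring_def)

context alg_indep
begin

lemma alg_indep_with_params: "alg_indep (2 * r) (with_params r g)"
proof
  fix i assume "i < 2 * r"
  then show "with_params r g i \<in> poly_ring (2 * r)"
    by (auto simp: with_params_def intro: poly_ring_Var poly_ring_mono[OF _ g_ring])
next
  fix F assume F: "F \<in> poly_ring (2 * r)" "psubst Cst (with_params r g) F = 0"
  have "peval F x = 0" for x
  proof -
    \<comment> \<open>Fixing the parameters at the numbers \<open>x i\<close> leaves a relation
      among the \<open>g\<close> alone, to which \<open>indep\<close> applies; this is done for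
      every choice of the parameters.\<close>
    define F' where "F' = psubst Cst (\<lambda>i. if i < r then Var i else Cst (x i)) F"
    have F': "F' \<in> poly_ring r"
      unfolding F'_def using F(1) by (rule psubst_Cst_poly_ring) (auto intro: poly_ring_Var)
    have "\<sigma> F' = 0"
    proof (rule poly_ring_eqI[OF \<sigma>_ring[OF F']])
      fix y
      let ?z = "\<lambda>i. if i < r then y i else x i"
      have g: "peval (g i) ?z = peval (g i) y" if "i < r" for i
        using g_ring[OF that] by (intro peval_cong) (auto dest: poly_ring_pvars)
      have "peval (\<sigma> F') y = peval F (\<lambda>i. peval (with_params r g i) ?z)"
        unfolding F'_def peval_psubst by (intro peval_cong) (auto simp: with_params_def g)
      also have "\<dots> = peval (psubst Cst (with_params r g) F) ?z" by (simp add: peval_psubst)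
      finally show "peval (\<sigma> F') y = peval 0 y" using F(2) by simp
    qed simp
    then have "F' = 0" using indep F' by blast
    then have "peval F' x = 0" by simp
    then have "peval F (\<lambda>i. peval (if i < r then Var i else Cst (x i)) x) = 0"
      by (simp add: F'_def peval_psubst)
    also have "(\<lambda>i. peval (if i < r then Var i else Cst (x i)) x) = x" by auto
    finally show ?thesis .
  qed
  then show "F = 0" using poly_ring_nonzero_peval[OF F(1)] by blast
qed

text \<open>Differentiating the minimal relation of the generic linear form \<open>\<Sum> \<lambda>\<^sub>i x\<^sub>i\<close> with respect
  to \<open>\<lambda>\<^sub>i\<close> expresses \<open>x\<^sub>i\<close> rationally in that form; then the \<open>\<lambda>\<^sub>i\<close> are specialised.\<close>

lemma primitive_linear_form:
  obtains lf l A B where "lf = (\<Sum>i<r. Cst (l i) * Var i)" "A \<in> poly_ring_ext r" "ev lf A \<noteq> 0"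
    "\<forall>i<r. B i \<in> poly_ring_ext r" "\<forall>i<r. Var i * ev lf A = ev lf (B i)"
proof -
  interpret E: alg_indep "2 * r" "with_params r g" by (rule alg_indep_with_params)
  define lx :: "nat cpoly" where "lx = (\<Sum>i<r. Var (r + i) * Var i)"
  have lx: "lx \<in> poly_ring (2 * r)"
    unfolding lx_def by (intro poly_ring_sum poly_ring_mult poly_ring_Var) auto
  obtain \<Phi> where \<Phi>: "E.minrel lx \<Phi>" using E.minrel_exists[OF lx] .
  define A where "A = pderiv \<Phi>"
  \<comment> \<open>With \<open>\<Phi> = \<Sum>\<^sub>j \<Phi>\<^sub>j T\<^sup>j\<close>, the
    derivative of \<open>\<Phi>(lx) = 0\<close> with respect to \<open>\<lambda>\<^sub>i\<close>
    reads \<open>x\<^sub>i \<Phi>'(lx) + \<Sum>\<^sub>j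
    (\<partial>\<Phi>\<^sub>j/\<partial>\<lambda>\<^sub>i) lx\<^sup>j = 0\<close>. \<open>A\<close>
    and \<open>B i\<close> are its two parts.\<close>
  define B where "B i = map_poly (\<lambda>F. - pdiff (r + i) F) \<Phi>" for i
  have coeffB: "coeff (B i) j = - pdiff (r + i) (coeff \<Phi> j)" for i j
    by (simp add: B_def coeff_map_poly)
  have A: "A \<in> poly_ring_ext (2 * r)"
    using \<Phi> by (auto simp: A_def E.minrel_def intro: poly_ring_ext_pderiv)
  have B: "B i \<in> poly_ring_ext (2 * r)" for i
    using \<Phi> unfolding poly_ring_ext_def mem_Collect_eq coeffB
    by (auto simp: E.minrel_def poly_ring_ext_def intro!: poly_ring_uminus pdiff_poly_ring)
  \<comment> \<open>In characteristic \<open>0\<close> the derivative is non-zero and of smaller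
    degree, so minimality keeps it from vanishing at \<open>lx\<close>.\<close>
  have "A \<noteq> 0" "degree A < degree \<Phi>"
    using \<Phi> by (auto simp: A_def E.minrel_def pderiv_eq_0_iff degree_pderiv)
  then have evA: "E.ev lx A \<noteq> 0" using \<Phi> A unfolding E.minrel_def by force
  have rel: "Var i * E.ev lx A = E.ev lx (B i)" if i: "i < r" for i
  proof (rule poly_ring_eqI[of _ "2 * r"])
    show "Var i * E.ev lx A \<in> poly_ring (2 * r)"
      using i by (intro poly_ring_mult poly_ring_Var E.ev_ring lx A) auto
    show "E.ev lx (B i) \<in> poly_ring (2 * r)" by (rule E.ev_ring[OF lx B])
    fix x
    define y where "y = (\<lambda>j. peval (with_params r g j) x)"
    define L where "L = peval lx x"
    let ?n = "r + i"
    have y: "peval (with_params r g j) (x(?n := t)) = (y(?n := t)) j" if "j < 2 * r" for j t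
    proof (cases "j < r")
      case True
      then have "peval (g j) (x(?n := t)) = peval (g j) x"
        using g_ring[OF True] by (intro peval_cong) (auto dest: poly_ring_pvars)
      then show ?thesis using True i by (simp add: y_def with_params_def)
    qed (auto simp: y_def with_params_def)
    \<comment> \<open>When only \<open>\<lambda>\<^sub>i\<close> moves, the linear form moves with
      constant slope \<open>x i\<close>, while the values of the \<open>g\<close> stay
      fixed.\<close>
    have L: "peval lx (x(?n := t)) = L + (t - x ?n) * x i" for t
    proof -
      have "peval lx (x(?n := t)) = (\<Sum>j<r. (if j = i then t else x (r + j)) * x j)"
        unfolding lx_def by (simp add: peval.hom_sum peval.hom_mult)
      also have "\<dots> = (\<Sum>j<r. x (r + j) * x j + (if j = i then (t - x ?n) * x i else 0))"
        by (intro sum.cong) (auto simp: algebra_simps)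
      also have "\<dots> = L + (t - x ?n) * x i"
        using i by (simp add: sum.distrib L_def lx_def peval.hom_sum peval.hom_mult)
      finally show ?thesis .
    qed
    have yn: "y ?n = x ?n" by (simp add: y_def with_params_def)
    have "eval_poly (\<lambda>F. peval F (y(?n := t))) \<Phi> (L + (t - x ?n) * x i) = 0" for t
    proof -
      have "peval (E.ev lx \<Phi>) (x(?n := t)) = 0" using \<Phi> by (simp add: E.minrel_def)
      then show ?thesis
        using E.peval_ev[of "x(?n := t)" "y(?n := t)" \<Phi> lx] y \<Phi> L by (simp add: E.minrel_def)
    qed
    then have "(\<lambda>t. \<Sum>j\<le>degree \<Phi>. (L + (t - y ?n) * x i) ^ j * peval (coeff \<Phi> j) (y(?n := t))) = (\<lambda>t. 0)"
      by (auto simp: eval_poly_as_sum yn)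
    then have "((\<lambda>t. \<Sum>j\<le>degree \<Phi>. (L + (t - y ?n) * x i) ^ j * peval (coeff \<Phi> j) (y(?n := t)))
        has_field_derivative 0) (at (y ?n))" by simp
    moreover have "((\<lambda>t. \<Sum>j\<le>degree \<Phi>. (L + (t - y ?n) * x i) ^ j * peval (coeff \<Phi> j) (y(?n := t)))
        has_field_derivative (\<Sum>j\<le>degree \<Phi>. (of_nat j * (L ^ (j - 1) * x i)) * peval (coeff \<Phi> j) y
            + peval (pdiff ?n (coeff \<Phi> j)) y * L ^ j)) (at (y ?n))"
    proof (intro DERIV_sum)
      fix j
      have "((\<lambda>t. (L + (t - y ?n) * x i) ^ j) has_field_derivative
          of_nat j * (L ^ (j - 1) * x i)) (at (y ?n))"
        by (auto intro!: derivative_eq_intros)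
      from DERIV_mult[OF this peval_fun_upd_has_field_derivative[of "coeff \<Phi> j" y ?n]]
      show "((\<lambda>t. (L + (t - y ?n) * x i) ^ j * peval (coeff \<Phi> j) (y(?n := t))) has_field_derivative
          (of_nat j * (L ^ (j - 1) * x i)) * peval (coeff \<Phi> j) y
            + peval (pdiff ?n (coeff \<Phi> j)) y * L ^ j) (at (y ?n))"
        by simp
    qed
    ultimately have "(\<Sum>j\<le>degree \<Phi>. (of_nat j * (L ^ (j - 1) * x i)) * peval (coeff \<Phi> j) y
            + peval (pdiff ?n (coeff \<Phi> j)) y * L ^ j) = 0"
      by (rule DERIV_unique[symmetric])
    then have *: "x i * (\<Sum>j\<le>degree \<Phi>. of_nat j * L ^ (j - 1) * peval (coeff \<Phi> j) y) =
        - (\<Sum>j\<le>degree \<Phi>. L ^ j * peval (pdiff ?n (coeff \<Phi> j)) y)"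
      by (simp add: sum.distrib sum_distrib_left mult_ac eq_neg_iff_add_eq_0)
    have evy: "peval (E.ev lx \<Psi>) x = eval_poly (\<lambda>F. peval F y) \<Psi> L" if "\<Psi> \<in> poly_ring_ext (2 * r)" for \<Psi>
      unfolding L_def by (rule E.peval_ev[OF _ that]) (simp add: y_def)
    have "peval (E.ev lx A) x = poly (pderiv (map_poly (\<lambda>F. peval F y) \<Phi>)) L"
    proof -
      have "map_poly (\<lambda>F. peval F y) A = pderiv (map_poly (\<lambda>F. peval F y) \<Phi>)"
        unfolding A_def by (intro poly_eqI)
          (simp add: coeff_map_poly coeff_pderiv peval.hom_mult peval.hom_add peval.hom_of_nat)
      then have "eval_poly (\<lambda>F. peval F y) A L = poly (pderiv (map_poly (\<lambda>F. peval F y) \<Phi>)) L"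
        unfolding eval_poly_def by (rule arg_cong)
      then show ?thesis by (simp only: evy[OF A])
    qed
    also have "\<dots> = (\<Sum>j\<le>degree \<Phi>. of_nat j * L ^ (j - 1) * peval (coeff \<Phi> j) y)"
    proof (rule DERIV_unique[OF poly_DERIV])
      have "poly (map_poly (\<lambda>F. peval F y) \<Phi>) = (\<lambda>z. \<Sum>j\<le>degree \<Phi>. z ^ j * peval (coeff \<Phi> j) y)"
        using eval_poly_as_sum[of "\<lambda>F. peval F y" \<Phi>] by (auto simp: eval_poly_def)
      moreover have "((\<lambda>z. \<Sum>j\<le>degree \<Phi>. z ^ j * peval (coeff \<Phi> j) y) has_field_derivative
          (\<Sum>j\<le>degree \<Phi>. of_nat j * L ^ (j - 1) * peval (coeff \<Phi> j) y)) (at L)"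
        by (intro DERIV_sum) (auto intro!: derivative_eq_intros)
      ultimately show "(poly (map_poly (\<lambda>F. peval F y) \<Phi>) has_field_derivative
          (\<Sum>j\<le>degree \<Phi>. of_nat j * L ^ (j - 1) * peval (coeff \<Phi> j) y)) (at L)" by simp
    qed
    finally have A': "peval (E.ev lx A) x = (\<Sum>j\<le>degree \<Phi>. of_nat j * L ^ (j - 1) * peval (coeff \<Phi> j) y)" .
    have "degree (B i) \<le> degree \<Phi>" unfolding B_def by (rule degree_map_poly_le)
    then have "peval (E.ev lx (B i)) x = (\<Sum>j\<le>degree \<Phi>. L ^ j * peval (coeff (B i) j) y)"
      unfolding evy[OF B] using eval_poly_as_sum[of "\<lambda>F. peval F y" "B i" L]
      by simp (intro sum.mono_neutral_left ballI, simp_all add: coeff_eq_0)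
    then show "peval (Var i * E.ev lx A) x = peval (E.ev lx (B i)) x"
      using * A' by (simp add: coeffB peval.hom_mult peval.hom_uminus sum_negf)
  qed
  \<comment> \<open>The specialisation must not kill the denominator, so the parameters are taken
    from a point where it does not vanish.\<close>
  obtain x0 where x0: "peval (E.ev lx A) x0 \<noteq> 0"
    using poly_ring_nonzero_peval[OF E.ev_ring[OF lx A] evA] .
  define sp where "sp = psubst Cst (\<lambda>i. if i < r then Var i else Cst (x0 i))"
  have sp_ring: "F \<in> poly_ring (2 * r) \<Longrightarrow> sp F \<in> poly_ring r" for F
    unfolding sp_def by (rule psubst_Cst_poly_ring) (auto intro: poly_ring_Var)
  have peval_sp: "peval (sp F) y = peval F (\<lambda>i. if i < r then y i else x0 i)" for F y
    unfolding sp_def peval_psubst by (intro peval_cong) auto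
  define lf where "lf = (\<Sum>i<r. Cst (x0 (r + i)) * Var i)"
  have lf: "lf \<in> poly_ring r"
    unfolding lf_def by (intro poly_ring_sum poly_ring_mult poly_ring_Var) auto
  have lf_sp: "lf = sp lx"
    by (rule poly_ring_eqI[OF lf sp_ring[OF lx]])
      (simp add: peval_sp lf_def lx_def peval.hom_sum peval.hom_mult)
  have sp_hom: "comm_ring_hom sp" unfolding sp_def by (rule comm_ring_hom_psubst_Cst)
  have sp0: "sp 0 = 0" unfolding sp_def by (rule psub.hom_zero)
  have ext: "map_poly sp \<Psi> \<in> poly_ring_ext r" if "\<Psi> \<in> poly_ring_ext (2 * r)" for \<Psi>
    using that sp_ring by (auto simp: poly_ring_ext_def coeff_map_poly sp0)
  have ev_sp: "ev lf (map_poly sp \<Psi>) = sp (E.ev lx \<Psi>)" if "\<Psi> \<in> poly_ring_ext (2 * r)" for \<Psi>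
  proof (rule poly_ring_eqI[OF ev_ring[OF lf ext[OF that]] sp_ring[OF E.ev_ring[OF lx that]]])
    fix y
    let ?z = "\<lambda>i. if i < r then y i else x0 i"
    let ?b = "\<lambda>i. peval (g i) y"
    let ?b' = "\<lambda>i. if i < r then peval (g i) y else x0 i"
    have "peval (ev lf (map_poly sp \<Psi>)) y = eval_poly (\<lambda>F. peval F ?b) (map_poly sp \<Psi>) (peval lf y)"
      by (rule peval_ev[OF _ ext[OF that]]) simp
    also have "\<dots> = eval_poly (\<lambda>F. peval F ?b') \<Psi> (peval lx ?z)"
    proof -
      have "map_poly (\<lambda>F. peval F ?b) (map_poly sp \<Psi>) = map_poly (\<lambda>F. peval F ?b') \<Psi>"
        by (intro poly_eqI) (simp add: coeff_map_poly sp0 peval_sp)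
      moreover have "peval lf y = peval lx ?z" unfolding lf_sp by (rule peval_sp)
      ultimately show ?thesis by (simp add: eval_poly_def)
    qed
    also have "\<dots> = peval (E.ev lx \<Psi>) ?z"
    proof (rule E.peval_ev[OF _ that, symmetric])
      fix i
      have "peval (g i) ?z = peval (g i) y" if "i < r"
        using g_ring[OF that] by (intro peval_cong) (auto dest: poly_ring_pvars)
      then show "peval (with_params r g i) ?z = ?b' i" by (auto simp: with_params_def)
    qed
    finally show "peval (ev lf (map_poly sp \<Psi>)) y = peval (sp (E.ev lx \<Psi>)) y" by (simp add: peval_sp)
  qed
  show thesis
  proof (rule that[of lf "\<lambda>i. x0 (r + i)" "map_poly sp A" "\<lambda>i. map_poly sp (B i)"])
    show "lf = (\<Sum>i<r. Cst (x0 (r + i)) * Var i)" by (rule lf_def)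
    show "map_poly sp A \<in> poly_ring_ext r" by (rule ext[OF A])
    show "\<forall>i<r. map_poly sp (B i) \<in> poly_ring_ext r" by (simp add: ext[OF B])
    have "peval (sp (E.ev lx A)) x0 \<noteq> 0" using x0 by (simp add: peval_sp)
    then show "ev lf (map_poly sp A) \<noteq> 0" unfolding ev_sp[OF A] by auto
    show "\<forall>i<r. Var i * ev lf (map_poly sp A) = ev lf (map_poly sp (B i))"
    proof (intro allI impI)
      fix i assume i: "i < r"
      have "sp (Var i) = Var i" using i by (simp add: sp_def psubst_Cst_single mono_eval_single)
      then show "Var i * ev lf (map_poly sp A) = ev lf (map_poly sp (B i))"
        unfolding ev_sp[OF A] ev_sp[OF B] rel[OF i, symmetric]
        using comm_ring_hom.axioms(1)[OF sp_hom] by (simp add: sp_def psub.hom_mult)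
    qed
  qed
qed

end

subsection \<open>The number of points in a generic fibre\<close>

lemma psubst_homogeneous:
  assumes "\<And>m. m \<in> keys F \<Longrightarrow> mdeg m = k"
  shows "psubst \<kappa> (\<lambda>i. t * p i) F = t ^ k * psubst \<kappa> p F"
  unfolding psubst_def mono_eval_scale sum_distrib_left
  by (intro sum.cong) (auto simp: assms mult_ac)

lemma card_simple_roots:
  fixes p :: "complex poly"
  assumes "p \<noteq> 0" "\<And>z. poly p z = 0 \<Longrightarrow> poly (pderiv p) z \<noteq> 0"
  shows "card {z. poly p z = 0} = degree p"
proof -
  have "rsquarefree p" using assms(2) by (auto simp: rsquarefree_roots)
  then have "smult (lead_coeff p) (\<Prod>z | poly p z = 0. [:- z, 1:]) = p"
    by (rule complex_poly_decompose_rsquarefree)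
  then have "degree p = degree (\<Prod>z | poly p z = 0. [:- z, 1:])"
    by (metis assms(1) degree_smult_eq leading_coeff_0_iff)
  also have "\<dots> = (\<Sum>z | poly p z = 0. degree [:- z, 1:])"
    by (rule degree_prod_eq_sum_degree) auto
  finally show ?thesis by simp
qed

text \<open>Points of \<open>\<complex>\<^sup>r\<close> are encoded as functions on
  \<open>nat\<close>; pinning them to \<open>0\<close> from \<open>r\<close> on gives the set the
  cardinality of the geometric fibre.\<close>

definition fibre :: "nat \<Rightarrow> (nat \<Rightarrow> nat cpoly) \<Rightarrow> (nat \<Rightarrow> complex) \<Rightarrow> (nat \<Rightarrow> complex) set" where
  "fibre r g b = {x. (\<forall>i\<ge>r. x i = 0) \<and> (\<forall>i<r. peval (g i) x = b i)}"

context alg_indep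
begin

text \<open>The remainder of \<open>W\<close> under pseudo-division by \<open>\<Phi>\<close>
  vanishes at \<open>\<alpha>\<close>, hence is \<open>0\<close> by minimality. So
  \<open>\<Phi>\<close> divides \<open>W\<close> up to a power of its leading coefficient, and this
  divisibility survives evaluation at every \<open>b\<close> where that coefficient is
  non-zero.\<close>

lemma minrel_zero:
  assumes "minrel \<alpha> \<Phi>" "W \<in> poly_ring_ext r" "ev \<alpha> W = 0"
    and "eval_poly (\<lambda>F. peval F b) \<Phi> z = 0" "peval (lead_coeff \<Phi>) b \<noteq> 0"
  shows "eval_poly (\<lambda>F. peval F b) W z = 0"
proof -
  interpret E: comm_ring_hom "\<lambda>\<Phi>. eval_poly (\<lambda>F. peval F b) \<Phi> z"
    by (rule comm_ring_hom_eval_poly[OF comm_ring_hom_peval])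
  have \<Phi>: "\<Phi> \<in> poly_ring_ext r" "\<Phi> \<noteq> 0" using assms(1) by (auto simp: minrel_def)
  obtain c U R where UR: "R \<in> poly_ring_ext r" "smult (lead_coeff \<Phi> ^ c) W = \<Phi> * U + R"
    "R = 0 \<or> degree R < degree \<Phi>"
    using pseudo_division[OF \<Phi> assms(2)] by blast
  have "ev \<alpha> (\<Phi> * U + R) = 0"
    unfolding UR(2)[symmetric] ev_smult using assms(3) by simp
  then have "ev \<alpha> R = 0" using assms(1) by (simp add: ev.hom_add ev.hom_mult minrel_def)
  then have "R = 0" using assms(1) UR by (auto simp: minrel_def)
  then have "[:lead_coeff \<Phi> ^ c:] * W = \<Phi> * U" using UR(2) by simp
  then have "eval_poly (\<lambda>F. peval F b) [:lead_coeff \<Phi> ^ c:] z * eval_poly (\<lambda>F. peval F b) W z = 0"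
    using assms(4) by (metis E.hom_mult mult_zero_left)
  moreover have "eval_poly (\<lambda>F. peval F b) [:lead_coeff \<Phi> ^ c:] z \<noteq> 0"
    using assms(5) by (subst eval_poly_as_sum) (auto simp: peval.hom_power)
  ultimately show ?thesis by simp
qed

lemma minrel_reduce:
  assumes "minrel \<alpha> \<Phi>" "W \<in> poly_ring_ext r"
  obtains Q R where "Q \<in> poly_ring r" "Q \<noteq> 0" "R \<in> poly_ring_ext r" "degree R < degree \<Phi>"
    "\<sigma> Q * ev \<alpha> W = ev \<alpha> R"
proof -
  have \<Phi>: "\<Phi> \<in> poly_ring_ext r" "\<Phi> \<noteq> 0" using assms(1) by (auto simp: minrel_def)
  obtain c U R where UR: "R \<in> poly_ring_ext r" "smult (lead_coeff \<Phi> ^ c) W = \<Phi> * U + R"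
    "R = 0 \<or> degree R < degree \<Phi>"
    using pseudo_division[OF \<Phi> assms(2)] by blast
  have "\<sigma> (lead_coeff \<Phi> ^ c) * ev \<alpha> W = ev \<alpha> (\<Phi> * U + R)"
    unfolding UR(2)[symmetric] ev_smult ..
  also have "\<dots> = ev \<alpha> R" using assms(1) by (simp add: ev.hom_add ev.hom_mult minrel_def)
  finally have "\<sigma> (lead_coeff \<Phi> ^ c) * ev \<alpha> W = ev \<alpha> R" .
  moreover have "lead_coeff \<Phi> ^ c \<in> poly_ring r"
    using \<Phi>(1) by (auto simp: poly_ring_ext_def intro: poly_ring_power)
  moreover have "degree R < degree \<Phi>" using UR(3) assms(1) by (auto simp: minrel_def)
  ultimately show thesis using that \<Phi>(2) UR(1) by simp
qed

text \<open>The elements expressible as a polynomial in \<open>\<alpha>\<close> with a denominator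
  from \<open>\<complex>[g]\<close> are closed under sums and products and contain the constants and
  the variables.\<close>

lemma fractions:
  assumes P: "\<And>i. i < r \<Longrightarrow> P i \<in> poly_ring_ext r" "\<And>i. i < r \<Longrightarrow> \<sigma> q * Var i = ev \<alpha> (P i)"
    and q: "q \<in> poly_ring r" "q \<noteq> 0" and F: "F \<in> poly_ring r"
  shows "\<exists>Q W. Q \<in> poly_ring r \<and> Q \<noteq> 0 \<and> W \<in> poly_ring_ext r \<and> \<sigma> Q * F = ev \<alpha> W"
proof -
  define ok where "ok F \<longleftrightarrow> (\<exists>Q W. Q \<in> poly_ring r \<and> Q \<noteq> 0 \<and> W \<in> poly_ring_ext r \<and> \<sigma> Q * F = ev \<alpha> W)" for F
  have ok_mult: "ok (F * G)" if FG: "ok F" "ok G" for F G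
  proof -
    from FG(1) obtain Q W where 1: "Q \<in> poly_ring r" "Q \<noteq> 0" "W \<in> poly_ring_ext r" "\<sigma> Q * F = ev \<alpha> W"
      unfolding ok_def by blast
    from FG(2) obtain Q' W' where 2: "Q' \<in> poly_ring r" "Q' \<noteq> 0" "W' \<in> poly_ring_ext r" "\<sigma> Q' * G = ev \<alpha> W'"
      unfolding ok_def by blast
    have "\<sigma> (Q * Q') * (F * G) = (\<sigma> Q * F) * (\<sigma> Q' * G)"
      by (simp add: psub.hom_mult mult_ac)
    also have "\<dots> = ev \<alpha> (W * W')" using 1 2 by (simp add: ev.hom_mult)
    finally show ?thesis unfolding ok_def using 1 2 by (intro exI[of _ "Q * Q'"] exI[of _ "W * W'"])
      (auto intro: poly_ring_mult poly_ring_ext_mult)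
  qed
  have ok_add: "ok (F + G)" if FG: "ok F" "ok G" for F G
  proof -
    from FG(1) obtain Q W where 1: "Q \<in> poly_ring r" "Q \<noteq> 0" "W \<in> poly_ring_ext r" "\<sigma> Q * F = ev \<alpha> W"
      unfolding ok_def by blast
    from FG(2) obtain Q' W' where 2: "Q' \<in> poly_ring r" "Q' \<noteq> 0" "W' \<in> poly_ring_ext r" "\<sigma> Q' * G = ev \<alpha> W'"
      unfolding ok_def by blast
    have "\<sigma> (Q * Q') * (F + G) = \<sigma> Q' * (\<sigma> Q * F) + \<sigma> Q * (\<sigma> Q' * G)"
      by (simp add: psub.hom_mult algebra_simps)
    also have "\<dots> = ev \<alpha> (smult Q' W + smult Q W')" using 1 2 by (simp add: ev.hom_add ev_smult)
    finally show ?thesis unfolding ok_def using 1 2 by (intro exI[of _ "Q * Q'"] exI[of _ "smult Q' W + smult Q W'"])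
      (auto intro: poly_ring_mult poly_ring_ext_add poly_ring_ext_smult)
  qed
  have ok_const: "ok (Cst c)" for c
    unfolding ok_def by (intro exI[of _ 1] exI[of _ "[:Cst c:]"]) (auto intro: poly_ring_ext_const simp: psubst_Cst_single)
  have ok_Var: "ok (Var i)" if "i < r" for i
    unfolding ok_def using P[OF that] q by blast
  have ok_power: "ok (F ^ j)" if "ok F" for F j
  proof (induction j)
    case 0
    show ?case using ok_const[of 1] by simp
  next
    case (Suc j)
    then show ?case using ok_mult[OF that] by simp
  qed
  have ok_prod: "ok (\<Prod>i\<in>I. h i)" if "finite I" "\<And>i. i \<in> I \<Longrightarrow> ok (h i)" for I h
    using that
  proof (induction I rule: finite_induct)
    case empty
    show ?case using ok_const[of 1] by simp
  next
    case (insert i I)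
    then show ?case using ok_mult[of "h i" "prod h I"] by simp
  qed
  have ok_sum: "ok (\<Sum>i\<in>I. h i)" if "finite I" "\<And>i. i \<in> I \<Longrightarrow> ok (h i)" for I h
    using that
  proof (induction I rule: finite_induct)
    case empty
    show ?case using ok_const[of 0] by simp
  next
    case (insert i I)
    then show ?case using ok_add[of "h i" "sum h I"] by simp
  qed
  have "F = (\<Sum>m\<in>keys F. Cst (lookup F m) * mono_eval Var m)"
  proof -
    have "F = psubst Cst Var F"
      by (rule poly_ring_eqI[OF F psubst_Cst_poly_ring[OF F]]) (auto simp: peval_psubst intro: poly_ring_Var)
    then show ?thesis by (simp add: psubst_def)
  qed
  moreover have "ok (\<Sum>m\<in>keys F. Cst (lookup F m) * mono_eval Var m)"
  proof (intro ok_sum ok_mult ok_const)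
    fix m assume "m \<in> keys F"
    then show "ok (mono_eval Var m)"
      unfolding mono_eval_def using F by (intro ok_prod ok_power ok_Var) (auto simp: poly_ring_iff)
  qed simp
  ultimately have "ok F" by simp
  then show ?thesis unfolding ok_def .
qed

end

locale homogeneous_alg_indep = alg_indep +
  fixes k :: nat
  assumes homogeneous: "\<And>i m. i < r \<Longrightarrow> m \<in> keys (g i) \<Longrightarrow> mdeg m = k"
begin

text \<open>For generic \<open>b\<close> the form \<open>lf\<close> maps the fibre bijectively onto
  the roots of \<open>\<Phi>\<close> with its coefficients evaluated at \<open>b\<close>, and these
  roots are simple. The last conclusion says that the powers of \<open>lf\<close> below
  \<open>degree \<Phi>\<close> span all polynomials up to denominators; the lower bound for that
  degree rests on it.\<close>

lemma fibre_structure: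
  obtains lf \<Phi> D where "lf \<in> polys_upto r 1" "minrel lf \<Phi>" "D \<in> poly_ring r" "D \<noteq> 0"
    "\<forall>b. peval D b \<noteq> 0 \<longrightarrow> card (fibre r g b) = degree \<Phi>"
    "\<forall>F\<in>poly_ring r. \<exists>Q R. Q \<in> poly_ring r \<and> Q \<noteq> 0 \<and> R \<in> poly_ring_ext r \<and>
        degree R < degree \<Phi> \<and> \<sigma> Q * F = ev lf R"
proof -
  obtain lf l A B where lf_eq: "lf = (\<Sum>i<r. Cst (l i) * Var i)" and
    A: "A \<in> poly_ring_ext r" "ev lf A \<noteq> 0" and
    B': "\<forall>i<r. B i \<in> poly_ring_ext r" "\<forall>i<r. Var i * ev lf A = ev lf (B i)"
    using primitive_linear_form .
  note B = B'[rule_format]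
  have lf1: "lf \<in> polys_upto r 1"
    unfolding lf_eq
  proof (rule polys_upto_sum)
    fix i assume "i \<in> {..<r}"
    then show "Cst (l i) * Var i \<in> polys_upto r 1"
      using polys_upto_mult[OF polys_upto_Cst[of "l i" r 0] polys_upto_Var[of i r 1]] by simp
  qed
  then have lf: "lf \<in> poly_ring r" by (rule poly_ring_upto)
  have lf_homog: "mdeg m = 1" if "m \<in> keys lf" for m
  proof -
    have "m \<in> (\<Union>i<r. keys (Cst (l i) * Var i))"
      using that Poly_Mapping.keys_sum[of "\<lambda>i. Cst (l i) * Var i" "{..<r}"] unfolding lf_eq by blast
    then show ?thesis by (auto simp: mult_single split: if_splits)
  qed
  obtain q C where q: "q \<in> poly_ring r" "q \<noteq> 0" "C \<in> poly_ring_ext r" "ev lf A * ev lf C = \<sigma> q"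
    using inverse_mod[OF lf A] .
  define P where "P i = B i * C" for i
  have P: "P i \<in> poly_ring_ext r" "\<sigma> q * Var i = ev lf (P i)" if "i < r" for i
    unfolding P_def using B(1)[OF that] B(2)[OF that, symmetric] q(3) q(4)[symmetric]
    by (auto intro: poly_ring_ext_mult simp: ev.hom_mult mult_ac)
  obtain \<Phi> where \<Phi>: "minrel lf \<Phi>" using minrel_exists[OF lf] .
  have \<Phi>': "\<Phi> \<in> poly_ring_ext r" "\<Phi> \<noteq> 0" "ev lf \<Phi> = 0" "0 < degree \<Phi>"
    using \<Phi> by (auto simp: minrel_def)
  have d\<Phi>: "pderiv \<Phi> \<in> poly_ring_ext r" by (rule poly_ring_ext_pderiv[OF \<Phi>'(1)])
  have "pderiv \<Phi> \<noteq> 0" "degree (pderiv \<Phi>) < degree \<Phi>"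
    using \<Phi>'(4) by (auto simp: pderiv_eq_0_iff degree_pderiv)
  then have evd: "ev lf (pderiv \<Phi>) \<noteq> 0" using \<Phi> d\<Phi> unfolding minrel_def by force
  obtain d C' where d: "d \<in> poly_ring r" "d \<noteq> 0" "C' \<in> poly_ring_ext r" "ev lf (pderiv \<Phi>) * ev lf C' = \<sigma> d"
    using inverse_mod[OF lf d\<Phi> evd] .
  \<comment> \<open>One factor each to keep the degree of \<open>\<Phi>\<close>, to make the
    coordinates \<open>P i / q\<close> defined, and to keep the roots simple.\<close>
  define D where "D = lead_coeff \<Phi> * q * d"
  have D: "D \<in> poly_ring r" "D \<noteq> 0"
    using \<Phi>' q d by (auto simp: D_def poly_ring_ext_def intro!: poly_ring_mult)
  have card: "card (fibre r g b) = degree \<Phi>" if "peval D b \<noteq> 0" for b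
  proof -
    let ?H = "\<lambda>F. peval F b"
    let ?E = "\<lambda>z \<Psi>. eval_poly ?H \<Psi> z"
    interpret E: comm_ring_hom "\<lambda>\<Psi>. eval_poly ?H \<Psi> z" for z
      by (rule comm_ring_hom_eval_poly[OF comm_ring_hom_peval])
    have E_const: "?E z [:F:] = ?H F" for z F
      by (subst eval_poly_as_sum) auto
    have E_smult: "?E z (smult F \<Psi>) = ?H F * ?E z \<Psi>" for z F \<Psi>
      using E.hom_mult[of "[:F:]" \<Psi> z] by (simp add: E_const)
    have E_X: "?E z [:0, 1:] = z" for z
      by (subst eval_poly_as_sum) auto
    have nz: "?H (lead_coeff \<Phi>) \<noteq> 0" "?H q \<noteq> 0" "?H d \<noteq> 0"
      using that by (auto simp: D_def peval.hom_mult)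
    have zero: "?E z W = 0" if "?E z \<Phi> = 0" "W \<in> poly_ring_ext r" "ev lf W = 0" for z W
      using minrel_zero[OF \<Phi> that(2,3,1) nz(1)] .
    have pt: "peval (ev lf W) x = ?E (peval lf x) W" if "x \<in> fibre r g b" "W \<in> poly_ring_ext r" for x W
      using that by (intro peval_ev) (auto simp: fibre_def)
    have rel_x: "?H q * x i = ?E (peval lf x) (P i)" if "x \<in> fibre r g b" "i < r" for x i
    proof -
      have "peval (\<sigma> q * Var i) x = ?E (peval lf x) (P i)"
        unfolding P(2)[OF that(2)] by (rule pt[OF that(1) P(1)[OF that(2)]])
      moreover have "peval (\<sigma> q) x = ?E (peval lf x) [:q:]"
        using pt[OF that(1) poly_ring_ext_const[OF q(1)]] by simp
      ultimately show ?thesis by (simp add: peval.hom_mult E_const)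
    qed
    let ?p = "map_poly ?H \<Phi>"
    have p: "poly ?p z = ?E z \<Phi>" for z by (simp add: eval_poly_def)
    have "bij_betw (peval lf) (fibre r g b) {z. poly ?p z = 0}"
      unfolding bij_betw_def
    proof
      show "inj_on (peval lf) (fibre r g b)"
      proof (rule inj_onI)
        fix x y assume xy: "x \<in> fibre r g b" "y \<in> fibre r g b" "peval lf x = peval lf y"
        show "x = y"
        proof
          fix i show "x i = y i"
          proof (cases "i < r")
            case True
            then have "?H q * x i = ?H q * y i" using rel_x[of x i] rel_x[of y i] xy by simp
            then show ?thesis using nz(2) by simp
          qed (use xy in \<open>auto simp: fibre_def\<close>)
        qed
      qed
      show "peval lf ` fibre r g b = {z. poly ?p z = 0}"
      proof
        show "peval lf ` fibre r g b \<subseteq> {z. poly ?p z = 0}"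
          using pt[OF _ \<Phi>'(1)] by (auto simp: p \<Phi>'(3))
        show "{z. poly ?p z = 0} \<subseteq> peval lf ` fibre r g b"
        proof
          fix z assume "z \<in> {z. poly ?p z = 0}"
          then have z: "?E z \<Phi> = 0" by (simp add: p)
          \<comment> \<open>The relations \<open>\<sigma> q * Var i = ev lf (P i)\<close> dictate
            the coordinates of a preimage of the root \<open>z\<close>.\<close>
          define x where "x = (\<lambda>i. if i < r then ?E z (P i) / ?H q else 0)"
          \<comment> \<open>For homogeneous \<open>F\<close>, passing from the fractions
            \<open>P i / q\<close> to the numerators \<open>P i\<close> only multiplies by a power
            of \<open>q\<close>; this is where homogeneity enters.\<close>
          have val: "?E z (psubst (\<lambda>c. [:Cst c:]) P F) = ?H q ^ j * peval F x"
            if F: "F \<in> poly_ring r" "\<And>m. m \<in> keys F \<Longrightarrow> mdeg m = j" for F j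
          proof -
            have "?E z (psubst (\<lambda>c. [:Cst c:]) P F) = psubst (\<lambda>c. c) (\<lambda>i. ?E z (P i)) F"
              by (subst hom_psubst[OF E.comm_ring_hom_axioms]) (simp add: E_const)
            also have "\<dots> = psubst (\<lambda>c. c) (\<lambda>i. ?H q * x i) F"
              using nz(2) F(1) by (intro psubst_cong) (auto simp: x_def dest: poly_ring_pvars)
            also have "\<dots> = ?H q ^ j * peval F x"
              unfolding peval_eq_psubst by (rule psubst_homogeneous[OF F(2)])
            finally show ?thesis .
          qed
          have rel: "ev lf (psubst (\<lambda>c. [:Cst c:]) P F) = \<sigma> q ^ j * F"
            if F: "F \<in> poly_ring r" "\<And>m. m \<in> keys F \<Longrightarrow> mdeg m = j" for F j
          proof -
            have "ev lf (psubst (\<lambda>c. [:Cst c:]) P F) = psubst Cst (\<lambda>i. ev lf (P i)) F"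
              by (subst hom_psubst[OF ev.comm_ring_hom_axioms]) (simp add: psubst_Cst_single)
            also have "\<dots> = psubst Cst (\<lambda>i. \<sigma> q * Var i) F"
              using F(1) by (intro psubst_cong) (simp add: P(2) poly_ring_pvars)
            also have "\<dots> = \<sigma> q ^ j * psubst Cst Var F"
              by (rule psubst_homogeneous[OF F(2)])
            also have "psubst Cst Var F = F"
              by (rule poly_ring_eqI[OF psubst_Cst_poly_ring[OF F(1)] F(1)])
                (auto simp: peval_psubst intro: poly_ring_Var)
            finally show ?thesis .
          qed
          have "peval (g i) x = b i" if i: "i < r" for i
          proof -
            \<comment> \<open>\<open>?W\<close> vanishes at \<open>lf\<close>, hence by
              \<open>zero\<close> also at the root \<open>z\<close>. Evaluated there it is the
              equation \<open>g i = b i\<close> multiplied by the value of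
              \<open>q ^ k\<close>.\<close>
            let ?W = "psubst (\<lambda>c. [:Cst c:]) P (g i) - smult (q ^ k) [:Var i:]"
            have "?W \<in> poly_ring_ext r"
              using i q(1) P(1) g_ring[OF i] by (intro poly_ring_ext_diff poly_ring_ext_psubst
                poly_ring_ext_smult poly_ring_ext_const poly_ring_power poly_ring_Var) auto
            moreover have "ev lf (psubst (\<lambda>c. [:Cst c:]) P (g i)) = \<sigma> q ^ k * g i"
              using i by (intro rel g_ring homogeneous)
            then have "ev lf ?W = 0"
              unfolding ev.hom_minus ev_smult by (simp add: psub.hom_power psubst_Cst_single)
            ultimately have "?E z ?W = 0" by (rule zero[OF z])
            moreover have "?E z (psubst (\<lambda>c. [:Cst c:]) P (g i)) = ?H q ^ k * peval (g i) x"
              using i by (intro val g_ring homogeneous)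
            ultimately show ?thesis
              using nz(2) unfolding E.hom_minus E_smult by (simp add: E_const peval.hom_power)
          qed
          then have "x \<in> fibre r g b" by (auto simp: fibre_def x_def)
          moreover have "peval lf x = z"
          proof -
            let ?W = "psubst (\<lambda>c. [:Cst c:]) P lf - smult q [:0, 1:]"
            have "[:0, 1:] \<in> poly_ring_ext r" using poly_ring_ext_monom[of 1 r 1] by (simp add: x_as_monom)
            then have "?W \<in> poly_ring_ext r"
              using q(1) P(1) lf by (intro poly_ring_ext_diff poly_ring_ext_psubst poly_ring_ext_smult) auto
            moreover have "ev lf (psubst (\<lambda>c. [:Cst c:]) P lf) = \<sigma> q ^ 1 * lf"
              by (intro rel lf lf_homog)
            then have "ev lf ?W = 0"
              unfolding ev.hom_minus ev_smult ev_X by simp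
            ultimately have "?E z ?W = 0" by (rule zero[OF z])
            moreover have "?E z (psubst (\<lambda>c. [:Cst c:]) P lf) = ?H q ^ 1 * peval lf x"
              by (intro val lf lf_homog)
            ultimately show ?thesis
              using nz(2) unfolding E.hom_minus E_smult E_X by simp
          qed
          ultimately show "z \<in> peval lf ` fibre r g b" by blast
        qed
      qed
    qed
    then have "card (fibre r g b) = card {z. poly ?p z = 0}" by (rule bij_betw_same_card)
    also have "\<dots> = degree ?p"
    proof (rule card_simple_roots)
      have "coeff ?p (degree \<Phi>) \<noteq> 0" using nz(1) by (simp add: coeff_map_poly)
      then show "?p \<noteq> 0" by (metis coeff_0)
      fix z assume "poly ?p z = 0"
      then have z: "?E z \<Phi> = 0" by (simp add: p)
      \<comment> \<open>This combination vanishes at \<open>lf\<close>, hence at the root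
        \<open>z\<close>; a multiple root would therefore make \<open>d\<close> vanish at
        \<open>b\<close>.\<close>
      have "?E z (pderiv \<Phi> * C' - [:d:]) = 0"
        using d d\<Phi> by (intro zero[OF z] poly_ring_ext_diff poly_ring_ext_mult poly_ring_ext_const)
          (auto simp: ev.hom_minus ev.hom_mult)
      then have "?E z (pderiv \<Phi>) \<noteq> 0" using nz(3) by (auto simp: E.hom_minus E.hom_mult E_const)
      moreover have "map_poly ?H (pderiv \<Phi>) = pderiv ?p"
        by (intro poly_eqI) (simp add: coeff_map_poly coeff_pderiv peval.hom_mult peval.hom_add peval.hom_of_nat)
      ultimately show "poly (pderiv ?p) z \<noteq> 0" by (simp add: eval_poly_def)
    qed
    also have "\<dots> = degree \<Phi>"
    proof (rule antisym)
      show "degree ?p \<le> degree \<Phi>" by (rule degree_map_poly_le)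
      show "degree \<Phi> \<le> degree ?p" using nz(1) by (intro le_degree) (simp add: coeff_map_poly)
    qed
    finally show ?thesis .
  qed
  have red: "\<exists>Q R. Q \<in> poly_ring r \<and> Q \<noteq> 0 \<and> R \<in> poly_ring_ext r \<and>
        degree R < degree \<Phi> \<and> \<sigma> Q * F = ev lf R" if F: "F \<in> poly_ring r" for F
  proof -
    obtain Q W where QW: "Q \<in> poly_ring r" "Q \<noteq> 0" "W \<in> poly_ring_ext r" "\<sigma> Q * F = ev lf W"
      using fractions[OF P q(1,2) F] by blast
    obtain Q' R where "Q' \<in> poly_ring r" "Q' \<noteq> 0" "R \<in> poly_ring_ext r" "degree R < degree \<Phi>"
      "\<sigma> Q' * ev lf W = ev lf R"
      using minrel_reduce[OF \<Phi> QW(3)] .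
    then show ?thesis using QW
      by (intro exI[of _ "Q' * Q"] exI[of _ R]) (auto intro: poly_ring_mult simp: psub.hom_mult mult.assoc)
  qed
  show thesis by (rule that[OF lf1 \<Phi> D]) (use card red in blast)+
qed

end

lemma span_mult:
  assumes "F \<in> cvs.span S" "\<And>s. s \<in> S \<Longrightarrow> h * s \<in> cvs.span T"
  shows "h * F \<in> cvs.span T"
  using assms(1)
proof (induction rule: cvs.span_induct_alt)
  case (step c x y)
  have "h * (Cst c * x + y) = Cst c * (h * x) + h * y"
    by (simp add: algebra_simps)
  then show ?case
    using step assms(2) by (simp add: cvs.span_add cvs.span_scale)
qed (simp add: cvs.span_zero)

text \<open>\<open>Var_power\<close> makes \<open>\<complex>[x]\<close> a finite module over
  \<open>\<complex>[g]\<close>. The bound \<open>N - k\<close> is the degree of a homogeneous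
  cofactor; it controls degrees whenever the relation is applied.\<close>

locale finite_homogeneous = homogeneous_alg_indep +
  fixes N :: nat and W :: "nat \<Rightarrow> nat \<Rightarrow> nat cpoly"
  assumes k_pos: "1 \<le> k" and k_le: "k \<le> N"
    and W_upto: "\<And>l i. l < r \<Longrightarrow> i < r \<Longrightarrow> W l i \<in> polys_upto r (N - k)"
    and Var_power: "\<And>l. l < r \<Longrightarrow> Var l ^ N = (\<Sum>i<r. g i * W l i)"
begin

lemma g_upto: "i < r \<Longrightarrow> g i \<in> polys_upto r k"
  using g_ring[of i] homogeneous[of i] by (auto simp: poly_ring_iff polys_upto_def)

definition box :: "(nat \<Rightarrow>\<^sub>0 nat) set" where
  "box = {m. keys m \<subseteq> {..<r} \<and> (\<forall>i<r. lookup m i < N)}"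

text \<open>The last condition bounds the total degree of the product, because every
  \<open>g i\<close> is homogeneous of degree \<open>k\<close>.\<close>

definition gens :: "nat \<Rightarrow> nat cpoly set" where
  "gens M = {mono_eval g \<beta> * single a 1 | \<beta> a.
     keys \<beta> \<subseteq> {..<r} \<and> a \<in> box \<and> k * mdeg \<beta> + mdeg a \<le> M}"

lemma finite_box: "finite box"
proof (rule finite_subset)
  show "box \<subseteq> exps_upto r (r * N)"
  proof
    fix m assume m: "m \<in> box"
    then have "mdeg m = (\<Sum>i<r. lookup m i)"
      by (intro mdeg_superset) (auto simp: box_def)
    also have "\<dots> \<le> (\<Sum>i<r. N)"
      using m by (intro sum_mono) (auto simp: box_def intro: less_imp_le)
    finally show "m \<in> exps_upto r (r * N)" using m by (simp add: box_def exps_upto_def)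
  qed
qed simp

text \<open>A monomial outside \<open>box\<close> contains some \<open>x\<^sub>i\<^sup>N\<close>.
  Replacing that power through \<open>Var_power\<close> leaves cofactors of degree at most
  \<open>M - k\<close>, which are covered by induction; multiplying their generators by
  \<open>g j\<close> gives back exactly the degree \<open>k\<close>.\<close>

lemma span_gens: "F \<in> polys_upto r M \<Longrightarrow> F \<in> cvs.span (gens M)"
proof (induction M arbitrary: F rule: less_induct)
  case (less M)
  have mono: "single m 1 \<in> cvs.span (gens M)" if m: "m \<in> exps_upto r M" for m
  proof (cases "\<forall>i<r. lookup m i < N")
    case True
    then have "single m 1 \<in> gens M"
      unfolding gens_def using m
      by (intro CollectI exI[of _ 0] exI[of _ m]) (auto simp: box_def exps_upto_def)
    then show ?thesis by (rule cvs.span_base)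
  next
    case False
    then obtain i where i: "i < r" "N \<le> lookup m i" by (auto simp: not_less)
    define m' where "m' = m - single i N"
    have eq: "m = single i N + m'"
      using i by (intro poly_mapping_eqI) (auto simp: m'_def lookup_add lookup_minus lookup_single when_def)
    have keys: "keys m' \<subseteq> {..<r}"
      using m by (auto simp: m'_def exps_upto_def in_keys_iff lookup_minus subset_iff)
    have deg: "mdeg m = N + mdeg m'" by (subst eq) (simp add: mdeg_add)
    have "Var i ^ N = (single (single i N) 1 :: nat cpoly)"
    proof (rule poly_ring_eqI[of _ r])
      show "Var i ^ N \<in> poly_ring r" using i by (intro poly_ring_power poly_ring_Var)
      show "single (single i N) 1 \<in> poly_ring r"
        using i by (auto simp: poly_ring_iff)
    qed (simp add: peval.hom_power peval_single)
    then have "single m 1 = Var i ^ N * single m' 1"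
      by (simp add: mult_single flip: eq)
    also have "\<dots> = (\<Sum>j<r. g j * (W i j * single m' 1))"
      by (simp add: Var_power[OF i(1)] sum_distrib_right mult.assoc)
    also have "\<dots> \<in> cvs.span (gens M)"
    proof (rule cvs.span_sum)
      fix j assume j: "j \<in> {..<r}"
      have kM: "k \<le> M" "N - k + mdeg m' \<le> M - k"
        using m deg k_le by (auto simp: exps_upto_def)
      have "W i j * single m' 1 \<in> polys_upto r (N - k + mdeg m')"
        using i j keys by (intro polys_upto_mult W_upto polys_upto_single) auto
      then have "W i j * single m' 1 \<in> cvs.span (gens (M - k))"
        using kM k_pos by (intro less.IH polys_upto_mono[OF _ kM(2)]) auto
      then show "g j * (W i j * single m' 1) \<in> cvs.span (gens M)"
      proof (rule span_mult)
        fix s assume "s \<in> gens (M - k)"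
        then obtain \<beta> a where s: "s = mono_eval g \<beta> * single a 1"
          "keys \<beta> \<subseteq> {..<r}" "a \<in> box" "k * mdeg \<beta> + mdeg a \<le> M - k"
          unfolding gens_def by blast
        have "g j * s = mono_eval g (single j 1 + \<beta>) * single a 1"
          by (simp add: s mono_eval_add mult.assoc)
        moreover have "keys (single j 1 + \<beta>) \<subseteq> {..<r}"
          using Poly_Mapping.keys_add[of "single j 1" \<beta>] s j by auto
        moreover have "k * mdeg (single j 1 + \<beta>) + mdeg a \<le> M"
          using s kM by (simp add: mdeg_add distrib_left)
        ultimately have "g j * s \<in> gens M" unfolding gens_def using s(3) by blast
        then show "g j * s \<in> cvs.span (gens M)" by (rule cvs.span_base)
      qed
    qed
    finally show ?thesis .
  qed
  have "cvs.span ((\<lambda>m. single m 1) ` exps_upto r M) \<subseteq> cvs.span (gens M)"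
    using mono by (intro cvs.span_minimal cvs.subspace_span) auto
  then show ?case using polys_upto_span[OF less.prems] by blast
qed

text \<open>By minimality the products of \<open>lf ^ i\<close> (\<open>i < degree \<Phi>\<close>)
  with the monomials of degree at most \<open>M\<close> in the \<open>g\<close> are linearly
  independent, and their degree is at most \<open>k * M + degree \<Phi>\<close>. Comparing the
  growth in \<open>M\<close> gives the bound.\<close>

lemma minrel_degree_le:
  assumes "lf \<in> polys_upto r 1" "minrel lf \<Phi>"
  shows "degree \<Phi> \<le> k ^ r"
proof -
  let ?e = "degree \<Phi>"
  have "?e * ((1 * M + 0 + r) choose r) \<le> 1 * ((k * M + ?e + r) choose r)" for M
  proof (rule ccontr)
    let ?B = "(\<lambda>m. single m (1::complex)) ` exps_upto r (k * M + ?e)"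
    assume "\<not> ?thesis"
    moreover have "card ?B \<le> card (exps_upto r (k * M + ?e))" by (rule card_image_le) simp
    ultimately have "card ?B < ?e * card (exps_upto r M)" by (simp add: card_exps_upto)
    moreover have "mono_eval g \<beta> * lf ^ i \<in> cvs.span ?B" if "i < ?e" "\<beta> \<in> exps_upto r M" for i \<beta>
    proof (rule polys_upto_span)
      have "mono_eval g \<beta> * lf ^ i \<in> polys_upto r (mdeg \<beta> * k + i * 1)"
        using that by (intro polys_upto_mult polys_upto_power mono_eval_polys_upto[of _ r] assms(1) g_upto)
          (auto simp: exps_upto_def)
      moreover have "mdeg \<beta> * k + i * 1 \<le> M * k + ?e"
        using that by (intro add_mono mult_le_mono1) (auto simp: exps_upto_def)
      ultimately show "mono_eval g \<beta> * lf ^ i \<in> polys_upto r (k * M + ?e)"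
        by (metis mult.commute polys_upto_mono)
    qed
    ultimately obtain \<Psi> where "\<Psi> \<noteq> 0" "\<Psi> \<in> poly_ring_ext r" "degree \<Psi> < ?e" "ev lf \<Psi> = 0"
      using relation_by_counting[of ?B ?e r M g lf] unfolding poly_ring_ext_def by auto
    then show False using assms(2) by (auto simp: minrel_def)
  qed
  then show ?thesis using binomial_ratio_le[of ?e 1 0 r 1 k ?e] by simp
qed

text \<open>Multiplication by one fixed \<open>\<sigma> q\<close> maps the polynomials of degree at
  most \<open>k * M\<close> injectively into the span of the products of \<open>lf ^ i\<close>
  (\<open>i < e\<close>) with the monomials of degree at most \<open>M + c\<close> in the
  \<open>g\<close>. Since \<open>c\<close> does not depend on \<open>M\<close>, the growth rates can
  be compared.\<close>

lemma le_minrel_degree: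
  assumes red: "\<And>F. F \<in> poly_ring r \<Longrightarrow> \<exists>Q R. Q \<in> poly_ring r \<and> Q \<noteq> 0 \<and> R \<in> poly_ring_ext r \<and>
        degree R < e \<and> \<sigma> Q * F = ev lf R"
  shows "k ^ r \<le> e"
proof -
  have "\<forall>a\<in>box. \<exists>Q R. Q \<in> poly_ring r \<and> Q \<noteq> 0 \<and> R \<in> poly_ring_ext r \<and>
        degree R < e \<and> \<sigma> Q * single a 1 = ev lf R"
    by (intro ballI red) (auto simp: box_def poly_ring_iff)
  then obtain Q R where QR: "\<And>a. a \<in> box \<Longrightarrow> Q a \<in> poly_ring r \<and> Q a \<noteq> 0 \<and> R a \<in> poly_ring_ext r \<and>
        degree (R a) < e \<and> \<sigma> (Q a) * single a 1 = ev lf (R a)"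
    by metis
  \<comment> \<open>A common denominator for all of \<open>box\<close>. Because \<open>box\<close>
    is finite, neither \<open>q\<close> nor the degree bound \<open>c\<close> below depends on
    \<open>M\<close>.\<close>
  define q where "q = prod Q box"
  define R' where "R' a = smult (\<Prod>b\<in>box - {a}. Q b) (R a)" for a
  have q: "q \<in> poly_ring r" "q \<noteq> 0"
    using QR finite_box by (auto simp: q_def intro: poly_ring_prod)
  have R': "R' a \<in> poly_ring_ext r" "degree (R' a) < e" "\<sigma> q * single a 1 = ev lf (R' a)"
    if "a \<in> box" for a
  proof -
    show "R' a \<in> poly_ring_ext r"
      unfolding R'_def using QR that by (intro poly_ring_ext_smult poly_ring_prod) auto
    show "degree (R' a) < e"
      unfolding R'_def using QR[OF that] by (meson degree_smult_le le_less_trans)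
    have "q = (\<Prod>b\<in>box - {a}. Q b) * Q a"
      unfolding q_def using prod.remove[OF finite_box that, of Q] by (simp add: mult.commute)
    then show "\<sigma> q * single a 1 = ev lf (R' a)"
      unfolding R'_def ev_smult using QR[OF that] by (simp add: psub.hom_mult mult.assoc)
  qed
  have "\<exists>c. \<forall>z\<in>box \<times> {..<e}. coeff (R' (fst z)) (snd z) \<in> polys_upto r c"
  proof (rule poly_ring_obtain_upto_finite[of "box \<times> {..<e}" "\<lambda>z. coeff (R' (fst z)) (snd z)" r])
    show "finite (box \<times> {..<e})" using finite_box by simp
    show "coeff (R' (fst z)) (snd z) \<in> poly_ring r" if "z \<in> box \<times> {..<e}" for z
      using R'(1) that by (auto simp: poly_ring_ext_def)
  qed blast
  then obtain c where c: "\<And>z. z \<in> box \<times> {..<e} \<Longrightarrow> coeff (R' (fst z)) (snd z) \<in> polys_upto r c"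
    by blast
  have "1 * ((k * M + 0 + r) choose r) \<le> e * ((1 * M + c + r) choose r)" for M
  proof (rule ccontr)
    let ?I = "exps_upto r (k * M)" and ?J = "exps_upto r (M + c) \<times> {..<e}"
    let ?B = "(\<lambda>(\<beta>, i). mono_eval g \<beta> * lf ^ i) ` ?J"
    assume "\<not> ?thesis"
    moreover have "card ?B \<le> card ?J" by (rule card_image_le) simp
    ultimately have "card ?B < card ?I" by (simp add: card_exps_upto card_cartesian_product mult.commute)
    moreover have span: "\<sigma> q * F \<in> cvs.span ?B" if F: "F \<in> polys_upto r (k * M)" for F
    proof (rule span_mult[OF span_gens[OF F]])
      fix s assume "s \<in> gens (k * M)"
      then obtain \<beta> a where s: "s = mono_eval g \<beta> * single a 1"
        "keys \<beta> \<subseteq> {..<r}" "a \<in> box" "k * mdeg \<beta> + mdeg a \<le> k * M"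
        unfolding gens_def by blast
      have "k * mdeg \<beta> \<le> k * M" using s(4) by (rule add_leD1)
      then have \<beta>: "mdeg \<beta> \<le> M" using k_pos by simp
      have "\<sigma> q * s = mono_eval g \<beta> * ev lf (R' a)"
        using R'(3)[OF s(3)] by (simp add: s(1) mult_ac)
      also have "\<dots> = (\<Sum>i\<le>degree (R' a). \<sigma> (single \<beta> 1 * coeff (R' a) i) * lf ^ i)"
        by (simp add: ev_sum sum_distrib_left psub.hom_mult psubst_Cst_single mult_ac)
      also have "\<dots> \<in> cvs.span ?B"
      proof (rule cvs.span_sum)
        fix i assume "i \<in> {..degree (R' a)}"
        then have i: "i < e" using R'(2)[OF s(3)] by simp
        let ?G = "single \<beta> 1 * coeff (R' a) i"
        have "?G \<in> polys_upto r (M + c)"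
          using c[of "(a, i)"] s(2,3) i \<beta> by (intro polys_upto_mult polys_upto_single) auto
        then have eq: "\<sigma> ?G * lf ^ i = (\<Sum>m\<in>keys ?G. Cst (lookup ?G m) * (mono_eval g m * lf ^ i))"
          and keys: "keys ?G \<subseteq> exps_upto r (M + c)"
          by (auto simp: psubst_def sum_distrib_right mult.assoc polys_upto_def exps_upto_def)
        show "\<sigma> ?G * lf ^ i \<in> cvs.span ?B"
          unfolding eq by (intro cvs.span_sum cvs.span_scale cvs.span_base) (use keys i in force)
      qed
      finally show "\<sigma> q * s \<in> cvs.span ?B" .
    qed
    have "\<exists>u. (\<exists>m\<in>?I. u m \<noteq> 0) \<and> (\<Sum>m\<in>?I. Cst (u m) * (\<sigma> q * single m 1)) = 0"
      using \<open>card ?B < card ?I\<close>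
    proof (intro linear_dependence[of _ ?B] span)
      show "single m 1 \<in> polys_upto r (k * M)" if "m \<in> ?I" for m
        using that by (auto intro!: polys_upto_single simp: exps_upto_def)
    qed simp_all
    then obtain u where u: "\<exists>m\<in>?I. u m \<noteq> 0" "(\<Sum>m\<in>?I. Cst (u m) * (\<sigma> q * single m 1)) = 0"
      by blast
    define F where "F = (\<Sum>m\<in>?I. single m (u m))"
    have "\<sigma> q * F = (\<Sum>m\<in>?I. Cst (u m) * (\<sigma> q * single m 1))"
      unfolding F_def sum_distrib_left
    proof (intro sum.cong refl)
      fix m
      have "single m (u m) = Cst (u m) * single m 1" by (simp add: mult_single)
      then show "\<sigma> q * single m (u m) = Cst (u m) * (\<sigma> q * single m 1)"
        by (metis mult.left_commute)
    qed
    then have "\<sigma> q * F = 0" using u(2) by simp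
    moreover have "\<sigma> q \<noteq> 0" using q indep by blast
    ultimately have "F = 0" by simp
    moreover have "lookup F m = u m" if "m \<in> ?I" for m
      using that by (simp add: F_def lookup_sum lookup_single when_def)
    ultimately show False using u(1) by auto
  qed
  then show ?thesis using binomial_ratio_le[of 1 k 0 r e 1 c] by simp
qed

theorem generic_fibre_card:
  "\<exists>D\<in>poly_ring r. D \<noteq> 0 \<and> (\<forall>b. peval D b \<noteq> 0 \<longrightarrow> card (fibre r g b) = k ^ r)"
proof -
  obtain lf \<Phi> D where *: "lf \<in> polys_upto r 1" "minrel lf \<Phi>" "D \<in> poly_ring r" "D \<noteq> 0"
    "\<forall>b. peval D b \<noteq> 0 \<longrightarrow> card (fibre r g b) = degree \<Phi>"
    "\<forall>F\<in>poly_ring r. \<exists>Q R. Q \<in> poly_ring r \<and> Q \<noteq> 0 \<and> R \<in> poly_ring_ext r \<and>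
        degree R < degree \<Phi> \<and> \<sigma> Q * F = ev lf R"
    using fibre_structure .
  have "degree \<Phi> = k ^ r"
    using minrel_degree_le[OF *(1,2)] le_minrel_degree[OF *(6)[rule_format]] by simp
  then show ?thesis using * by auto
qed

end

section \<open>The Euler forms of the complete homogeneous polynomials\<close>

subsection \<open>Complete homogeneous polynomials\<close>

definition comps :: "nat set \<Rightarrow> nat \<Rightarrow> (nat \<Rightarrow>\<^sub>0 nat) set" where
  "comps S n = {a. keys a \<subseteq> S \<and> mdeg a = n}"

definition chom :: "nat set \<Rightarrow> nat \<Rightarrow> nat cpoly" where
  "chom S n = (\<Sum>a\<in>comps S n. single a 1)"

text \<open>\<open>euler_form r k i\<close> is \<open>x\<^sub>i \<partial>h\<^sub>k/\<partial>x\<^sub>i\<close> for the complete homogeneous polynomial \<open>h\<^sub>k\<close> in \<open>r\<close> variables.\<close>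

definition euler_form :: "nat \<Rightarrow> nat \<Rightarrow> nat \<Rightarrow> nat cpoly" where
  "euler_form r k i = (\<Sum>a\<in>comps {..<r} k. single a (of_nat (lookup a i)))"

lemma finite_comps:
  assumes "finite S" shows "finite (comps S n)"
proof -
  have "\<exists>r. S \<subseteq> {..<r}" using assms by (rule finite_nat_iff_bounded[THEN iffD1])
  then obtain r where "S \<subseteq> {..<r}" by blast
  then have "comps S n \<subseteq> exps_upto r n" by (auto simp: comps_def exps_upto_def)
  then show ?thesis by (rule finite_subset) simp
qed

lemma lookup_chom: "finite S \<Longrightarrow> lookup (chom S n) a = (if a \<in> comps S n then 1 else 0)"
  by (simp add: chom_def lookup_sum lookup_single when_def finite_comps)

lemma lookup_euler_form:
  "lookup (euler_form r k i) a = (if a \<in> comps {..<r} k then of_nat (lookup a i) else 0)"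
  by (simp add: euler_form_def lookup_sum lookup_single when_def finite_comps)

lemma keys_euler_form: "keys (euler_form r k i) \<subseteq> comps {..<r} k"
  by (auto simp: in_keys_iff lookup_euler_form split: if_splits)

lemma Var_power_eq: "Var i ^ n = (single (single i n) 1 :: 'v cpoly)"
proof (induction n)
  case (Suc n)
  have "single i (Suc 0) + single i n = single i (Suc n)"
    unfolding single_add[symmetric] by simp
  then show ?case by (simp only: power_Suc Suc mult_single) simp
qed simp

text \<open>Multiplication by \<open>x\<^sub>i\<^sup>s\<close> shifts \<open>h\<^sub>n\<close> onto
  the monomials of degree \<open>s + n\<close> divisible by \<open>x\<^sub>i\<^sup>s\<close>, each
  hit once.\<close>

lemma lookup_Var_power_chom:
  assumes "finite S" "i \<in> S"
  shows "lookup (Var i ^ s * chom S n) a =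
     (if s \<le> lookup a i \<and> a \<in> comps S (s + n) then 1 else 0)"
proof -
  let ?s = "single i s"
  have "Var i ^ s * chom S n = (\<Sum>c\<in>comps S n. single (?s + c) 1)"
    by (simp add: Var_power_eq chom_def sum_distrib_left mult_single)
  then have "lookup (Var i ^ s * chom S n) a = (\<Sum>c\<in>comps S n. if ?s + c = a then 1 else 0)"
    by (simp add: lookup_sum lookup_single when_def)
  also have "\<dots> = (if s \<le> lookup a i \<and> a \<in> comps S (s + n) then 1 else 0)"
  proof (cases "s \<le> lookup a i \<and> a \<in> comps S (s + n)")
    case True
    define c where "c = a - ?s"
    have eq: "?s + c = a"
      using True by (intro poly_mapping_eqI) (auto simp: c_def lookup_add lookup_minus lookup_single when_def)
    have "keys c \<subseteq> S"
      using True by (auto simp: c_def comps_def in_keys_iff lookup_minus subset_iff)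
    moreover have "mdeg a = s + mdeg c" unfolding eq[symmetric] by (simp add: mdeg_add)
    ultimately have c: "c \<in> comps S n" using True by (simp add: comps_def)
    have "?s + c' = a \<longleftrightarrow> c' = c" for c' using eq by (metis add_left_imp_eq)
    then show ?thesis using True c finite_comps[OF assms(1)] by simp
  next
    case False
    have "?s + c \<noteq> a" if c: "c \<in> comps S n" for c
    proof
      assume eq: "?s + c = a"
      have "lookup a i = s + lookup c i" unfolding eq[symmetric] by (simp add: lookup_add)
      moreover have "mdeg a = s + n" using c unfolding eq[symmetric] by (simp add: mdeg_add comps_def)
      moreover have "keys a \<subseteq> S"
        using Poly_Mapping.keys_add[of ?s c] c assms(2) unfolding eq[symmetric]
        by (auto simp: comps_def split: if_splits)
      ultimately show False using False by (simp add: comps_def)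
    qed
    then show ?thesis using False by (auto intro!: sum.neutral)
  qed
  finally show ?thesis .
qed

text \<open>The coefficient \<open>a\<^sub>i\<close> of \<open>x\<^sup>a\<close> counts the
  \<open>s \<ge> 1\<close> for which \<open>x\<^sub>i\<^sup>s\<close> divides
  \<open>x\<^sup>a\<close>.\<close>

lemma euler_form_eq:
  assumes "i < r"
  shows "euler_form r k i = (\<Sum>s=1..k. Var i ^ s * chom {..<r} (k - s))"
proof (rule poly_mapping_eqI)
  fix a
  have "lookup (\<Sum>s=1..k. Var i ^ s * chom {..<r} (k - s)) a =
      (\<Sum>s=1..k. if s \<le> lookup a i \<and> a \<in> comps {..<r} k then 1 else 0)"
    unfolding lookup_sum using assms by (intro sum.cong) (auto simp: lookup_Var_power_chom)
  also have "\<dots> = lookup (euler_form r k i) a"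
  proof (cases "a \<in> comps {..<r} k")
    case True
    have "lookup a i \<le> k"
      using True by (cases "i \<in> keys a")
        (auto simp: comps_def mdeg_def in_keys_iff intro!: member_le_sum)
    then have "{1..k} \<inter> {s. s \<le> lookup a i} = {1..lookup a i}" by auto
    then show ?thesis using True by (simp add: lookup_euler_form sum.If_cases)
  qed (simp add: lookup_euler_form)
  finally show "lookup (euler_form r k i) a =
      lookup (\<Sum>s=1..k. Var i ^ s * chom {..<r} (k - s)) a" ..
qed

lemma chom_remove:
  assumes "finite S" "i \<in> S" "1 \<le> n"
  shows "chom S n = chom (S - {i}) n + Var i * chom S (n - 1)"
proof (rule poly_mapping_eqI)
  fix a
  have "a \<in> comps (S - {i}) n \<longleftrightarrow> a \<in> comps S n \<and> lookup a i = 0"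
    by (auto simp: comps_def in_keys_iff)
  then show "lookup (chom S n) a =
      lookup (chom (S - {i}) n + Var i * chom S (n - 1)) a"
    using lookup_Var_power_chom[OF assms(1,2), of 1 "n - 1" a] assms
    by (auto simp: lookup_add lookup_chom)
qed

text \<open>Euler's identity for a form of degree \<open>n\<close>.\<close>

lemma sum_euler_form: "(\<Sum>i<r. euler_form r n i) = Cst (of_nat n) * chom {..<r} n"
proof (rule poly_mapping_eqI)
  fix a
  have "lookup (Cst (of_nat n) * chom {..<r} n) a = (if a \<in> comps {..<r} n then of_nat n else 0)"
    by (simp add: chom_def sum_distrib_left mult_single lookup_sum lookup_single when_def finite_comps del: single_of_nat)
  moreover have "(\<Sum>i<r. lookup a i) = n" if "a \<in> comps {..<r} n"
    using that mdeg_superset[of "{..<r}" a] by (simp add: comps_def)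
  ultimately show "lookup (\<Sum>i<r. euler_form r n i) a =
      lookup (Cst (of_nat n) * chom {..<r} n) a"
    by (auto simp: lookup_sum lookup_euler_form simp flip: of_nat_sum)
qed

lemma chom_singleton: "chom {l} n = Var l ^ n"
proof -
  have "comps {l} n = {single l n}"
  proof
    show "comps {l} n \<subseteq> {single l n}"
    proof
      fix a assume a: "a \<in> comps {l} n"
      then have "mdeg a = (\<Sum>i\<in>{l}. lookup a i)"
        by (intro mdeg_superset) (auto simp: comps_def)
      then have "lookup a l = n" using a by (simp add: comps_def)
      then have "a = single l n"
        using a by (intro poly_mapping_eqI) (auto simp: comps_def lookup_single when_def in_keys_iff)
      then show "a \<in> {single l n}" by simp
    qed
  qed (auto simp: comps_def split: if_splits)
  then show ?thesis by (simp add: chom_def Var_power_eq)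
qed

subsection \<open>Powers of the variables in the ideal of the Euler forms\<close>

text \<open>A filtered version of the ideal: the index \<open>n\<close> bounds the degrees of the
  cofactors as if the element were homogeneous of degree \<open>n\<close>. These bounds become the
  assumption \<open>W_upto\<close> of \<open>finite_homogeneous\<close>.\<close>

definition euler_ideal :: "nat \<Rightarrow> nat \<Rightarrow> nat \<Rightarrow> nat cpoly set" where
  "euler_ideal r k n = {F. \<exists>W. (\<forall>i<r. W i \<in> polys_upto r (n - k)) \<and> F = (\<Sum>i<r. euler_form r k i * W i)}"

lemma euler_ideal_0: "0 \<in> euler_ideal r k n"
  unfolding euler_ideal_def by (intro CollectI exI[of _ "\<lambda>_. 0"]) auto

lemma euler_ideal_add: "F \<in> euler_ideal r k n \<Longrightarrow> G \<in> euler_ideal r k n \<Longrightarrow> F + G \<in> euler_ideal r k n"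
proof -
  assume "F \<in> euler_ideal r k n" "G \<in> euler_ideal r k n"
  then obtain V W where "\<forall>i<r. V i \<in> polys_upto r (n - k)" "F = (\<Sum>i<r. euler_form r k i * V i)"
    "\<forall>i<r. W i \<in> polys_upto r (n - k)" "G = (\<Sum>i<r. euler_form r k i * W i)"
    unfolding euler_ideal_def by blast
  then show ?thesis
    unfolding euler_ideal_def by (intro CollectI exI[of _ "\<lambda>i. V i + W i"])
      (auto intro: polys_upto_add simp: distrib_left sum.distrib)
qed

lemma euler_ideal_sum: "(\<And>i. i \<in> A \<Longrightarrow> F i \<in> euler_ideal r k n) \<Longrightarrow> sum F A \<in> euler_ideal r k n"
  by (induction A rule: infinite_finite_induct) (auto simp: euler_ideal_0 euler_ideal_add)

lemma euler_ideal_mult: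
  assumes "F \<in> euler_ideal r k n" "P \<in> polys_upto r d" "k \<le> n"
  shows "P * F \<in> euler_ideal r k (d + n)"
proof -
  obtain W where W: "\<forall>i<r. W i \<in> polys_upto r (n - k)" "F = (\<Sum>i<r. euler_form r k i * W i)"
    using assms(1) unfolding euler_ideal_def by blast
  have "d + n - k = d + (n - k)" using assms(3) by simp
  then have "\<forall>i<r. P * W i \<in> polys_upto r (d + n - k)"
    using W(1) assms(2) by (auto intro: polys_upto_mult)
  moreover have "P * F = (\<Sum>i<r. euler_form r k i * (P * W i))"
    by (simp add: W(2) sum_distrib_left mult_ac)
  ultimately show ?thesis
    unfolding euler_ideal_def by (intro CollectI exI[of _ "\<lambda>i. P * W i"] conjI)
qed

lemma euler_form_in_ideal:
  assumes "i < r" shows "euler_form r k i \<in> euler_ideal r k k"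
proof -
  define W :: "nat \<Rightarrow> nat cpoly" where "W j = (if j = i then 1 else 0)" for j
  have "(\<Sum>j<r. euler_form r k j * W j) = (\<Sum>j<r. if j = i then euler_form r k j else 0)"
    by (intro sum.cong) (auto simp: W_def)
  then have "euler_form r k i = (\<Sum>j<r. euler_form r k j * W j)" using assms by simp
  then show ?thesis
    unfolding euler_ideal_def by (intro CollectI exI[of _ W]) (auto simp: W_def)
qed

text \<open>Newton's identity \<open>n h\<^sub>n = \<Sum> p\<^sub>s h\<^sub>n\<^sub>-\<^sub>s\<close>: modulo the Euler forms, its tail \<open>s > j\<close> (for \<open>n = k + j\<close>)
  is \<open>\<Sum>\<^sub>i x\<^sub>i\<^sup>j (x\<^sub>i \<partial>h\<^sub>k/\<partial>x\<^sub>i)\<close>, so inductively all \<open>h\<^sub>n\<close> with \<open>n \<ge> k\<close> lie in the ideal.\<close>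

lemma chom_in_ideal:
  assumes "1 \<le> k"
  shows "chom {..<r} (k + j) \<in> euler_ideal r k (k + j)"
proof (induction j rule: less_induct)
  case (less j)
  let ?h = "chom {..<r}"
  let ?n = "k + j"
  have "Cst (of_nat ?n) * ?h ?n = (\<Sum>i<r. \<Sum>s=1..?n. Var i ^ s * ?h (?n - s))"
    unfolding sum_euler_form[symmetric] by (intro sum.cong refl euler_form_eq) auto
  also have "\<dots> = (\<Sum>i<r. (\<Sum>s=1..j. Var i ^ s * ?h (?n - s)) + Var i ^ j * euler_form r k i)"
  proof (intro sum.cong refl)
    fix i assume "i \<in> {..<r}"
    have eq: "{1..?n} = {1..j} \<union> {j+1..?n}" by auto
    have "(\<Sum>s=1..?n. Var i ^ s * ?h (?n - s)) =
        (\<Sum>s=1..j. Var i ^ s * ?h (?n - s)) + (\<Sum>s=j+1..?n. Var i ^ s * ?h (?n - s))"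
      unfolding eq by (rule sum.union_disjoint) auto
    also have "(\<Sum>s=j+1..?n. Var i ^ s * ?h (?n - s)) = (\<Sum>s=1..k. Var i ^ (s + j) * ?h (?n - (s + j)))"
      using sum.shift_bounds_cl_nat_ivl[of "\<lambda>s. Var i ^ s * ?h (?n - s)" 1 j k]
      by (simp only: add.commute[of 1 j])
    also have "\<dots> = Var i ^ j * euler_form r k i"
      unfolding euler_form_eq[OF \<open>i \<in> {..<r}\<close>[unfolded lessThan_iff]] sum_distrib_left
      by (intro sum.cong refl) (simp only: power_add diff_cancel2 mult_ac)
    finally show "(\<Sum>s=1..?n. Var i ^ s * ?h (?n - s)) =
        (\<Sum>s=1..j. Var i ^ s * ?h (?n - s)) + Var i ^ j * euler_form r k i" .
  qed
  also have "\<dots> \<in> euler_ideal r k ?n"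
  proof (intro euler_ideal_sum euler_ideal_add)
    fix i assume i: "i \<in> {..<r}"
    then have Var: "Var i ^ s \<in> polys_upto r s" for s
      using polys_upto_power[OF polys_upto_Var[of i r 1], of s] by simp
    show "Var i ^ j * euler_form r k i \<in> euler_ideal r k ?n"
      using euler_ideal_mult[OF euler_form_in_ideal[of i r k] Var[of j]] i by (simp add: add.commute)
    fix s assume s: "s \<in> {1..j}"
    then have eq: "s + (k + (j - s)) = ?n" "?n - s = k + (j - s)" by auto
    show "Var i ^ s * ?h (?n - s) \<in> euler_ideal r k ?n"
      using euler_ideal_mult[OF less.IH[of "j - s"] Var[of s]] s unfolding eq by simp
  qed
  finally have "Cst (1 / of_nat ?n) * (Cst (of_nat ?n) * ?h ?n) \<in> euler_ideal r k (0 + ?n)"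
    by (rule euler_ideal_mult) auto
  moreover have "Cst (1 / of_nat ?n) * (Cst (of_nat ?n) * ?h ?n) = ?h ?n"
  proof -
    have "Cst (1 / of_nat ?n) * Cst (of_nat ?n) = (Cst 1 :: nat cpoly)"
    proof -
      have "1 / of_nat ?n * of_nat ?n = (1 :: complex)"
        using assms by (simp del: of_nat_add)
      then show ?thesis unfolding mult_single by (simp only: add_0_left)
    qed
    then show ?thesis unfolding mult.assoc[symmetric] by simp
  qed
  ultimately show ?case by (simp only: add_0_left)
qed

text \<open>Variables are removed one at a time by \<open>h\<^sub>n(S) = h\<^sub>n(T) - x\<^sub>i
  h\<^sub>n\<^sub>-\<^sub>1(T)\<close> with \<open>T = insert i S\<close>. The last term uses degree
  \<open>n - 1\<close> for \<open>T\<close>, so each removed variable raises the smallest admissible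
  degree by one.\<close>

lemma chom_subset_in_ideal:
  assumes "1 \<le> k" "S \<subseteq> {..<r}" "k + card ({..<r} - S) \<le> n"
  shows "chom S n \<in> euler_ideal r k n"
  using assms(2,3)
proof (induction "card ({..<r} - S)" arbitrary: S n)
  case 0
  then have "S = {..<r}" by auto
  then show ?case using chom_in_ideal[OF assms(1), of r "n - k"] 0 by simp
next
  case (Suc c)
  then have "{..<r} - S \<noteq> {}" by (metis card.empty nat.distinct(1))
  then obtain i where i: "i < r" "i \<notin> S" by auto
  let ?T = "insert i S"
  have "{..<r} - ?T = ({..<r} - S) - {i}" by auto
  then have card: "card ({..<r} - ?T) = c" using Suc(2) i by (simp add: card_Diff_singleton)
  have T: "?T \<subseteq> {..<r}" "finite ?T" using Suc.prems(1) i by (auto intro: finite_subset)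
  have n: "k + c \<le> n - 1" "1 \<le> n" using Suc.prems(2) Suc(2) by auto
  have 1: "chom ?T n \<in> euler_ideal r k n" and 2: "chom ?T (n - 1) \<in> euler_ideal r k (n - 1)"
    using Suc(1)[OF card[symmetric] T(1)] card n by auto
  have "(- 1) * (Var i * chom ?T (n - 1)) \<in> euler_ideal r k (0 + (1 + (n - 1)))"
    using i(1) n by (intro euler_ideal_mult 2 polys_upto_Var polys_upto_uminus) auto
  then have "chom ?T n + (- 1) * (Var i * chom ?T (n - 1)) \<in> euler_ideal r k n"
    using 1 n by (intro euler_ideal_add) auto
  moreover have "?T - {i} = S" using i by auto
  then have "chom ?T n = chom S n + Var i * chom ?T (n - 1)"
    using chom_remove[OF T(2), of i n] n by simp
  ultimately show ?case by simp
qed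

text \<open>In one variable \<open>h\<^sub>n\<close> is the power \<open>x\<^sub>l\<^sup>n\<close>;
  removing the \<open>r - 1\<close> other variables is the origin of the exponent
  \<open>k + r - 1\<close>.\<close>

lemma Var_power_in_ideal:
  assumes "1 \<le> k" "l < r"
  shows "Var l ^ (k + r - 1) \<in> euler_ideal r k (k + r - 1)"
proof -
  have "card ({..<r} - {l}) = r - 1" using assms(2) by (simp add: card_Diff_singleton)
  then show ?thesis
    using chom_subset_in_ideal[OF assms(1), of "{l}" r "k + r - 1"] assms by (simp add: chom_singleton)
qed

lemma euler_forms_common_zero:
  assumes "1 \<le> k" "\<And>i. i < r \<Longrightarrow> peval (euler_form r k i) x = 0" "l < r"
  shows "x l = 0"
proof -
  obtain W where "Var l ^ (k + r - 1) = (\<Sum>i<r. euler_form r k i * W i)"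
    using Var_power_in_ideal[OF assms(1,3)] unfolding euler_ideal_def by blast
  then have "peval (Var l ^ (k + r - 1)) x = peval (\<Sum>i<r. euler_form r k i * W i) x" by simp
  then have "x l ^ (k + r - 1) = 0"
    using assms(2) by (simp add: peval.hom_power peval.hom_sum peval.hom_mult)
  then show ?thesis by simp
qed

subsection \<open>Algebraic independence of the Euler forms\<close>

text \<open>Non-negative coefficients cannot cancel, so the largest weight with a positive
  coefficient is the degree even if it is attained several times.\<close>

lemma degree_nonneg_sum:
  fixes c e :: "'a \<Rightarrow> nat"
  assumes "finite A" "a \<in> A" "c a > 0" "\<And>b. b \<in> A \<Longrightarrow> c b > 0 \<Longrightarrow> e b \<le> e a"
  defines "p \<equiv> \<Sum>b\<in>A. [:of_nat (c b):] * monom (1::complex) (e b)"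
  shows "degree p = e a" "p \<noteq> 0"
proof -
  have coeff: "coeff p j = of_nat (\<Sum>b\<in>A. if e b = j then c b else 0)" for j
    unfolding p_def by (auto simp: coeff_sum intro!: sum.cong)
  have "(\<Sum>b\<in>A. if e b = e a then c b else 0) > 0"
    using assms(1-3) by (intro sum_pos2[of _ a]) auto
  then have ne: "coeff p (e a) \<noteq> 0" unfolding coeff by (simp only: of_nat_eq_0_iff)
  have "coeff p j = 0" if "e a < j" for j
  proof -
    have "(if e b = j then c b else 0) = 0" if "b \<in> A" for b
      using assms(4)[of b] that \<open>e a < j\<close> by (cases "c b = 0") auto
    then show ?thesis unfolding coeff by simp
  qed
  then have "degree p \<le> e a" by (intro degree_le) auto
  then show "degree p = e a" using le_degree[OF ne] by simp
  show "p \<noteq> 0" using ne by auto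
qed

text \<open>After a weighted substitution into one variable, the degree of a product of powers of
  the Euler forms determines all the exponents, so no cancellation can occur between different
  monomials of \<open>F\<close>.\<close>

lemma euler_forms_indep:
  assumes "1 \<le> k" "1 \<le> r" "F \<in> poly_ring r" "psubst Cst (euler_form r k) F = 0"
  shows "F = 0"
proof (rule ccontr)
  assume F: "F \<noteq> 0"
  obtain B where B: "\<And>m i. m \<in> keys F \<Longrightarrow> lookup m i < B"
    using lookup_bound_obtain[of "keys F"] by auto
  obtain m where "m \<in> keys F" using F by fastforce
  then have B1: "1 \<le> B" using B[of m 0] by simp
  \<comment> \<open>The powers \<open>B ^ i\<close> separate the exponents. Variable
    \<open>0\<close> gets \<open>B ^ r\<close> in place of \<open>1\<close>, which makes the weight
    of \<open>x\<^sub>0\<^sup>k\<^sup>-\<^sup>1 x\<^sub>i\<close> largest among the monomials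
    occurring in the \<open>i\<close>-th Euler form.\<close>
  define w where "w i = (if i = 0 then B ^ r else B ^ i)" for i :: nat
  have w: "w i \<le> B ^ r" if "i < r" for i
    using that B1 by (auto simp: w_def intro: power_increasing)
  define T :: "nat cpoly \<Rightarrow> complex poly" where "T = psubst (\<lambda>c. [:c:]) (\<lambda>i. monom 1 (w i))"
  have T_hom: "comm_ring_hom T"
    unfolding T_def by (rule const_hom.comm_ring_hom_psubst[OF const_hom_pCons])
  have T_single: "T (single m c) = [:c:] * mono_eval (\<lambda>i. monom 1 (w i)) m" for m c
    unfolding T_def by (rule const_hom.psubst_single[OF const_hom_pCons])
  define wt where "wt a = (\<Sum>j\<in>keys a. w j * lookup a j)" for a
  have g: "degree (T (euler_form r k i)) = (k - 1) * B ^ r + w i" "T (euler_form r k i) \<noteq> 0" if i: "i < r" for i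
  proof -
    let ?a = "single 0 (k - 1) + single i 1"
    have keys: "keys ?a \<subseteq> {..<r}"
      using Poly_Mapping.keys_add[of "single 0 (k - 1)" "single i 1"] i by (auto split: if_splits)
    then have a: "?a \<in> comps {..<r} k" using assms(1) by (simp add: comps_def mdeg_add)
    have wt_eq: "wt a = (\<Sum>j<r. w j * lookup a j)" if "a \<in> comps {..<r} k" for a
      unfolding wt_def using that by (intro sum.mono_neutral_left) (auto simp: comps_def in_keys_iff)
    have wt_a: "wt ?a = (k - 1) * B ^ r + w i"
    proof -
      have "wt ?a = (\<Sum>j<r. (if j = 0 then w 0 * (k - 1) else 0) + (if j = i then w i else 0))"
        unfolding wt_eq[OF a] by (intro sum.cong) (auto simp: lookup_add lookup_single when_def algebra_simps)
      then show ?thesis using assms(2) i by (simp add: sum.distrib w_def[of 0] mult.commute)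
    qed
    have "wt b \<le> wt ?a" if b: "b \<in> comps {..<r} k" "lookup b i > 0" for b
    proof -
      have "wt b = w i * lookup b i + (\<Sum>j\<in>{..<r} - {i}. w j * lookup b j)"
        unfolding wt_eq[OF b(1)] using i by (intro sum.remove) auto
      also have "\<dots> \<le> (w i + B ^ r * (lookup b i - 1)) + (\<Sum>j\<in>{..<r} - {i}. B ^ r * lookup b j)"
      proof (rule add_mono)
        have "w i * lookup b i = w i + w i * (lookup b i - 1)"
          using b(2) by (cases "lookup b i") auto
        then show "w i * lookup b i \<le> w i + B ^ r * (lookup b i - 1)"
          using w[OF i] by simp
        show "(\<Sum>j\<in>{..<r} - {i}. w j * lookup b j) \<le> (\<Sum>j\<in>{..<r} - {i}. B ^ r * lookup b j)"
          using w by (intro sum_mono mult_le_mono1) auto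
      qed
      also have "\<dots> = w i + B ^ r * ((lookup b i - 1) + (\<Sum>j\<in>{..<r} - {i}. lookup b j))"
        by (simp add: sum_distrib_left distrib_left)
      also have "(lookup b i - 1) + (\<Sum>j\<in>{..<r} - {i}. lookup b j) = k - 1"
      proof -
        have "k = (\<Sum>j<r. lookup b j)"
          using b(1) mdeg_superset[of "{..<r}" b] by (simp add: comps_def)
        also have "\<dots> = lookup b i + (\<Sum>j\<in>{..<r} - {i}. lookup b j)"
          using i by (intro sum.remove) auto
        finally show ?thesis using b(2) by simp
      qed
      finally show ?thesis using wt_a by (simp add: mult.commute)
    qed
    then have "lookup b i > 0 \<Longrightarrow> wt b \<le> wt ?a" if "b \<in> comps {..<r} k" for b
      using that by blast
    moreover have "T (euler_form r k i) = (\<Sum>b\<in>comps {..<r} k. [:of_nat (lookup b i):] * monom 1 (wt b))"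
      unfolding euler_form_def comm_ring_hom.axioms
      using T_hom by (simp add: T_def const_hom.psubst_sum[OF const_hom_pCons]
          const_hom.psubst_single[OF const_hom_pCons] mono_eval_monom wt_def)
    moreover have "lookup ?a i > 0" by (simp add: lookup_add)
    ultimately show "degree (T (euler_form r k i)) = (k - 1) * B ^ r + w i" "T (euler_form r k i) \<noteq> 0"
      using degree_nonneg_sum[of "comps {..<r} k" ?a "\<lambda>b. lookup b i" wt] a
        finite_comps[of "{..<r}" k] unfolding wt_a[symmetric] by simp_all
  qed
  let ?g = "\<lambda>i. T (euler_form r k i)"
  have keysF: "keys m \<subseteq> {..<r}" if "m \<in> keys F" for m
    using that assms(3) by (auto simp: poly_ring_iff)
  have ne: "mono_eval ?g m \<noteq> 0" if "m \<in> keys F" for m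
    using g(2) keysF[OF that] by (auto simp: mono_eval_def)
  \<comment> \<open>Digit \<open>0\<close> stays empty: the exponent of variable \<open>0\<close>
    sits above \<open>B ^ r\<close> in \<open>hi\<close>, together with the contribution
    \<open>(k - 1) * B ^ r\<close> of every factor.\<close>
  define lo where "lo m i = (if i = 0 then 0 else lookup m i)" for m :: "nat \<Rightarrow>\<^sub>0 nat" and i
  define hi where "hi m = (k - 1) * (\<Sum>i<r. lookup m i) + lookup m 0" for m :: "nat \<Rightarrow>\<^sub>0 nat"
  have deg: "degree (mono_eval ?g m) = (\<Sum>i<r. B ^ i * lo m i) + B ^ r * hi m"
    if "m \<in> keys F" for m
  proof -
    have "degree (mono_eval ?g m) = (\<Sum>i<r. lookup m i * degree (?g i))"
      unfolding mono_eval_superset[OF finite_lessThan keysF[OF that]]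
      using g(2) by (subst degree_prod_eq_sum_degree) (auto simp: degree_power_eq intro!: sum.cong)
    also have "\<dots> = (\<Sum>i<r. lookup m i * ((k - 1) * B ^ r) + (B ^ i * lo m i + (if i = 0 then B ^ r * lookup m 0 else 0)))"
      by (intro sum.cong) (auto simp: g(1) lo_def w_def algebra_simps)
    also have "\<dots> = (\<Sum>i<r. B ^ i * lo m i) + B ^ r * hi m"
    proof -
      obtain K where K: "k - 1 = K" by simp
      show ?thesis
        using assms(2) unfolding K hi_def
        by (simp add: sum.distrib sum_distrib_left algebra_simps)
    qed
    finally show ?thesis .
  qed
  have "psubst (\<lambda>c. [:c:]) ?g F \<noteq> 0"
  proof (rule psubst_nonzero_degree[OF F ne])
    show "inj_on (\<lambda>m. degree (mono_eval ?g m)) (keys F)"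
    proof (rule inj_onI)
      fix m m' assume m: "m \<in> keys F" "m' \<in> keys F"
        "degree (mono_eval ?g m) = degree (mono_eval ?g m')"
      have lt: "lo n i < B" if "n \<in> keys F" for n i
        using B[OF that] B1 by (auto simp: lo_def)
      have *: "(\<forall>i<r. lo m i = lo m' i) \<and> hi m = hi m'"
        using m lt by (intro digit_sum_unique[of r "lo m" B "lo m'"]) (auto simp: deg)
      have eq: "lookup m i = lookup m' i" if "i < r" "i \<noteq> 0" for i
        using * that by (auto simp: lo_def split: if_splits)
      have split: "(\<Sum>i<r. lookup n i) = lookup n 0 + (\<Sum>i\<in>{..<r} - {0}. lookup n i)"
        for n :: "nat \<Rightarrow>\<^sub>0 nat"
        using assms(2) by (intro sum.remove) auto
      have "(\<Sum>i\<in>{..<r} - {0}. lookup m i) = (\<Sum>i\<in>{..<r} - {0}. lookup m' i)"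
        using eq by (intro sum.cong) auto
      \<comment> \<open>Once the other exponents agree, \<open>hi\<close> fixes \<open>k\<close>
        times the exponent of variable \<open>0\<close>.\<close>
      then have "(k - 1) * lookup m 0 + lookup m 0 = (k - 1) * lookup m' 0 + lookup m' 0"
        using * by (simp add: hi_def split distrib_left)
      then have "(k - 1 + 1) * lookup m 0 = (k - 1 + 1) * lookup m' 0"
        by (simp only: distrib_right mult_1)
      then have "lookup m 0 = lookup m' 0"
        by (subst (asm) mult_cancel1) simp
      then show "m = m'"
        using eq keysF m by (intro poly_mapping_eqI_lessThan[of _ r]) metis+
    qed
  qed
  moreover have "T (psubst Cst (euler_form r k) F) = psubst (\<lambda>c. [:c:]) ?g F"
    by (subst hom_psubst[OF T_hom]) (simp add: T_single)
  ultimately show False using assms(4) by (simp add: T_def const_hom.psubst_0[OF const_hom_pCons])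
qed

theorem euler_forms_generic_fibre_card:
  assumes "1 \<le> k" "1 \<le> r"
  shows "\<exists>D\<in>poly_ring r. D \<noteq> 0 \<and> (\<forall>b. peval D b \<noteq> 0 \<longrightarrow> card (fibre r (euler_form r k) b) = k ^ r)"
proof -
  let ?N = "k + r - 1"
  let ?P = "\<lambda>l W. (\<forall>i<r. W i \<in> polys_upto r (?N - k)) \<and> Var l ^ ?N = (\<Sum>i<r. euler_form r k i * W i)"
  have "\<forall>l\<in>{..<r}. \<exists>W. ?P l W"
    using Var_power_in_ideal[OF assms(1)] unfolding euler_ideal_def by blast
  then have "\<exists>W. \<forall>l\<in>{..<r}. ?P l (W l)" by (rule bchoice)
  then obtain W where W: "\<forall>l\<in>{..<r}. ?P l (W l)" ..
  interpret finite_homogeneous r "euler_form r k" k ?N W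
  proof
    show "euler_form r k i \<in> poly_ring r" for i
      using keys_euler_form[of r k i] by (auto simp: poly_ring_iff comps_def)
    show "mdeg m = k" if "m \<in> keys (euler_form r k i)" for i m
      using keys_euler_form[of r k i] that by (auto simp: comps_def)
  qed (use assms euler_forms_indep W in auto)
  show ?thesis by (rule generic_fibre_card)
qed

section \<open>Differential calculus and geometry of the Veronese cone\<close>

subsection \<open>Gradients and logarithmic derivatives\<close>

text \<open>Ties the coordinatewise \<open>deriv\<close> in the definition of
  \<open>gradient\<close> to the formal partial derivatives, and through them to derivatives along
  arbitrary lines.\<close>

lemma gradient_scalar_prod:
  assumes "F \<in> poly_ring n" "p \<in> carrier_vec n" "v \<in> carrier_vec n"
  shows "scalar_prod (gradient n F p) v = (\<Sum>i<n. peval (pdiff i F) (\<lambda>i. p $ i) * v $ i)"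
    and "((\<lambda>t. evalv F (p + t \<cdot>\<^sub>v v)) has_field_derivative scalar_prod (gradient n F p) v) (at 0)"
proof -
  have pv: "pvars F \<subseteq> {..<n}" using assms(1) by (simp add: poly_ring_def)
  have line: "((\<lambda>t. evalv F (p + t \<cdot>\<^sub>v w)) has_field_derivative
      (\<Sum>i<n. peval (pdiff i F) (\<lambda>i. p $ i) * w $ i)) (at 0)" if w: "w \<in> carrier_vec n" for w
  proof -
    have "((\<lambda>t. peval F (\<lambda>i. p $ i + t * w $ i)) has_field_derivative
        (\<Sum>i<n. peval (pdiff i F) (\<lambda>i. p $ i + 0 * w $ i) * w $ i)) (at 0)"
      by (intro peval_has_field_derivative pv) (auto intro!: derivative_eq_intros)
    moreover have "(\<lambda>t. peval F (\<lambda>i. p $ i + t * w $ i)) = (\<lambda>t. evalv F (p + t \<cdot>\<^sub>v w))"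
      using assms(2) w pv by (intro ext peval_cong) auto
    ultimately show ?thesis by simp
  qed
  have grad: "gradient n F p $ i = peval (pdiff i F) (\<lambda>i. p $ i)" if i: "i < n" for i
  proof -
    have "(\<Sum>j<n. peval (pdiff j F) (\<lambda>i. p $ i) * unit_vec n i $ j) =
        (\<Sum>j<n. if j = i then peval (pdiff j F) (\<lambda>i. p $ i) else 0)"
      using i by (intro sum.cong) (auto simp: unit_vec_def)
    also have "\<dots> = peval (pdiff i F) (\<lambda>i. p $ i)" using i by simp
    finally show ?thesis
      using i line[of "unit_vec n i"] by (simp add: gradient_def DERIV_imp_deriv)
  qed
  show *: "scalar_prod (gradient n F p) v = (\<Sum>i<n. peval (pdiff i F) (\<lambda>i. p $ i) * v $ i)"
    using assms(3) grad by (auto simp: scalar_prod_def lessThan_atLeast0 intro!: sum.cong)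
  show "((\<lambda>t. evalv F (p + t \<cdot>\<^sub>v v)) has_field_derivative scalar_prod (gradient n F p) v) (at 0)"
    unfolding * by (rule line[OF assms(3)])
qed

text \<open>The logarithmic derivative of a monomial is linear in those of its variables. Writing
  the derivative of \<open>\<gamma> i\<close> as \<open>\<gamma> i t * w i\<close> avoids
  division.\<close>

lemma mono_eval_log_derivative:
  fixes \<gamma> :: "'v \<Rightarrow> complex \<Rightarrow> complex"
  assumes "finite I" "keys m \<subseteq> I"
    and "\<And>i. i \<in> I \<Longrightarrow> (\<gamma> i has_field_derivative \<gamma> i t * w i) (at t)"
  shows "((\<lambda>t. mono_eval (\<lambda>i. \<gamma> i t) m) has_field_derivative
     mono_eval (\<lambda>i. \<gamma> i t) m * (\<Sum>i\<in>I. of_nat (lookup m i) * w i)) (at t)"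
proof -
  have eq: "of_nat (lookup m i) * mono_eval (\<lambda>i. \<gamma> i t) (m - single i 1) * (\<gamma> i t * w i) =
      mono_eval (\<lambda>i. \<gamma> i t) m * (of_nat (lookup m i) * w i)" for i
  proof (cases "lookup m i = 0")
    case False
    define m' where "m' = m - single i 1"
    have "m = m' + single i 1"
      using False by (intro poly_mapping_eqI) (auto simp: m'_def lookup_add lookup_minus lookup_single when_def)
    then have "mono_eval (\<lambda>i. \<gamma> i t) m = mono_eval (\<lambda>i. \<gamma> i t) m' * \<gamma> i t"
      by (simp add: mono_eval_add)
    then show ?thesis unfolding m'_def[symmetric] by simp
  qed simp
  have "((\<lambda>t. mono_eval (\<lambda>i. \<gamma> i t) m) has_field_derivative
     (\<Sum>i\<in>I. of_nat (lookup m i) * mono_eval (\<lambda>i. \<gamma> i t) (m - single i 1) * (\<gamma> i t * w i))) (at t)"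
    using assms by (intro mono_eval_has_field_derivative)
  then show ?thesis unfolding eq sum_distrib_left .
qed

lemma mono_eval_eq_0: "j \<in> keys m \<Longrightarrow> x j = (0::complex) \<Longrightarrow> mono_eval x m = 0"
  unfolding mono_eval_def by (rule prod_zero) (auto simp: in_keys_iff intro!: bexI[of _ j])

lemma keys_comps: "a \<in> comps S q \<Longrightarrow> j \<in> keys a \<Longrightarrow> j \<in> S"
  by (auto simp: comps_def)

subsection \<open>Full row rank\<close>

text \<open>The columns include those of \<open>z\<close> times the identity, whose independence
  gives the lower bound; the upper bound is the dimension \<open>L\<close> of the space containing
  the columns.\<close>

lemma rank_eq_dim_row:
  fixes J :: "complex mat"
  assumes J: "J \<in> carrier_mat L n" and z: "z \<noteq> 0"
    and cols: "\<And>l. l < L \<Longrightarrow> \<exists>c<n. col J c = z \<cdot>\<^sub>v unit_vec L l"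
  shows "vec_space.rank L J = L"
proof -
  interpret V: vec_space "TYPE(complex)" L .
  define Z where "Z = z \<cdot>\<^sub>m (1\<^sub>m L)"
  have Z: "Z \<in> carrier_mat L L" by (simp add: Z_def)
  have "det Z \<noteq> 0" using z by (simp add: Z_def)
  then have rank: "V.rank Z = L" by (rule V.low_rank_det_zero[OF Z])
  have colZ: "col Z l = z \<cdot>\<^sub>v unit_vec L l" if "l < L" for l
    using that by (intro eq_vecI) (auto simp: Z_def)
  have colsZ: "cols Z = map (\<lambda>l. z \<cdot>\<^sub>v unit_vec L l) [0..<L]"
    using colZ Z unfolding cols_def by auto
  have dist: "distinct (cols Z)"
    unfolding colsZ distinct_map
  proof (intro conjI inj_onI)
    fix l l' assume l: "l \<in> set [0..<L]" "l' \<in> set [0..<L]" "z \<cdot>\<^sub>v unit_vec L l = z \<cdot>\<^sub>v unit_vec L l'"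
    then have "(z \<cdot>\<^sub>v unit_vec L l) $ l = (z \<cdot>\<^sub>v unit_vec L l') $ l" by simp
    then show "l = l'" using l(1,2) z by (auto split: if_splits)
  qed simp
  have li: "V.lin_indpt (set (cols Z))" by (rule V.full_rank_lin_indpt[OF Z rank dist])
  have "set (cols Z) \<subseteq> set (cols J)"
  proof
    fix y assume "y \<in> set (cols Z)"
    then obtain l where l: "l < L" "y = z \<cdot>\<^sub>v unit_vec L l" unfolding colsZ by auto
    then obtain c where "c < n" "col J c = y" using cols by metis
    then show "y \<in> set (cols J)" using J by (auto simp: cols_def)
  qed
  note sub = this
  have "card (set (cols Z)) \<le> V.rank J" by (rule V.rank_ge_card_indpt[OF J sub li])
  moreover have "card (set (cols Z)) = L" using distinct_card[OF dist] Z by simp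
  moreover have "V.rank J \<le> L"
  proof -
    obtain S where S: "maximal S (\<lambda>T. T \<subseteq> set (cols J) \<and> V.lin_indpt T)"
      using maximal_exists_superset[of "set (cols J)" "\<lambda>T. T \<subseteq> set (cols J) \<and> V.lin_indpt T" "set (cols Z)"]
        sub li by blast
    then have "S \<subseteq> set (cols J)" and "V.lin_indpt S" by (auto simp: maximal_def)
    moreover have "set (cols J) \<subseteq> carrier_vec L" using J cols_dim[of J] by simp
    ultimately have "card S \<le> V.dim" by (intro V.li_le_dim(2)) auto
    then show ?thesis using V.rank_card_indpt[OF J S] V.dim_is_n by simp
  qed
  ultimately show ?thesis by simp
qed

subsection \<open>The Veronese cone\<close>

locale veronese =
  fixes m k :: nat and A :: "int mat"
  assumes vm: "veronese_matrix m k A" and k_pos: "1 \<le> k"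
begin

abbreviation n :: nat where "n \<equiv> dim_col A"

definition r :: nat where "r = Suc m"

lemma r_simps [simp]: "0 < r" "Suc l < r \<longleftrightarrow> l < m"
  by (auto simp: r_def)

text \<open>Homogenised exponent vectors: the coordinate \<open>0\<close> brings the coordinate sum up to \<open>k\<close>.\<close>

definition hexp :: "nat \<Rightarrow> (nat \<Rightarrow>\<^sub>0 nat)" where
  "hexp i = (\<Sum>j<r. single j
      (if j = 0 then nat (int k - (\<Sum>l<m. A $$ (l, i))) else nat (A $$ (j - 1, i))))"

lemma lookup_hexp: "lookup (hexp i) j = (if j < r then
    (if j = 0 then nat (int k - (\<Sum>l<m. A $$ (l, i))) else nat (A $$ (j - 1, i))) else 0)"
  by (simp add: hexp_def lookup_sum lookup_single when_def)

lemma dim_row_A: "dim_row A = m"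
  using vm by (simp add: veronese_matrix_def)

lemma col_exponents:
  assumes "i < n"
  shows "l < m \<Longrightarrow> 0 \<le> A $$ (l, i)" "(\<Sum>l<m. A $$ (l, i)) \<le> int k"
proof -
  have "col A i \<in> set (cols A)" using assms by (simp add: cols_def)
  then have *: "(\<forall>j<m. 0 \<le> col A i $ j) \<and> (\<Sum>j<m. col A i $ j) \<le> int k"
    using vm by (simp add: veronese_matrix_def)
  have col: "col A i $ l = A $$ (l, i)" if "l < m" for l
    using that assms dim_row_A by simp
  show "l < m \<Longrightarrow> 0 \<le> A $$ (l, i)" using * col by simp
  have "(\<Sum>j<m. col A i $ j) = (\<Sum>l<m. A $$ (l, i))" using col by (intro sum.cong) auto
  then show "(\<Sum>l<m. A $$ (l, i)) \<le> int k" using * by simp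
qed

lemma lookup_hexp_Suc: "i < n \<Longrightarrow> l < m \<Longrightarrow> int (lookup (hexp i) (Suc l)) = A $$ (l, i)"
  using col_exponents(1)[of i l] by (simp add: lookup_hexp)

lemma lookup_hexp_0: "i < n \<Longrightarrow> int (lookup (hexp i) 0) = int k - (\<Sum>l<m. A $$ (l, i))"
  using col_exponents(2)[of i] by (simp add: lookup_hexp)

lemma hexp_comps: assumes "i < n" shows "hexp i \<in> comps {..<r} k"
proof -
  have keys: "keys (hexp i) \<subseteq> {..<r}"
    by (auto simp: in_keys_iff lookup_hexp split: if_splits)
  have "int (mdeg (hexp i)) = int (\<Sum>j<Suc m. lookup (hexp i) j)"
    unfolding r_def[symmetric] by (subst mdeg_superset[OF _ keys]) auto
  also have "\<dots> = int k"
    unfolding sum.lessThan_Suc_shift using assms by (simp add: lookup_hexp_0 lookup_hexp_Suc)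
  finally show ?thesis using keys by (simp add: comps_def)
qed

lemma bij_hexp: "bij_betw hexp {..<n} (comps {..<r} k)"
  unfolding bij_betw_def
proof
  show "inj_on hexp {..<n}"
  proof (rule inj_onI)
    fix i i' assume i: "i \<in> {..<n}" "i' \<in> {..<n}" "hexp i = hexp i'"
    have "A $$ (l, i) = A $$ (l, i')" if "l < m" for l
      using lookup_hexp_Suc[of i l] lookup_hexp_Suc[of i' l] i that by simp
    then have "col A i = col A i'" using i dim_row_A by (intro eq_vecI) auto
    then have "cols A ! i = cols A ! i'" using i by simp
    moreover have "distinct (cols A)" using vm by (simp add: veronese_matrix_def)
    ultimately show "i = i'" using i nth_eq_iff_index_eq[of "cols A" i i'] by (metis cols_length lessThan_iff)
  qed
  show "hexp ` {..<n} = comps {..<r} k"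
  proof
    show "hexp ` {..<n} \<subseteq> comps {..<r} k" using hexp_comps by auto
    show "comps {..<r} k \<subseteq> hexp ` {..<n}"
    proof
      fix c assume c: "c \<in> comps {..<r} k"
      let ?a = "vec m (\<lambda>l. int (lookup c (Suc l)))"
      have deg: "k = (\<Sum>j<Suc m. lookup c j)"
        using c mdeg_superset[of "{..<r}" c] unfolding r_def[symmetric] by (simp add: comps_def)
      then have k: "k = lookup c 0 + (\<Sum>l<m. lookup c (Suc l))"
        unfolding sum.lessThan_Suc_shift by simp
      have sum: "(\<Sum>l<m. ?a $ l) = int (\<Sum>l<m. lookup c (Suc l))" by simp
      then have "?a \<in> set (cols A)" using vm k by (simp add: veronese_matrix_def)
      then obtain i where i: "i < n" "col A i = ?a" by (auto simp: cols_def)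
      have entry: "A $$ (l, i) = int (lookup c (Suc l))" if "l < m" for l
      proof -
        have "A $$ (l, i) = col A i $ l" using that i(1) dim_row_A by simp
        then show ?thesis using i(2) that by simp
      qed
      have "hexp i = c"
      proof (rule poly_mapping_eqI_lessThan[of _ r])
        show "keys (hexp i) \<subseteq> {..<r}" "keys c \<subseteq> {..<r}"
          using hexp_comps[OF i(1)] c by (auto simp: comps_def)
        fix j assume "j < r"
        show "lookup (hexp i) j = lookup c j"
        proof (cases j)
          case 0
          have "(\<Sum>l<m. A $$ (l, i)) = int (\<Sum>l<m. lookup c (Suc l))"
            unfolding of_nat_sum using entry by (intro sum.cong) auto
          then show ?thesis using 0 lookup_hexp_0[OF i(1)] k by simp
        next
          case (Suc l)
          then show ?thesis using \<open>j < r\<close> lookup_hexp_Suc[OF i(1), of l] entry[of l] by simp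
        qed
      qed
      then show "c \<in> hexp ` {..<n}" using i(1) by auto
    qed
  qed
qed

definition idx :: "(nat \<Rightarrow>\<^sub>0 nat) \<Rightarrow> nat" where
  "idx = the_inv_into {..<n} hexp"

lemma idx: "c \<in> comps {..<r} k \<Longrightarrow> idx c < n \<and> hexp (idx c) = c"
  using bij_hexp f_the_inv_into_f_bij_betw[OF bij_hexp, of c] bij_betw_the_inv_into[OF bij_hexp]
  unfolding idx_def by (auto simp: bij_betw_def)

lemma idx_hexp: "i < n \<Longrightarrow> idx (hexp i) = i"
  using bij_hexp unfolding idx_def by (auto simp: bij_betw_def intro: the_inv_into_f_f)

definition ver :: "(nat \<Rightarrow> complex) \<Rightarrow> complex vec" where
  "ver x = vec n (\<lambda>i. mono_eval x (hexp i))"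

lemma ver_carrier [simp]: "ver x \<in> carrier_vec n"
  by (simp add: ver_def)

lemma ver_index [simp]: "i < n \<Longrightarrow> ver x $ i = mono_eval x (hexp i)"
  by (simp add: ver_def)

lemma ver_idx: "c \<in> comps {..<r} k \<Longrightarrow> ver x $ idx c = mono_eval x c"
  using idx by simp

lemma mono_eval_comps: "c \<in> comps {..<r} q \<Longrightarrow> mono_eval x c = (\<Prod>j<r. x j ^ lookup c j)"
  by (intro mono_eval_superset) (auto simp: comps_def)

lemma peval_euler_form: "peval (euler_form r k j) x = (\<Sum>i<n. of_nat (lookup (hexp i) j) * ver x $ i)"
proof -
  have "peval (euler_form r k j) x = (\<Sum>a\<in>comps {..<r} k. of_nat (lookup a j) * mono_eval x a)"
    unfolding euler_form_def by (simp add: peval.hom_sum peval_single)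
  also have "\<dots> = (\<Sum>i<n. of_nat (lookup (hexp i) j) * mono_eval x (hexp i))"
    by (rule sum.reindex_bij_betw[OF bij_hexp, symmetric])
  finally show ?thesis by simp
qed

lemma ver_scale: "ver (\<lambda>j. t * x j) = t ^ k \<cdot>\<^sub>v ver x"
proof (rule eq_vecI)
  fix i assume "i < dim_vec (t ^ k \<cdot>\<^sub>v ver x)"
  then have i: "i < n" by (simp add: ver_def)
  then show "ver (\<lambda>j. t * x j) $ i = (t ^ k \<cdot>\<^sub>v ver x) $ i"
    using hexp_comps[OF i] by (simp add: mono_eval_scale comps_def ver_def)
qed (simp add: ver_def)

lemma ver_0_eq: "(\<And>j. j < r \<Longrightarrow> x j = 0) \<Longrightarrow> ver x = 0\<^sub>v n"
proof (rule eq_vecI)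
  fix i assume x: "\<And>j. j < r \<Longrightarrow> x j = 0" and "i < dim_vec (0\<^sub>v n :: complex vec)"
  then have i: "i < n" by simp
  have "hexp i \<noteq> 0" using hexp_comps[OF i] k_pos by (auto simp: comps_def)
  then obtain j where "j \<in> keys (hexp i)" by fastforce
  then have "mono_eval x (hexp i) = 0"
    using keys_comps[OF hexp_comps[OF i]] by (intro mono_eval_eq_0 x) auto
  then show "ver x $ i = 0\<^sub>v n $ i" using i by simp
qed (simp add: ver_def)

definition torus_points :: "complex vec set" where
  "torus_points = {toric_param A (ones_vec n) s \<theta> | s \<theta>. s \<noteq> 0 \<and> \<theta> \<in> torus (dim_row A)}"

text \<open>Dehomogenisation: \<open>s = x\<^sub>0\<^sup>k\<close>, and \<open>\<theta>\<close>
  consists of the quotients of the other coordinates by \<open>x\<^sub>0\<close>.\<close>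

lemma toric_param_eq_ver:
  assumes "\<And>l. l < m \<Longrightarrow> x (Suc l) = x 0 * \<theta> $ l" "x 0 \<noteq> 0" "\<theta> \<in> torus m"
  shows "toric_param A (ones_vec n) (x 0 ^ k) \<theta> = ver x"
proof (rule eq_vecI)
  fix i assume "i < dim_vec (ver x)"
  then have i: "i < n" by (simp add: ver_def)
  have "laurent_monom \<theta> (col A i) = (\<Prod>l<m. \<theta> $ l powi A $$ (l, i))"
    unfolding laurent_monom_def using i dim_row_A by (intro prod.cong) auto
  also have "\<dots> = (\<Prod>l<m. \<theta> $ l ^ lookup (hexp i) (Suc l))"
    using i by (intro prod.cong) (auto simp: lookup_hexp_Suc[symmetric] simp del: of_nat_Suc)
  finally have lm: "laurent_monom \<theta> (col A i) = (\<Prod>l<m. \<theta> $ l ^ lookup (hexp i) (Suc l))" .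
  define y where "y j = (if j = 0 then 1 else \<theta> $ (j - 1))" for j
  have "mono_eval x (hexp i) = mono_eval (\<lambda>j. x 0 * y j) (hexp i)"
    using hexp_comps[OF i] assms(1)
    by (intro mono_eval_cong) (auto simp: comps_def y_def gr0_conv_Suc subset_iff)
  also have "\<dots> = x 0 ^ k * mono_eval y (hexp i)"
    using hexp_comps[OF i] by (simp add: mono_eval_scale comps_def)
  also have "mono_eval y (hexp i) = laurent_monom \<theta> (col A i)"
    unfolding mono_eval_comps[OF hexp_comps[OF i]] lm r_def prod.lessThan_Suc_shift by (simp add: y_def)
  finally show "toric_param A (ones_vec n) (x 0 ^ k) \<theta> $ i = ver x $ i"
    using i by (simp add: toric_param_def ones_vec_def)
qed (simp add: toric_param_def ver_def)

lemma complex_root_exists: obtains z :: complex where "z ^ k = w"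
proof (cases "w = 0")
  case False
  have "exp (Ln w / of_nat k) ^ k = exp (of_nat k * (Ln w / of_nat k))" by (rule exp_of_nat_mult[symmetric])
  also have "\<dots> = w" using False k_pos by simp
  finally show thesis by (rule that)
qed (use k_pos that[of 0] in auto)

lemma torus_points_eq: "torus_points = ver ` {x. \<forall>j<r. x j \<noteq> 0}"
proof
  show "torus_points \<subseteq> ver ` {x. \<forall>j<r. x j \<noteq> 0}"
  proof
    fix p assume "p \<in> torus_points"
    then obtain s \<theta> where p: "p = toric_param A (ones_vec n) s \<theta>" "s \<noteq> 0" "\<theta> \<in> torus m"
      unfolding torus_points_def dim_row_A by auto
    obtain z where z: "z ^ k = s" by (rule complex_root_exists)
    then have "z \<noteq> 0" using p(2) k_pos by auto
    define x where "x j = (if j = 0 then z else z * \<theta> $ (j - 1))" for j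
    have "p = ver x"
      using toric_param_eq_ver[of x \<theta>] p z \<open>z \<noteq> 0\<close> by (simp add: x_def)
    moreover have "\<forall>j<r. x j \<noteq> 0" using p(3) \<open>z \<noteq> 0\<close> by (auto simp: x_def torus_def gr0_conv_Suc)
    ultimately show "p \<in> ver ` {x. \<forall>j<r. x j \<noteq> 0}" by blast
  qed
  show "ver ` {x. \<forall>j<r. x j \<noteq> 0} \<subseteq> torus_points"
  proof
    fix p assume "p \<in> ver ` {x. \<forall>j<r. x j \<noteq> 0}"
    then obtain x where x: "\<forall>j<r. x j \<noteq> 0" "p = ver x" by blast
    define \<theta> where "\<theta> = vec m (\<lambda>l. x (Suc l) / x 0)"
    have \<theta>: "\<theta> \<in> torus m" using x(1) by (auto simp: \<theta>_def torus_def)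
    then have "toric_param A (ones_vec n) (x 0 ^ k) \<theta> = ver x"
      using x(1) by (intro toric_param_eq_ver) (auto simp: \<theta>_def)
    then show "p \<in> torus_points"
      unfolding torus_points_def dim_row_A using x \<theta> by (intro CollectI exI[of _ "x 0 ^ k"] exI[of _ \<theta>]) auto
  qed
qed

definition cone :: "complex vec set" where
  "cone = zariski_closure n torus_points"

lemma peval_ver: "F \<in> poly_ring n \<Longrightarrow> evalv F (ver x) = peval (psubst Cst (\<lambda>i. mono_eval Var (hexp i)) F) x"
proof -
  assume F: "F \<in> poly_ring n"
  have "peval (mono_eval Var c) x = mono_eval x c" for c
    unfolding mono_eval_def by (simp add: peval.hom_prod peval.hom_power)
  then show ?thesis unfolding peval_psubst using F by (intro peval_cong) (auto dest: poly_ring_pvars)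
qed

text \<open>The pullback \<open>G\<close> of an \<open>F\<close> vanishing on the torus is
  \<open>0\<close> wherever all coordinates are non-zero. Hence \<open>G\<close> times the product
  of the variables vanishes everywhere, and \<open>G = 0\<close> because polynomials form a domain;
  so points with zero coordinates are covered too.\<close>

lemma ver_in_cone: "ver x \<in> cone"
  unfolding cone_def zariski_closure_def
proof (intro CollectI conjI ballI)
  fix F assume F: "F \<in> vanishing_ideal n torus_points"
  then have Fr: "F \<in> poly_ring n" by (simp add: vanishing_ideal_def)
  define G where "G = psubst Cst (\<lambda>i. mono_eval Var (hexp i)) F"
  have G: "G \<in> poly_ring r"
    unfolding G_def using Fr
  proof (rule psubst_Cst_poly_ring)
    fix i assume "i < n"
    then show "mono_eval Var (hexp i) \<in> poly_ring r"
      using hexp_comps[of i] by (auto simp: mono_eval_def comps_def intro!: poly_ring_prod poly_ring_power poly_ring_Var)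
  qed
  have "G * (\<Prod>j<r. Var j) = 0"
  proof (rule poly_ring_eqI[of _ r])
    show "G * (\<Prod>j<r. Var j) \<in> poly_ring r"
      using G by (intro poly_ring_mult poly_ring_prod poly_ring_Var) auto
    fix y
    show "peval (G * (\<Prod>j<r. Var j)) y = peval 0 y"
    proof (cases "\<forall>j<r. y j \<noteq> 0")
      case True
      then have "ver y \<in> torus_points" unfolding torus_points_eq by blast
      then have "evalv F (ver y) = 0" using F by (simp add: vanishing_ideal_def)
      then show ?thesis using peval_ver[OF Fr] by (simp add: G_def peval.hom_mult)
    next
      case False
      then show ?thesis by (auto simp: peval.hom_mult peval.hom_prod)
    qed
  qed simp
  moreover have "Var j \<noteq> (0 :: nat cpoly)" for j
    by (metis lookup_single_eq lookup_zero zero_neq_one)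
  then have "(\<Prod>j<r. Var j :: nat cpoly) \<noteq> 0" by simp
  ultimately have "G = 0" by simp
  then show "evalv F (ver x) = 0" using peval_ver[OF Fr] by (simp add: G_def)
qed simp

lemma cone_vanishing:
  assumes "p \<in> cone" "F \<in> poly_ring n" "\<And>x. evalv F (ver x) = 0"
  shows "evalv F p = 0"
  using assms unfolding cone_def zariski_closure_def vanishing_ideal_def torus_points_eq by blast

text \<open>With \<open>pivot i j = (k - 1) e\<^sub>i + e\<^sub>j\<close>, the relation \<open>y\<^sub>a y\<^bsub>k e\<^sub>i\<^esub>\<^bsup>k - 1\<^esup> = \<Prod>\<^sub>j y\<^bsub>pivot i j\<^esub>\<^bsup>a\<^sub>j\<^esup>\<close> recovers all
  coordinates of a point of the cone with \<open>y\<^bsub>k e\<^sub>i\<^esub> \<noteq> 0\<close> from the pivotal ones.\<close>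

definition pivot :: "nat \<Rightarrow> nat \<Rightarrow> (nat \<Rightarrow>\<^sub>0 nat)" where
  "pivot i j = single i (k - 1) + single j 1"

lemma pivot_comps: "i < r \<Longrightarrow> j < r \<Longrightarrow> pivot i j \<in> comps {..<r} k"
  using Poly_Mapping.keys_add[of "single i (k - 1)" "single j 1"] k_pos
  by (auto simp: pivot_def comps_def mdeg_add split: if_splits)

lemma pivot_diag: "pivot i i = single i k"
  using k_pos by (simp add: pivot_def flip: single_add)

lemma mono_eval_pivot: "mono_eval x (pivot i j) = x i ^ (k - 1) * x j"
  by (simp add: pivot_def mono_eval_add)

definition pivot_rel :: "nat \<Rightarrow> (nat \<Rightarrow>\<^sub>0 nat) \<Rightarrow> nat cpoly" where
  "pivot_rel i a = Var (idx a) * Var (idx (pivot i i)) ^ (k - 1) - mono_eval (\<lambda>j. Var (idx (pivot i j))) a"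

lemma peval_pivot_rel:
  "peval (pivot_rel i a) y = y (idx a) * y (idx (pivot i i)) ^ (k - 1) - mono_eval (\<lambda>j. y (idx (pivot i j))) a"
  by (simp add: pivot_rel_def peval.hom_minus peval.hom_mult peval.hom_power mono_eval_def peval.hom_prod)

lemma pivot_rel_ring: "i < r \<Longrightarrow> a \<in> comps {..<r} k \<Longrightarrow> pivot_rel i a \<in> poly_ring n"
  unfolding pivot_rel_def mono_eval_def
  by (intro poly_ring_diff poly_ring_mult poly_ring_power poly_ring_prod poly_ring_Var)
    (auto simp: idx pivot_comps dest: keys_comps)

lemma comps_prod_scale:
  "a \<in> comps {..<r} k \<Longrightarrow> mono_eval (\<lambda>j. t * x j) a = t ^ k * mono_eval x a"
  by (simp add: mono_eval_scale comps_def)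

lemma pivot_rel_ver:
  assumes "i < r" "a \<in> comps {..<r} k"
  shows "evalv (pivot_rel i a) (ver x) = 0"
proof -
  have "mono_eval (\<lambda>j. ver x $ idx (pivot i j)) a = mono_eval (\<lambda>j. x i ^ (k - 1) * x j) a"
    using assms by (intro mono_eval_cong) (auto simp: ver_idx pivot_comps mono_eval_pivot dest: keys_comps)
  also have "\<dots> = (x i ^ (k - 1)) ^ k * mono_eval x a"
    using assms by (simp add: comps_prod_scale)
  finally show ?thesis
    using assms by (simp add: peval_pivot_rel ver_idx pivot_comps pivot_diag[of i, symmetric])
      (simp add: pivot_diag power_mult[symmetric] mult.commute)
qed

lemma ver_of_pivot_rel:
  assumes i: "i < r" and p: "p \<in> carrier_vec n" and nz: "p $ idx (pivot i i) \<noteq> 0"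
    and rel: "\<And>a. a \<in> comps {..<r} k \<Longrightarrow> evalv (pivot_rel i a) p = 0"
  obtains x where "p = ver x"
proof -
  let ?P = "p $ idx (pivot i i)"
  obtain z where z: "z ^ k = ?P" by (rule complex_root_exists)
  have z0: "z \<noteq> 0" using z nz k_pos by (auto simp: power_0_left)
  \<comment> \<open>\<open>z\<close> plays the part of \<open>x i\<close>: on the image of
    \<open>ver\<close> the coordinate at \<open>pivot i j\<close> is
    \<open>x i ^ (k - 1) * x j\<close>.\<close>
  define x where "x j = p $ idx (pivot i j) / z ^ (k - 1)" for j
  have "p = ver x"
  proof (rule eq_vecI)
    fix l assume "l < dim_vec (ver x)"
    then have l: "l < n" by (simp add: ver_def)
    let ?a = "hexp l"
    have "p $ l * ?P ^ (k - 1) = mono_eval (\<lambda>j. p $ idx (pivot i j)) ?a"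
      using rel[OF hexp_comps[OF l]] by (simp add: peval_pivot_rel idx_hexp[OF l])
    also have "\<dots> = mono_eval (\<lambda>j. z ^ (k - 1) * x j) ?a"
      using z0 by (intro mono_eval_cong) (simp add: x_def)
    also have "\<dots> = (z ^ (k - 1)) ^ k * mono_eval x ?a"
      by (rule comps_prod_scale[OF hexp_comps[OF l]])
    also have "(z ^ (k - 1)) ^ k = ?P ^ (k - 1)"
      unfolding z[symmetric] by (simp add: power_mult[symmetric] mult.commute)
    finally show "p $ l = ver x $ l" using nz l by simp
  qed (use p in \<open>simp add: ver_def\<close>)
  then show thesis by (rule that)
qed

text \<open>If the coordinate at some pure power \<open>k e\<^sub>i\<close> is non-zero, the
  relations \<open>pivot_rel\<close> reconstruct a preimage. If all of these vanish, the equations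
  expressing the \<open>k\<close>-th power of a coordinate as a monomial in the pure power
  coordinates force the point to be \<open>0\<close>.\<close>

lemma cone_eq: "cone = range ver"
proof
  show "range ver \<subseteq> cone" using ver_in_cone by auto
  show "cone \<subseteq> range ver"
  proof
    fix p assume p: "p \<in> cone"
    then have pc: "p \<in> carrier_vec n" by (simp add: cone_def zariski_closure_def)
    show "p \<in> range ver"
    proof (cases "\<exists>i<r. p $ idx (pivot i i) \<noteq> 0")
      case True
      then obtain i where i: "i < r" "p $ idx (pivot i i) \<noteq> 0" by blast
      have "evalv (pivot_rel i a) p = 0" if "a \<in> comps {..<r} k" for a
        using i that by (intro cone_vanishing[OF p] pivot_rel_ring pivot_rel_ver)
      then show ?thesis using ver_of_pivot_rel[OF i(1) pc i(2)] by blast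
    next
      case False
      have "p $ l = 0" if l: "l < n" for l
      proof -
        let ?F = "Var l ^ k - mono_eval (\<lambda>j. Var (idx (pivot j j))) (hexp l)"
        have eval: "evalv ?F q = (q $ l) ^ k - mono_eval (\<lambda>j. q $ idx (pivot j j)) (hexp l)" for q
          by (simp add: peval.hom_minus peval.hom_power mono_eval_def peval.hom_prod)
        have "evalv ?F p = 0"
        proof (rule cone_vanishing[OF p])
          show "?F \<in> poly_ring n"
            unfolding mono_eval_def using l hexp_comps[OF l]
            by (intro poly_ring_diff poly_ring_power poly_ring_prod poly_ring_Var)
              (auto simp: idx pivot_comps dest: keys_comps)
          fix x
          have "mono_eval (\<lambda>j. ver x $ idx (pivot j j)) (hexp l) = mono_eval (\<lambda>j. x j ^ k) (hexp l)"
            using keys_comps[OF hexp_comps[OF l]]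
            by (intro mono_eval_cong) (simp add: ver_idx pivot_comps, simp add: pivot_diag)
          also have "\<dots> = mono_eval x (hexp l) ^ k"
            by (simp add: mono_eval_def prod_power_distrib power_mult[symmetric] mult.commute)
          finally show "evalv ?F (ver x) = 0" unfolding eval using l by simp
        qed
        moreover have "mono_eval (\<lambda>j. p $ idx (pivot j j)) (hexp l) = 0"
        proof -
          have "hexp l \<noteq> 0" using hexp_comps[OF l] k_pos by (auto simp: comps_def)
          then obtain j where "j \<in> keys (hexp l)" by fastforce
          then show ?thesis using False keys_comps[OF hexp_comps[OF l]]
            by (intro mono_eval_eq_0[of j]) auto
        qed
        ultimately show "p $ l = 0" unfolding eval using k_pos by simp
      qed
      then have "p = ver (\<lambda>_. 0)"
        using pc ver_0_eq[of "\<lambda>_. 0"] by (intro eq_vecI) auto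
      then show ?thesis by blast
    qed
  qed
qed

lemma toric_variety_eq: "toric_variety A (ones_vec n) = projectivization n cone"
  by (simp add: toric_variety_def cone_def torus_points_def)

lemma cone_carrier: "p \<in> cone \<Longrightarrow> p \<in> carrier_vec n"
  by (auto simp: cone_eq)

lemma cone_smult: "p \<in> cone \<Longrightarrow> t \<cdot>\<^sub>v p \<in> cone"
proof -
  assume "p \<in> cone"
  then obtain x where x: "p = ver x" by (auto simp: cone_eq)
  obtain z where "z ^ k = t" by (rule complex_root_exists)
  then have "t \<cdot>\<^sub>v p = ver (\<lambda>j. z * x j)" by (simp add: x ver_scale)
  then show ?thesis by (simp add: cone_eq)
qed

lemma affine_cone_eq: "affine_cone n (toric_variety A (ones_vec n)) = cone"
proof
  have zero: "0\<^sub>v n \<in> cone" using ver_0_eq[of "\<lambda>_. 0"] ver_in_cone[of "\<lambda>_. 0"] by simp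
  show "affine_cone n (toric_variety A (ones_vec n)) \<subseteq> cone"
    using zero cone_smult by (auto simp: affine_cone_def toric_variety_eq projectivization_def proj_point_def)
  show "cone \<subseteq> affine_cone n (toric_variety A (ones_vec n))"
  proof
    fix p assume p: "p \<in> cone"
    have "p \<in> proj_point p"
      unfolding proj_point_def by (intro CollectI exI[of _ 1]) auto
    then show "p \<in> affine_cone n (toric_variety A (ones_vec n))"
      using p by (auto simp: affine_cone_def toric_variety_eq projectivization_def)
  qed
qed

subsection \<open>The principal A-determinant\<close>

text \<open>A zero of the given linear forms on the variety would be a common zero of all Euler
  forms, hence \<open>0\<close>: the rows of \<open>A\<close> give the Euler forms with
  \<open>j > 0\<close>, and \<open>k\<close> times the row of ones minus all rows of
  \<open>A\<close> gives the one with \<open>j = 0\<close>.\<close>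

lemma not_in_Sigma_locus:
  assumes "is_A_resultant A R" shows "ones_vec n \<notin> Sigma_locus A R"
proof
  let ?c = "ones_vec n"
  define M where "M = mat_of_cols n (?c # map (\<lambda>j. euler_coeffs A j ?c) [0..<dim_row A])"
  have M: "M \<in> carrier_mat n (dim_row A + 1)" unfolding M_def by (rule carrier_matI) auto
  assume "?c \<in> Sigma_locus A R"
  then have "peval R (\<lambda>ij. M $$ ij) = 0" by (simp add: Sigma_locus_def principal_A_det_def M_def)
  then obtain P where P: "P \<in> toric_variety A ?c" "\<forall>p\<in>P. \<forall>j<dim_row A + 1. scalar_prod (col M j) p = 0"
    using assms M unfolding is_A_resultant_def by blast
  then obtain p where p: "p \<in> cone" "p \<noteq> 0\<^sub>v n" "P = proj_point p"
    unfolding toric_variety_eq projectivization_def by blast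
  have "p \<in> P" unfolding p(3) proj_point_def by (intro CollectI exI[of _ 1]) auto
  then have orth: "scalar_prod (col M j) p = 0" if "j < dim_row A + 1" for j using P(2) that by blast
  obtain x where x: "p = ver x" using p(1) by (auto simp: cone_eq)
  have sum0: "(\<Sum>i<n. ver x $ i) = 0"
  proof -
    have "col M 0 = ?c" by (simp add: M_def ones_vec_def)
    then have "scalar_prod ?c p = 0" using orth[of 0] by simp
    then show ?thesis by (simp add: x scalar_prod_def ones_vec_def lessThan_atLeast0 ver_def)
  qed
  have sumA: "(\<Sum>i<n. of_int (A $$ (l, i)) * ver x $ i) = 0" if l: "l < m" for l
  proof -
    have "col M (Suc l) = euler_coeffs A l ?c"
      unfolding M_def using l dim_row_A by (subst col_mat_of_cols) (auto simp: euler_coeffs_def nth_append)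
    then have "scalar_prod (euler_coeffs A l ?c) p = 0" using orth[of "Suc l"] l dim_row_A by simp
    then show ?thesis
      by (simp add: x scalar_prod_def ones_vec_def euler_coeffs_def lessThan_atLeast0 ver_def)
  qed
  have "peval (euler_form r k j) x = 0" if j: "j < r" for j
  proof (cases j)
    case (Suc l)
    have "of_nat (lookup (hexp i) j) = (of_int (A $$ (l, i)) :: complex)" if "i < n" for i
      using lookup_hexp_Suc[OF that, of l] j Suc by (metis r_simps(2) of_int_of_nat_eq)
    then have "peval (euler_form r k j) x = (\<Sum>i<n. of_int (A $$ (l, i)) * ver x $ i)"
      unfolding peval_euler_form by (intro sum.cong) auto
    then show ?thesis using sumA[of l] j Suc by simp
  next
    case 0
    have "of_nat (lookup (hexp i) j) = (of_nat k - (\<Sum>l<m. of_int (A $$ (l, i))) :: complex)" if "i < n" for i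
    proof -
      have "(of_int (int (lookup (hexp i) 0)) :: complex) = of_int (int k - (\<Sum>l<m. A $$ (l, i)))"
        using lookup_hexp_0[OF that] by simp
      then show ?thesis using 0 by simp
    qed
    then have "peval (euler_form r k j) x = (\<Sum>i<n. (of_nat k - (\<Sum>l<m. of_int (A $$ (l, i)))) * ver x $ i)"
      unfolding peval_euler_form by (intro sum.cong) auto
    also have "\<dots> = of_nat k * (\<Sum>i<n. ver x $ i) - (\<Sum>i<n. \<Sum>l<m. of_int (A $$ (l, i)) * ver x $ i)"
      by (simp add: left_diff_distrib sum_subtractf sum_distrib_left sum_distrib_right)
    also have "(\<Sum>i<n. \<Sum>l<m. of_int (A $$ (l, i)) * ver x $ i) = (\<Sum>l<m. \<Sum>i<n. of_int (A $$ (l, i)) * ver x $ i)"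
      by (rule sum.swap)
    also have "\<dots> = 0" using sumA by simp
    finally show ?thesis using sum0 by simp
  qed
  then have "x l = 0" if "l < r" for l
    using euler_forms_common_zero[OF k_pos _ that] by blast
  then have "ver x = 0\<^sub>v n" by (rule ver_0_eq)
  then show False using p(2) x by simp
qed

end

section \<open>Likelihood equations and the number of critical points\<close>

lemma generically_unique:
  assumes "generically n P" "generically n Q"
  shows "\<exists>u. P u \<and> Q u"
proof -
  obtain D E where D: "D \<in> poly_ring n" "D \<noteq> 0" "\<forall>u\<in>carrier_vec n. evalv D u \<noteq> 0 \<longrightarrow> P u"
    and E: "E \<in> poly_ring n" "E \<noteq> 0" "\<forall>u\<in>carrier_vec n. evalv E u \<noteq> 0 \<longrightarrow> Q u"
    using assms unfolding generically_def by blast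
  have DE: "D * E \<in> poly_ring n" "D * E \<noteq> 0" using D E by (auto intro: poly_ring_mult)
  obtain x where x: "peval (D * E) x \<noteq> 0" using poly_ring_nonzero_peval[OF DE] .
  have "evalv (D * E) (vec n x) = peval (D * E) x"
    using DE(1) by (intro peval_cong) (auto dest: poly_ring_pvars)
  then have "evalv D (vec n x) \<noteq> 0" "evalv E (vec n x) \<noteq> 0"
    using x by (auto simp: peval.hom_mult)
  then have "P (vec n x) \<and> Q (vec n x)" using D(3) E(3) by simp
  then show ?thesis by blast
qed

text \<open>Two generic conditions hold at a common point, so the number singled out by
  \<open>THE\<close> in \<open>mldeg\<close> is unique.\<close>

lemma mldeg_eqI:
  assumes "generically n (\<lambda>u. finite (critical_points n X u) \<and> card (critical_points n X u) = N)"
  shows "mldeg n X = N"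
  unfolding mldeg_def
proof (rule the_equality)
  show "generically n (\<lambda>u. finite (critical_points n X u) \<and> card (critical_points n X u) = N)" by (rule assms)
  fix N' assume "generically n (\<lambda>u. finite (critical_points n X u) \<and> card (critical_points n X u) = N')"
  from generically_unique[OF this assms] show "N' = N" by auto
qed

lemma powr_line_has_field_derivative:
  fixes a b s :: complex
  assumes "a \<noteq> 0"
  shows "((\<lambda>t. ((a + t * b) / a) powr s) has_field_derivative s * (b / a)) (at 0)"
proof -
  have f: "((\<lambda>t. (a + t * b) / a) has_field_derivative b / a) (at 0)"
    using assms by (auto intro!: derivative_eq_intros)
  have "((\<lambda>z::complex. z powr s) has_field_derivative s * 1 powr (s - 1)) (at 1)"
    by (rule has_field_derivative_powr) simp
  then have "((\<lambda>z::complex. z powr s) has_field_derivative s * 1 powr (s - 1)) (at ((a + 0 * b) / a))"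
    using assms by simp
  from DERIV_chain2[OF this f] show ?thesis by simp
qed

lemma coord_sum_eq: "p \<in> carrier_vec n \<Longrightarrow> coord_sum p = (\<Sum>i<n. p $ i)"
  by (simp add: coord_sum_def carrier_vecD)

text \<open>All factors of \<open>likelihood_at u p\<close> take the value \<open>1\<close> at
  \<open>p\<close>, so the product and quotient rules collapse to the logarithmic
  derivative.\<close>

lemma likelihood_at_derivative:
  assumes u: "u \<in> carrier_vec n" and p: "p \<in> carrier_vec n" and v: "v \<in> carrier_vec n"
    and nz: "\<And>i. i < n \<Longrightarrow> p $ i \<noteq> 0" "coord_sum p \<noteq> 0"
  shows "((\<lambda>t. likelihood_at u p (p + t \<cdot>\<^sub>v v)) has_field_derivative
     (\<Sum>i<n. u $ i * (v $ i / p $ i)) - coord_sum u * (coord_sum v / coord_sum p)) (at 0)"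
proof -
  let ?f = "\<lambda>i t. ((p $ i + t * v $ i) / p $ i) powr (u $ i)"
  let ?g = "\<lambda>t. ((coord_sum p + t * coord_sum v) / coord_sum p) powr coord_sum u"
  have sum: "coord_sum (p + t \<cdot>\<^sub>v v) = coord_sum p + t * coord_sum v" for t
    using p v by (simp add: coord_sum_eq[of _ n] sum.distrib sum_distrib_left)
  have eq: "(\<lambda>t. likelihood_at u p (p + t \<cdot>\<^sub>v v)) = (\<lambda>t. (\<Prod>i<n. ?f i t) / ?g t)"
    unfolding likelihood_at_def sum using u p v by (intro ext arg_cong2[where f="(/)"] prod.cong refl) auto
  have "((\<lambda>t. \<Prod>i<n. ?f i t) has_field_derivative
      (\<Sum>i<n. (u $ i * (v $ i / p $ i)) * (\<Prod>j\<in>{..<n} - {i}. ?f j 0))) (at 0)"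
    using nz(1) by (intro has_field_derivative_prod powr_line_has_field_derivative) auto
  also have "(\<Sum>i<n. (u $ i * (v $ i / p $ i)) * (\<Prod>j\<in>{..<n} - {i}. ?f j 0)) = (\<Sum>i<n. u $ i * (v $ i / p $ i))"
  proof (intro sum.cong refl)
    fix i
    have "(\<Prod>j\<in>{..<n} - {i}. ?f j 0) = 1" using nz(1) by (intro prod.neutral) auto
    then show "(u $ i * (v $ i / p $ i)) * (\<Prod>j\<in>{..<n} - {i}. ?f j 0) = u $ i * (v $ i / p $ i)" by simp
  qed
  finally have num: "((\<lambda>t. \<Prod>i<n. ?f i t) has_field_derivative (\<Sum>i<n. u $ i * (v $ i / p $ i))) (at 0)" .
  have den: "(?g has_field_derivative coord_sum u * (coord_sum v / coord_sum p)) (at 0)"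
    by (rule powr_line_has_field_derivative[OF nz(2)])
  have one: "(\<Prod>i<n. ?f i 0) = 1" "?g 0 = 1" using nz by (auto intro!: prod.neutral)
  have "((\<lambda>t. (\<Prod>i<n. ?f i t) / ?g t) has_field_derivative
      ((\<Sum>i<n. u $ i * (v $ i / p $ i)) * ?g 0 - (\<Prod>i<n. ?f i 0) * (coord_sum u * (coord_sum v / coord_sum p)))
        / (?g 0 * ?g 0)) (at 0)"
    using one(2) by (intro DERIV_divide num den) simp
  then show ?thesis unfolding eq one by simp
qed

context veronese
begin

subsection \<open>Smoothness and tangent spaces\<close>

lemma ver_nonzero: "(\<And>j. j < r \<Longrightarrow> x j \<noteq> 0) \<Longrightarrow> i < n \<Longrightarrow> ver x $ i \<noteq> 0"
  using keys_comps[OF hexp_comps[of i]] by (auto simp: mono_eval_def)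

text \<open>Where the coordinate \<open>y\<close> at \<open>pivot 0 0\<close> is non-zero, the cone
  is cut out by the relations \<open>pivot_rel 0 a\<close> for the non-pivotal coordinates. Each
  such coordinate occurs in exactly one of them, linearly with coefficient
  \<open>y ^ (k - 1)\<close>, so the Jacobian contains a multiple of the identity.\<close>

lemma smooth_at_ver:
  assumes x: "x 0 \<noteq> 0" shows "smooth_at n cone (ver x)"
proof -
  let ?b = "idx (pivot 0 0)"
  define ps where "ps = (\<lambda>j. idx (pivot 0 j)) ` {..<r}"
  define rest where "rest = filter (\<lambda>i. i \<notin> ps) [0..<n]"
  define Fs where "Fs = map (\<lambda>i. pivot_rel 0 (hexp i)) rest"
  have rest_n: "i < n" "i \<notin> ps" if "i \<in> set rest" for i using that by (auto simp: rest_def)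
  have b: "?b < n" using idx pivot_comps[of 0 0] by simp
  have Fs: "set Fs \<subseteq> poly_ring n"
    using rest_n by (auto simp: Fs_def intro!: pivot_rel_ring hexp_comps)
  have pb: "ver x $ ?b \<noteq> 0"
    using x by (simp add: ver_idx pivot_comps mono_eval_pivot)
  have eqs: "q \<in> cone \<longleftrightarrow> (\<forall>F\<in>set Fs. evalv F q = 0)" if q: "q \<in> carrier_vec n" "q $ ?b \<noteq> 0" for q
  proof
    assume "q \<in> cone"
    then show "\<forall>F\<in>set Fs. evalv F q = 0"
      using rest_n by (auto simp: Fs_def intro!: cone_vanishing pivot_rel_ring pivot_rel_ver hexp_comps)
  next
    assume zero: "\<forall>F\<in>set Fs. evalv F q = 0"
    have "evalv (pivot_rel 0 a) q = 0" if a: "a \<in> comps {..<r} k" for a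
    proof (cases "idx a \<in> ps")
      case True
      then obtain j where j: "j < r" "idx a = idx (pivot 0 j)" by (auto simp: ps_def)
      then have "a = pivot 0 j" using idx[OF a] idx[OF pivot_comps[of 0 j]] by (metis r_simps(1))
      \<comment> \<open>For pivotal \<open>a\<close> both terms of the relation are the same
        product, so it imposes nothing and is left out of \<open>Fs\<close>.\<close>
      then show ?thesis by (simp add: peval_pivot_rel mono_eval_pivot)
    next
      case False
      then have "idx a \<in> set rest" using idx[OF a] by (simp add: rest_def)
      then have "pivot_rel 0 (hexp (idx a)) \<in> set Fs" by (auto simp: Fs_def)
      then show ?thesis using zero idx[OF a] by auto
    qed
    then obtain y where "q = ver y" using ver_of_pivot_rel[OF _ q] by (metis r_simps(1))
    then show "q \<in> cone" by (simp add: ver_in_cone)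
  qed
  have rank: "vec_space.rank (length Fs) (jacobian n Fs (ver x)) = length Fs"
  proof (rule rank_eq_dim_row[of _ _ n "(ver x $ ?b) ^ (k - 1)"])
    show "jacobian n Fs (ver x) \<in> carrier_mat (length Fs) n"
      unfolding jacobian_def by (intro carrier_matI) auto
    show "(ver x $ ?b) ^ (k - 1) \<noteq> 0" using pb by simp
    fix l assume l: "l < length Fs"
    then have l': "l < length rest" by (simp add: Fs_def)
    define c where "c = rest ! l"
    have c: "c < n" "c \<notin> ps" using rest_n[of c] l' by (auto simp: c_def)
    have "col (jacobian n Fs (ver x)) c = (ver x $ ?b) ^ (k - 1) \<cdot>\<^sub>v unit_vec (length Fs) l"
    proof (rule eq_vecI)
      fix l2 assume "l2 < dim_vec ((ver x $ ?b) ^ (k - 1) \<cdot>\<^sub>v unit_vec (length Fs) l)"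
      then have l2: "l2 < length Fs" "l2 < length rest" by (auto simp: Fs_def)
      define i where "i = rest ! l2"
      have i: "i < n" using rest_n[of i] l2 by (auto simp: i_def)
      have cb: "c \<noteq> idx (pivot 0 j)" if "j < r" for j using c(2) that by (auto simp: ps_def)
      let ?q = "\<lambda>t. ver x + t \<cdot>\<^sub>v unit_vec n c"
      have piv: "?q t $ idx (pivot 0 j) = ver x $ idx (pivot 0 j)" if "j < r" for t j
        using idx[OF pivot_comps[of 0 j]] that cb[OF that] c(1) by (auto simp: unit_vec_def)
      have "evalv (pivot_rel 0 (hexp i)) (?q t) = (ver x $ i + t * (if i = c then 1 else 0)) * (ver x $ ?b) ^ (k - 1) -
          mono_eval (\<lambda>j. ver x $ idx (pivot 0 j)) (hexp i)" for t
      proof -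
        have "mono_eval (\<lambda>j. ?q t $ idx (pivot 0 j)) (hexp i) = mono_eval (\<lambda>j. ver x $ idx (pivot 0 j)) (hexp i)"
          using keys_comps[OF hexp_comps[OF i]] piv by (intro mono_eval_cong) auto
        then show ?thesis
          using i c(1) piv[of 0 t] by (simp add: peval_pivot_rel idx_hexp[OF i] unit_vec_def)
      qed
      moreover have "((\<lambda>t. (ver x $ i + t * (if i = c then 1 else 0)) * (ver x $ ?b) ^ (k - 1) -
          mono_eval (\<lambda>j. ver x $ idx (pivot 0 j)) (hexp i)) has_field_derivative
          (if i = c then 1 else 0) * (ver x $ ?b) ^ (k - 1)) (at 0)"
        by (auto intro!: derivative_eq_intros)
      ultimately have "gradient n (pivot_rel 0 (hexp i)) (ver x) $ c = (if i = c then 1 else 0) * (ver x $ ?b) ^ (k - 1)"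
        using c(1) by (simp add: gradient_def DERIV_imp_deriv)
      moreover have "col (jacobian n Fs (ver x)) c $ l2 = gradient n (pivot_rel 0 (hexp i)) (ver x) $ c"
        using l2 c(1) by (simp add: jacobian_def Fs_def i_def gradient_def mat_of_rows_def)
      moreover have "i = c \<longleftrightarrow> l2 = l"
        using l' l2(2) nth_eq_iff_index_eq[of "rest" l2 l] by (simp add: i_def c_def rest_def)
      ultimately show "col (jacobian n Fs (ver x)) c $ l2 =
          ((ver x $ ?b) ^ (k - 1) \<cdot>\<^sub>v unit_vec (length Fs) l) $ l2"
        using l l2(1) by (simp add: unit_vec_def)
    qed (simp add: jacobian_def)
    then show "\<exists>c<n. col (jacobian n Fs (ver x)) c = (ver x $ ?b) ^ (k - 1) \<cdot>\<^sub>v unit_vec (length Fs) l"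
      using c(1) by blast
  qed
  show ?thesis
    unfolding smooth_at_def using Fs eqs rank pb b ver_in_cone
    by (intro conjI exI[of _ "Var ?b"] exI[of _ Fs]) (auto intro: poly_ring_Var)
qed

lemma vanishing_ideal_cone: "F \<in> vanishing_ideal n cone \<longleftrightarrow> F \<in> poly_ring n \<and> (\<forall>x. evalv F (ver x) = 0)"
  by (auto simp: vanishing_ideal_def cone_eq)

lemma sum_hexp: "i < n \<Longrightarrow> (\<Sum>j<r. of_nat (lookup (hexp i) j)) = (of_nat k :: complex)"
  using mdeg_superset[of "{..<r}" "hexp i"] hexp_comps[of i] unfolding of_nat_sum[symmetric]
  by (simp add: comps_def)

text \<open>The right side is the image of the differential of \<open>ver\<close> at
  \<open>x\<close> in logarithmic coordinates \<open>\<tau>\<close>. One inclusion moves along the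
  curve \<open>x\<^sub>j (1 + t \<tau>\<^sub>j)\<close>; the other uses only the equations
  \<open>pivot_rel 0 a\<close>, which become linear in the logarithmic derivatives
  \<open>\<omega>\<close>.\<close>

lemma tangent_space_ver:
  assumes x: "\<And>j. j < r \<Longrightarrow> x j \<noteq> 0" and v: "v \<in> carrier_vec n"
  shows "v \<in> tangent_space n cone (ver x) \<longleftrightarrow>
     (\<exists>\<tau>. \<forall>i<n. v $ i = ver x $ i * (\<Sum>j<r. of_nat (lookup (hexp i) j) * \<tau> j))"
proof
  assume "\<exists>\<tau>. \<forall>i<n. v $ i = ver x $ i * (\<Sum>j<r. of_nat (lookup (hexp i) j) * \<tau> j)"
  then obtain \<tau> where \<tau>: "\<And>i. i < n \<Longrightarrow> v $ i = ver x $ i * (\<Sum>j<r. of_nat (lookup (hexp i) j) * \<tau> j)"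
    by blast
  have "scalar_prod (gradient n F (ver x)) v = 0" if F: "F \<in> vanishing_ideal n cone" for F
  proof -
    have Fr: "F \<in> poly_ring n" and zero: "evalv F (ver y) = 0" for y
      using F by (auto simp: vanishing_ideal_cone)
    define \<gamma> where "\<gamma> j t = x j * (1 + t * \<tau> j)" for j t
    have \<gamma>0: "(\<lambda>j. \<gamma> j 0) = x" by (simp add: \<gamma>_def)
    have "((\<lambda>t. mono_eval (\<lambda>j. \<gamma> j t) (hexp i)) has_field_derivative
        mono_eval (\<lambda>j. \<gamma> j 0) (hexp i) * (\<Sum>j<r. of_nat (lookup (hexp i) j) * \<tau> j)) (at 0)" if i: "i < n" for i
      using hexp_comps[OF i] by (intro mono_eval_log_derivative)
        (auto simp: comps_def \<gamma>_def intro!: derivative_eq_intros)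
    then have der: "((\<lambda>t. mono_eval (\<lambda>j. \<gamma> j t) (hexp i)) has_field_derivative v $ i) (at 0)" if "i < n" for i
      using that \<tau>[OF that] \<gamma>0 by simp
    have "((\<lambda>t. peval F (\<lambda>i. mono_eval (\<lambda>j. \<gamma> j t) (hexp i))) has_field_derivative
        (\<Sum>i<n. peval (pdiff i F) (\<lambda>i. mono_eval (\<lambda>j. \<gamma> j 0) (hexp i)) * v $ i)) (at 0)"
      using Fr der by (intro peval_has_field_derivative) (auto simp: poly_ring_def)
    moreover have "(\<lambda>t. peval F (\<lambda>i. mono_eval (\<lambda>j. \<gamma> j t) (hexp i))) = (\<lambda>t. 0)"
    proof
      fix t
      have "peval F (\<lambda>i. mono_eval (\<lambda>j. \<gamma> j t) (hexp i)) = evalv F (ver (\<lambda>j. \<gamma> j t))"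
        using Fr by (intro peval_cong) (auto dest: poly_ring_pvars)
      then show "peval F (\<lambda>i. mono_eval (\<lambda>j. \<gamma> j t) (hexp i)) = 0" using zero by simp
    qed
    ultimately have "((\<lambda>t. 0) has_field_derivative
        (\<Sum>i<n. peval (pdiff i F) (\<lambda>i. mono_eval (\<lambda>j. \<gamma> j 0) (hexp i)) * v $ i)) (at (0 :: complex))"
      by simp
    then have "(\<Sum>i<n. peval (pdiff i F) (\<lambda>i. mono_eval (\<lambda>j. \<gamma> j 0) (hexp i)) * v $ i) = 0"
      by (rule DERIV_unique[OF _ DERIV_const])
    moreover have "peval (pdiff i F) (\<lambda>i. mono_eval (\<lambda>j. \<gamma> j 0) (hexp i)) = peval (pdiff i F) (\<lambda>i. ver x $ i)" for i
      using pdiff_poly_ring[OF Fr, of i] by (intro peval_cong) (auto simp: \<gamma>0 dest: poly_ring_pvars)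
    ultimately show ?thesis unfolding gradient_scalar_prod(1)[OF Fr ver_carrier v] by simp
  qed
  then show "v \<in> tangent_space n cone (ver x)" using v by (simp add: tangent_space_def)
next
  assume t: "v \<in> tangent_space n cone (ver x)"
  define \<omega> where "\<omega> i = v $ i / ver x $ i" for i
  have nz: "ver x $ i \<noteq> 0" if "i < n" for i by (rule ver_nonzero[OF x that])
  have v_\<omega>: "v $ i = ver x $ i * \<omega> i" if "i < n" for i using nz[OF that] by (simp add: \<omega>_def)
  let ?c = "\<lambda>j. idx (pivot 0 j)"
  have c: "?c j < n" if "j < r" for j using idx[OF pivot_comps[of 0 j]] that by simp
  \<comment> \<open>The equations for \<open>\<omega>\<close> carry an extra term
    \<open>(k - 1) * \<omega> (?c 0)\<close>. As the exponents of a monomial add up to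
    \<open>k\<close>, the share \<open>(k - 1) / k\<close> of \<open>\<omega> (?c 0)\<close>
    subtracted from each \<open>\<tau> j\<close> absorbs it.\<close>
  define \<tau> where "\<tau> j = \<omega> (?c j) - of_nat (k - 1) / of_nat k * \<omega> (?c 0)" for j
  have "v $ i = ver x $ i * (\<Sum>j<r. of_nat (lookup (hexp i) j) * \<tau> j)" if i: "i < n" for i
  proof -
    let ?a = "\<lambda>j. of_nat (lookup (hexp i) j) :: complex"
    let ?F = "pivot_rel 0 (hexp i)"
    let ?y = "\<lambda>l t. ver x $ l + t * v $ l"
    have F: "?F \<in> poly_ring n" using pivot_rel_ring[OF _ hexp_comps[OF i]] by simp
    then have "?F \<in> vanishing_ideal n cone"
      using pivot_rel_ver[OF _ hexp_comps[OF i]] by (simp add: vanishing_ideal_cone)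
    then have "scalar_prod (gradient n ?F (ver x)) v = 0" using t by (simp add: tangent_space_def)
    then have "((\<lambda>t. evalv ?F (ver x + t \<cdot>\<^sub>v v)) has_field_derivative 0) (at 0)"
      using gradient_scalar_prod(2)[OF F ver_carrier[of x] v] by (simp only:)
    moreover have "evalv ?F (ver x + t \<cdot>\<^sub>v v) = ?y i t * ?y (?c 0) t ^ (k - 1) - mono_eval (\<lambda>j. ?y (?c j) t) (hexp i)" for t
    proof -
      have "mono_eval (\<lambda>j. (ver x + t \<cdot>\<^sub>v v) $ ?c j) (hexp i) = mono_eval (\<lambda>j. ?y (?c j) t) (hexp i)"
        using keys_comps[OF hexp_comps[OF i]] c v by (intro mono_eval_cong) (auto simp del: ver_index)
      then show ?thesis
        using i c[of 0] v by (simp add: peval_pivot_rel idx_hexp[OF i] del: ver_index)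
    qed
    ultimately have d0: "((\<lambda>t. ?y i t * ?y (?c 0) t ^ (k - 1) - mono_eval (\<lambda>j. ?y (?c j) t) (hexp i)) has_field_derivative 0) (at 0)"
      by simp
    let ?Z1 = "ver x $ i * (ver x $ ?c 0) ^ (k - 1)" and ?Z2 = "mono_eval (\<lambda>j. ver x $ ?c j) (hexp i)"
    have y': "(?y l has_field_derivative ?y l 0 * \<omega> l) (at 0)" if "l < n" for l
      using v_\<omega>[OF that] by (auto intro!: derivative_eq_intros)
    have d1: "((\<lambda>t. ?y i t * ?y (?c 0) t ^ (k - 1)) has_field_derivative ?Z1 * (\<omega> i + of_nat (k - 1) * \<omega> (?c 0))) (at 0)"
    proof -
      \<comment> \<open>The product of coordinates is presented as a monomial in two auxiliary
        variables so that the logarithmic product rule applies.\<close>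
      let ?m = "single (0::nat) (1::nat) + single 1 (k - 1)"
      let ?\<gamma> = "\<lambda>s t. if s = (0::nat) then ?y i t else ?y (?c 0) t"
      have "((\<lambda>t. mono_eval (\<lambda>s. ?\<gamma> s t) ?m) has_field_derivative mono_eval (\<lambda>s. ?\<gamma> s 0) ?m *
          (\<Sum>s\<in>{0,1}. of_nat (lookup ?m s) * (if s = 0 then \<omega> i else \<omega> (?c 0)))) (at 0)"
      proof (rule mono_eval_log_derivative)
        show "keys ?m \<subseteq> {0, 1}"
          using Poly_Mapping.keys_add[of "single (0::nat) (1::nat)" "single 1 (k - 1)"]
          by (auto split: if_splits)
        show "(?\<gamma> s has_field_derivative ?\<gamma> s 0 * (if s = 0 then \<omega> i else \<omega> (?c 0))) (at 0)" if "s \<in> {0, 1}" for s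
          using y'[OF i] y'[OF c[of 0]] by simp
      qed simp
      then show ?thesis by (simp add: mono_eval_add lookup_add lookup_single when_def del: ver_index)
    qed
    have d2: "((\<lambda>t. mono_eval (\<lambda>j. ?y (?c j) t) (hexp i)) has_field_derivative ?Z2 * (\<Sum>j<r. ?a j * \<omega> (?c j))) (at 0)"
    proof -
      have "((\<lambda>t. mono_eval (\<lambda>j. ?y (?c j) t) (hexp i)) has_field_derivative
          mono_eval (\<lambda>j. ?y (?c j) 0) (hexp i) * (\<Sum>j<r. ?a j * \<omega> (?c j))) (at 0)"
        using hexp_comps[OF i] c by (intro mono_eval_log_derivative y') (auto simp: comps_def)
      then show ?thesis by simp
    qed
    have Z: "?Z1 = ?Z2"
      using pivot_rel_ver[OF _ hexp_comps[OF i], of 0 x] by (simp add: peval_pivot_rel idx_hexp[OF i] del: ver_index)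
    have "?Z1 \<noteq> 0" using nz[OF i] nz[OF c[of 0]] by simp
    moreover have "?Z1 * (\<omega> i + of_nat (k - 1) * \<omega> (?c 0)) - ?Z2 * (\<Sum>j<r. ?a j * \<omega> (?c j)) = 0"
      using DERIV_unique[OF DERIV_diff[OF d1 d2] d0] .
    then have "?Z1 * (\<omega> i + of_nat (k - 1) * \<omega> (?c 0)) = ?Z1 * (\<Sum>j<r. ?a j * \<omega> (?c j))"
      unfolding Z by (simp only: right_minus_eq)
    ultimately have h1: "\<omega> i + of_nat (k - 1) * \<omega> (?c 0) = (\<Sum>j<r. ?a j * \<omega> (?c j))"
      by (simp only: mult_cancel_left) simp
    have h2: "(\<Sum>j<r. ?a j * \<tau> j) = (\<Sum>j<r. ?a j * \<omega> (?c j)) - (\<Sum>j<r. ?a j) * (of_nat (k - 1) / of_nat k * \<omega> (?c 0))"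
      unfolding \<tau>_def right_diff_distrib sum_subtractf sum_distrib_right ..
    have h3: "(\<Sum>j<r. ?a j) * (of_nat (k - 1) / of_nat k * \<omega> (?c 0)) = of_nat (k - 1) * \<omega> (?c 0)"
      using k_pos unfolding sum_hexp[OF i] by simp
    have "\<omega> i = (\<Sum>j<r. ?a j * \<tau> j)"
      unfolding h2 h3 h1[symmetric] by simp
    then show ?thesis using v_\<omega>[OF i] by simp
  qed
  then show "\<exists>\<tau>. \<forall>i<n. v $ i = ver x $ i * (\<Sum>j<r. of_nat (lookup (hexp i) j) * \<tau> j)" by blast
qed

subsection \<open>Critical points\<close>

text \<open>The sufficient statistics of the data: the homogenised exponent matrix applied to
  \<open>u\<close>. At \<open>u = ver x\<close> they are the values of the Euler forms.\<close>

definition \<beta> :: "complex vec \<Rightarrow> nat \<Rightarrow> complex" where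
  "\<beta> u j = (\<Sum>i<n. u $ i * of_nat (lookup (hexp i) j))"

lemma sum_\<beta>:
  assumes "u \<in> carrier_vec n" shows "(\<Sum>j<r. \<beta> u j) = of_nat k * coord_sum u"
proof -
  have "(\<Sum>j<r. \<beta> u j) = (\<Sum>i<n. u $ i * (\<Sum>j<r. of_nat (lookup (hexp i) j)))"
    unfolding \<beta>_def sum_distrib_left by (rule sum.swap)
  also have "\<dots> = (\<Sum>i<n. u $ i * of_nat k)" by (intro sum.cong) (auto simp: sum_hexp)
  finally show ?thesis by (simp add: coord_sum_eq[OF assms] sum_distrib_left mult.commute)
qed

lemma peval_euler_form_\<beta>: "peval (euler_form r k j) x = \<beta> (ver x) j"
  unfolding peval_euler_form \<beta>_def by (simp add: mult.commute)

text \<open>With \<open>U\<close> and \<open>S\<close> the coordinate sums of \<open>u\<close> and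
  \<open>p = ver x\<close>, the derivative in the direction \<open>\<tau>\<close> is
  \<open>\<Sum>\<^sub>j \<tau>\<^sub>j (\<beta> u j - U / S * \<beta> p j)\<close>. It vanishes for
  all \<open>\<tau>\<close> iff every bracket does.\<close>

lemma likelihood_critical_iff:
  assumes u: "u \<in> carrier_vec n" and x: "\<And>j. j < r \<Longrightarrow> x j \<noteq> 0" and S: "coord_sum (ver x) \<noteq> 0"
  shows "likelihood_critical n cone u (ver x) \<longleftrightarrow>
     (\<forall>j<r. \<beta> u j * coord_sum (ver x) = coord_sum u * \<beta> (ver x) j)"
proof -
  let ?p = "ver x" and ?U = "coord_sum u"
  let ?S = "coord_sum ?p"
  let ?h = "\<lambda>i j. of_nat (lookup (hexp i) j) :: complex"
  have nz: "?p $ i \<noteq> 0" if "i < n" for i by (rule ver_nonzero[OF x that])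
  have tsv: "w \<in> tangent_space n cone ?p \<longleftrightarrow> (\<exists>\<tau>. \<forall>i<n. w $ i = ?p $ i * (\<Sum>j<r. ?h i j * \<tau> j))"
    if "w \<in> carrier_vec n" for w
    by (rule tangent_space_ver[OF x that])
  have crit: "((\<lambda>t. likelihood_at u ?p (?p + t \<cdot>\<^sub>v v)) has_field_derivative 0) (at 0) \<longleftrightarrow>
      (\<Sum>j<r. \<tau> j * (\<beta> u j - ?U / ?S * \<beta> ?p j)) = 0"
    if v: "v \<in> carrier_vec n" "\<And>i. i < n \<Longrightarrow> v $ i = ?p $ i * (\<Sum>j<r. ?h i j * \<tau> j)" for v \<tau>
  proof -
    have 1: "(\<Sum>i<n. u $ i * (v $ i / ?p $ i)) = (\<Sum>j<r. \<tau> j * \<beta> u j)"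
    proof -
      have "(\<Sum>i<n. u $ i * (v $ i / ?p $ i)) = (\<Sum>i<n. u $ i * (\<Sum>j<r. ?h i j * \<tau> j))"
        using nz v(2) by (intro sum.cong) (auto simp del: ver_index)
      also have "\<dots> = (\<Sum>i<n. \<Sum>j<r. \<tau> j * (u $ i * ?h i j))"
        by (simp add: sum_distrib_left mult_ac)
      also have "\<dots> = (\<Sum>j<r. \<tau> j * \<beta> u j)"
        by (subst sum.swap) (simp add: \<beta>_def sum_distrib_left)
      finally show ?thesis .
    qed
    have 2: "coord_sum v = (\<Sum>j<r. \<tau> j * \<beta> ?p j)"
    proof -
      have "coord_sum v = (\<Sum>i<n. ?p $ i * (\<Sum>j<r. ?h i j * \<tau> j))"
        using v by (simp add: coord_sum_eq[of v n] del: ver_index)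
      also have "\<dots> = (\<Sum>i<n. \<Sum>j<r. \<tau> j * (?p $ i * ?h i j))"
        by (simp add: sum_distrib_left mult_ac del: ver_index)
      also have "\<dots> = (\<Sum>j<r. \<tau> j * \<beta> ?p j)"
        by (subst sum.swap) (simp add: \<beta>_def sum_distrib_left del: ver_index)
      finally show ?thesis .
    qed
    have "((\<lambda>t. likelihood_at u ?p (?p + t \<cdot>\<^sub>v v)) has_field_derivative
        (\<Sum>i<n. u $ i * (v $ i / ?p $ i)) - ?U * (coord_sum v / ?S)) (at 0)"
      by (rule likelihood_at_derivative[OF u ver_carrier v(1) nz S])
    also have "(\<Sum>i<n. u $ i * (v $ i / ?p $ i)) - ?U * (coord_sum v / ?S) = (\<Sum>j<r. \<tau> j * (\<beta> u j - ?U / ?S * \<beta> ?p j))"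
      unfolding 1 2 by (simp add: right_diff_distrib sum_subtractf sum_distrib_left sum_divide_distrib mult_ac)
    finally have d: "((\<lambda>t. likelihood_at u ?p (?p + t \<cdot>\<^sub>v v)) has_field_derivative
        (\<Sum>j<r. \<tau> j * (\<beta> u j - ?U / ?S * \<beta> ?p j))) (at 0)" .
    show ?thesis
    proof
      assume "((\<lambda>t. likelihood_at u ?p (?p + t \<cdot>\<^sub>v v)) has_field_derivative 0) (at 0)"
      then show "(\<Sum>j<r. \<tau> j * (\<beta> u j - ?U / ?S * \<beta> ?p j)) = 0" by (rule DERIV_unique[OF d])
    next
      assume "(\<Sum>j<r. \<tau> j * (\<beta> u j - ?U / ?S * \<beta> ?p j)) = 0"
      then show "((\<lambda>t. likelihood_at u ?p (?p + t \<cdot>\<^sub>v v)) has_field_derivative 0) (at 0)" using d by simp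
    qed
  qed
  have eq: "\<beta> u j - ?U / ?S * \<beta> ?p j = 0 \<longleftrightarrow> \<beta> u j * ?S = ?U * \<beta> ?p j" for j
    using S by (simp add: field_simps)
  show ?thesis
  proof
    assume L: "likelihood_critical n cone u ?p"
    show "\<forall>j<r. \<beta> u j * ?S = ?U * \<beta> ?p j"
    proof (intro allI impI)
      fix j assume j: "j < r"
      let ?\<tau> = "\<lambda>l. if l = j then 1 else 0 :: complex"
      define v where "v = vec n (\<lambda>i. ?p $ i * (\<Sum>l<r. ?h i l * ?\<tau> l))"
      have v: "v \<in> carrier_vec n" "\<And>i. i < n \<Longrightarrow> v $ i = ?p $ i * (\<Sum>l<r. ?h i l * ?\<tau> l)" by (auto simp: v_def)
      have "v \<in> tangent_space n cone ?p"
        unfolding tsv[OF v(1)] by (intro exI[of _ ?\<tau>] allI impI v(2))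
      then have "(\<Sum>l<r. ?\<tau> l * (\<beta> u l - ?U / ?S * \<beta> ?p l)) = 0"
        using L crit[of v ?\<tau>, OF v] unfolding likelihood_critical_def by blast
      also have "(\<Sum>l<r. ?\<tau> l * (\<beta> u l - ?U / ?S * \<beta> ?p l)) = (\<Sum>l<r. if l = j then \<beta> u l - ?U / ?S * \<beta> ?p l else 0)"
        by (intro sum.cong) auto
      also have "\<dots> = \<beta> u j - ?U / ?S * \<beta> ?p j" using j by simp
      finally show "\<beta> u j * ?S = ?U * \<beta> ?p j" using eq by blast
    qed
  next
    assume R: "\<forall>j<r. \<beta> u j * ?S = ?U * \<beta> ?p j"
    show "likelihood_critical n cone u ?p"
      unfolding likelihood_critical_def
    proof
      fix v assume v: "v \<in> tangent_space n cone ?p"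
      then have vc: "v \<in> carrier_vec n" by (simp add: tangent_space_def)
      then obtain \<tau> where "\<And>i. i < n \<Longrightarrow> v $ i = ?p $ i * (\<Sum>j<r. ?h i j * \<tau> j)"
        using v unfolding tsv[OF vc] by blast
      moreover have "(\<Sum>j<r. \<tau> j * (\<beta> u j - ?U / ?S * \<beta> ?p j)) = 0"
      proof (intro sum.neutral ballI)
        fix j assume "j \<in> {..<r}"
        then have "\<beta> u j - ?U / ?S * \<beta> ?p j = 0" unfolding eq using R by simp
        then show "\<tau> j * (\<beta> u j - ?U / ?S * \<beta> ?p j) = 0" by (simp only: mult_zero_right)
      qed
      ultimately show "((\<lambda>t. likelihood_at u ?p (?p + t \<cdot>\<^sub>v v)) has_field_derivative 0) (at 0)"
        using crit[OF vc] by blast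
    qed
  qed
qed

abbreviation X :: "complex vec set set" where
  "X \<equiv> toric_variety A (ones_vec n)"

lemma proj_point_self: "p \<in> proj_point p"
  unfolding proj_point_def by (intro CollectI exI[of _ 1]) auto

lemma proj_point_smult: "t \<noteq> 0 \<Longrightarrow> proj_point (t \<cdot>\<^sub>v p) = proj_point p"
proof
  assume t: "t \<noteq> 0"
  show "proj_point (t \<cdot>\<^sub>v p) \<subseteq> proj_point p"
  proof
    fix q assume "q \<in> proj_point (t \<cdot>\<^sub>v p)"
    then obtain s where s: "q = s \<cdot>\<^sub>v (t \<cdot>\<^sub>v p)" "s \<noteq> 0" by (auto simp: proj_point_def)
    then have "q = (s * t) \<cdot>\<^sub>v p" "s * t \<noteq> 0" using t by (simp_all add: smult_smult_assoc)
    then show "q \<in> proj_point p" unfolding proj_point_def by blast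
  qed
  show "proj_point p \<subseteq> proj_point (t \<cdot>\<^sub>v p)"
  proof
    fix q assume "q \<in> proj_point p"
    then obtain s where s: "q = s \<cdot>\<^sub>v p" "s \<noteq> 0" by (auto simp: proj_point_def)
    then have "q = (s / t) \<cdot>\<^sub>v (t \<cdot>\<^sub>v p)" using t by (simp add: smult_smult_assoc)
    then show "q \<in> proj_point (t \<cdot>\<^sub>v p)" using s t unfolding proj_point_def by (intro CollectI exI[of _ "s / t"]) auto
  qed
qed

lemma in_arrangement_iff:
  assumes p: "p \<in> carrier_vec n" "p \<noteq> 0\<^sub>v n"
  shows "proj_point p \<in> hyperplane_arrangement n \<longleftrightarrow> (\<exists>i<n. p $ i = 0) \<or> coord_sum p = 0"
proof
  assume "(\<exists>i<n. p $ i = 0) \<or> coord_sum p = 0"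
  then show "proj_point p \<in> hyperplane_arrangement n"
    unfolding hyperplane_arrangement_def projectivization_def using p by blast
next
  assume "proj_point p \<in> hyperplane_arrangement n"
  then obtain q where q: "q \<in> carrier_vec n" "(\<exists>i<n. q $ i = 0) \<or> coord_sum q = 0" "proj_point p = proj_point q"
    unfolding hyperplane_arrangement_def projectivization_def by blast
  have "p \<in> proj_point q" using proj_point_self[of p] q(3) by simp
  then obtain t where t: "p = t \<cdot>\<^sub>v q" by (auto simp: proj_point_def)
  have "coord_sum p = t * coord_sum q"
    using q(1) by (simp add: t coord_sum_eq[of _ n] sum_distrib_left)
  then show "(\<exists>i<n. p $ i = 0) \<or> coord_sum p = 0"
    using q(1,2) by (auto simp: t)
qed

lemma \<beta>_smult: "u \<in> carrier_vec n \<Longrightarrow> \<beta> (t \<cdot>\<^sub>v u) j = t * \<beta> u j"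
  by (simp add: \<beta>_def sum_distrib_left mult.assoc)

lemma coord_sum_smult: "u \<in> carrier_vec n \<Longrightarrow> coord_sum (t \<cdot>\<^sub>v u) = t * coord_sum u"
  by (simp add: coord_sum_eq[of _ n] sum_distrib_left)

lemma n_pos: "0 < n"
  using idx pivot_comps[of 0 0] by (metis gr_zeroI not_less_zero r_simps(1))

text \<open>The equations are homogeneous in the point, so one representative decides for all. Each
  representative is again of the form \<open>ver y\<close> with non-zero \<open>y j\<close>, by
  rescaling \<open>x\<close> with a \<open>k\<close>-th root, and so is a smooth point.\<close>

lemma critical_point_iff:
  assumes u: "u \<in> carrier_vec n" and x: "\<And>j. j < r \<Longrightarrow> x j \<noteq> 0" and S: "coord_sum (ver x) \<noteq> 0"
  shows "proj_point (ver x) \<in> critical_points n X u \<longleftrightarrow>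
     (\<forall>j<r. \<beta> u j * coord_sum (ver x) = coord_sum u * \<beta> (ver x) j)"
proof -
  let ?p = "ver x"
  have nz: "?p $ i \<noteq> 0" if "i < n" for i by (rule ver_nonzero[OF x that])
  have p0: "?p \<noteq> 0\<^sub>v n" using nz[OF n_pos] n_pos by (metis index_zero_vec(1))
  have inX: "proj_point ?p \<in> X"
    using p0 ver_in_cone by (auto simp: toric_variety_eq projectivization_def)
  have pt: "\<exists>y. q = ver y \<and> (\<forall>j<r. y j \<noteq> 0) \<and> (\<exists>t. t \<noteq> 0 \<and> q = t \<cdot>\<^sub>v ?p)" if q: "q \<in> proj_point ?p" for q
  proof -
    obtain t where t: "q = t \<cdot>\<^sub>v ?p" "t \<noteq> 0" using q by (auto simp: proj_point_def)
    obtain z where z: "z ^ k = t" by (rule complex_root_exists)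
    then have "z \<noteq> 0" using t(2) k_pos by (auto simp: power_0_left)
    then show ?thesis using t z x by (intro exI[of _ "\<lambda>j. z * x j"]) (auto simp: ver_scale)
  qed
  have smooth: "smooth_at n cone q" if "q \<in> proj_point ?p" for q
    using pt[OF that] smooth_at_ver by (metis r_simps(1))
  then have reg: "proj_point ?p \<in> reg_points n X"
    using inX by (simp add: reg_points_def affine_cone_eq)
  have arr: "proj_point ?p \<notin> hyperplane_arrangement n"
    using in_arrangement_iff[OF ver_carrier p0] nz S by auto
  have L: "likelihood_critical n cone u q \<longleftrightarrow>
      (\<forall>j<r. \<beta> u j * coord_sum ?p = coord_sum u * \<beta> ?p j)" if q: "q \<in> proj_point ?p" for q
  proof -
    obtain y t where y: "q = ver y" "\<forall>j<r. y j \<noteq> 0" "t \<noteq> 0" "q = t \<cdot>\<^sub>v ?p"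
      using pt[OF q] by blast
    have "coord_sum q = t * coord_sum ?p" by (simp only: y(4) coord_sum_smult[OF ver_carrier])
    then have "coord_sum q \<noteq> 0" using y(3) S by simp
    then have "likelihood_critical n cone u q \<longleftrightarrow> (\<forall>j<r. \<beta> u j * coord_sum q = coord_sum u * \<beta> q j)"
      using likelihood_critical_iff[of u y, OF u y(2)[rule_format]] y(1) by simp
    also have "\<dots> \<longleftrightarrow> (\<forall>j<r. \<beta> u j * coord_sum ?p = coord_sum u * \<beta> ?p j)"
      using y(3) by (simp add: y(4) coord_sum_smult \<beta>_smult mult.left_commute)
    finally show ?thesis .
  qed
  have "proj_point ?p \<in> critical_points n X u \<longleftrightarrow> (\<forall>q\<in>proj_point ?p. likelihood_critical n cone u q)"
    using reg arr by (simp add: critical_points_def affine_cone_eq)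
  also have "\<dots> \<longleftrightarrow> (\<forall>j<r. \<beta> u j * coord_sum ?p = coord_sum u * \<beta> ?p j)"
  proof
    assume "\<forall>q\<in>proj_point ?p. likelihood_critical n cone u q"
    then show "\<forall>j<r. \<beta> u j * coord_sum ?p = coord_sum u * \<beta> ?p j"
      using L[OF proj_point_self] proj_point_self by simp
  qed (use L in simp)
  finally show ?thesis .
qed

lemma euler_form_zero: "j < r \<Longrightarrow> x j = 0 \<Longrightarrow> peval (euler_form r k j) x = 0"
  unfolding euler_form_def
  by (auto simp: peval.hom_sum peval_single intro!: sum.neutral mono_eval_eq_0[of j] simp: in_keys_iff)

text \<open>The likelihood equations only make \<open>\<beta> p\<close> proportional to
  \<open>\<beta> u\<close>. Rescaling the representative to the coordinate sum of \<open>u\<close>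
  turns this into equality; conversely, equality fixes the coordinate sum through Euler's
  identity.\<close>

lemma critical_points_eq:
  assumes u: "u \<in> carrier_vec n" and \<beta>_nz: "\<And>j. j < r \<Longrightarrow> \<beta> u j \<noteq> 0" and U: "coord_sum u \<noteq> 0"
  shows "critical_points n X u = (\<lambda>x. proj_point (ver x)) ` fibre r (euler_form r k) (\<beta> u)"
proof
  have sum_ver: "of_nat k * coord_sum (ver x) = (\<Sum>j<r. peval (euler_form r k j) x)" for x
    by (simp add: sum_\<beta>[OF ver_carrier, symmetric] peval_euler_form_\<beta>)
  show "(\<lambda>x. proj_point (ver x)) ` fibre r (euler_form r k) (\<beta> u) \<subseteq> critical_points n X u"
  proof
    fix P assume "P \<in> (\<lambda>x. proj_point (ver x)) ` fibre r (euler_form r k) (\<beta> u)"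
    then obtain x where x: "x \<in> fibre r (euler_form r k) (\<beta> u)" "P = proj_point (ver x)" by blast
    then have G: "\<And>j. j < r \<Longrightarrow> peval (euler_form r k j) x = \<beta> u j" by (simp add: fibre_def)
    \<comment> \<open>The \<open>j\<close>-th Euler form is divisible by \<open>x\<^sub>j\<close>,
      so a non-zero value keeps the point off the coordinate hyperplanes.\<close>
    have xnz: "x j \<noteq> 0" if "j < r" for j using G[OF that] \<beta>_nz[OF that] euler_form_zero[OF that] by metis
    have "of_nat k * coord_sum (ver x) = of_nat k * coord_sum u"
      unfolding sum_ver using G sum_\<beta>[OF u] by simp
    then have S: "coord_sum (ver x) = coord_sum u" using k_pos by simp
    show "P \<in> critical_points n X u"
      unfolding x(2) using critical_point_iff[of u x, OF u xnz] S U G by (simp add: peval_euler_form_\<beta>)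
  qed
  show "critical_points n X u \<subseteq> (\<lambda>x. proj_point (ver x)) ` fibre r (euler_form r k) (\<beta> u)"
  proof
    fix P assume P: "P \<in> critical_points n X u"
    then have "P \<in> X" "P \<notin> hyperplane_arrangement n" by (auto simp: critical_points_def reg_points_def)
    then obtain p where p: "p \<in> cone" "p \<noteq> 0\<^sub>v n" "P = proj_point p"
      unfolding toric_variety_eq projectivization_def by blast
    obtain x where x: "p = ver x" using p(1) by (auto simp: cone_eq)
    have pnz: "\<And>i. i < n \<Longrightarrow> p $ i \<noteq> 0" and S: "coord_sum p \<noteq> 0"
      using in_arrangement_iff[OF cone_carrier[OF p(1)] p(2)] \<open>P \<notin> _\<close> p(3) by auto
    have xnz: "x j \<noteq> 0" if "j < r" for j
    proof
      assume "x j = 0"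
      then have "ver x $ idx (pivot j j) = 0" using that by (simp add: ver_idx pivot_comps mono_eval_pivot)
      moreover have "idx (pivot j j) < n" using idx[OF pivot_comps[of j j]] that by simp
      ultimately show False using pnz x by metis
    qed
    have crit: "\<forall>j<r. \<beta> u j * coord_sum (ver x) = coord_sum u * \<beta> (ver x) j"
      using critical_point_iff[of u x, OF u xnz] S P p(3) x by simp
    obtain z where z: "z ^ k = coord_sum u / coord_sum (ver x)" by (rule complex_root_exists)
    then have z0: "z \<noteq> 0" using U S x k_pos by (auto simp: power_0_left)
    define y where "y j = (if j < r then z * x j else 0)" for j
    have ver_y: "ver y = z ^ k \<cdot>\<^sub>v ver x"
    proof -
      have "ver y = ver (\<lambda>j. z * x j)"
        using keys_comps[OF hexp_comps] by (intro eq_vecI) (auto simp: ver_def y_def intro!: mono_eval_cong)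
      then show ?thesis by (simp add: ver_scale)
    qed
    have "peval (euler_form r k j) y = \<beta> u j" if "j < r" for j
      using crit that S x unfolding peval_euler_form_\<beta> ver_y
      by (simp add: \<beta>_smult z field_simps)
    then have "y \<in> fibre r (euler_form r k) (\<beta> u)" by (simp add: fibre_def y_def)
    moreover have "proj_point (ver y) = P"
      unfolding ver_y p(3) x using z0 by (intro proj_point_smult) simp
    ultimately show "P \<in> (\<lambda>x. proj_point (ver x)) ` fibre r (euler_form r k) (\<beta> u)" by blast
  qed
qed

text \<open>Both representatives have coordinate sum \<open>coord_sum u\<close>, so equal projective points give
  equal vectors.\<close>

lemma fibre_same_point:
  assumes u: "u \<in> carrier_vec n" and \<beta>_nz: "\<And>j. j < r \<Longrightarrow> \<beta> u j \<noteq> 0" and U: "coord_sum u \<noteq> 0"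
    and x: "x \<in> fibre r (euler_form r k) (\<beta> u)"
  shows "{y \<in> fibre r (euler_form r k) (\<beta> u). proj_point (ver y) = proj_point (ver x)} =
     (\<lambda>z j. z * x j) ` {z. z ^ k = 1}"
proof
  let ?F = "fibre r (euler_form r k) (\<beta> u)"
  have xnz: "y j \<noteq> 0" if "y \<in> ?F" "j < r" for y j
    using \<beta>_nz[OF that(2)] euler_form_zero[OF that(2), of y] that by (auto simp: fibre_def)
  have S: "coord_sum (ver y) = coord_sum u" if "y \<in> ?F" for y
  proof -
    have "of_nat k * coord_sum (ver y) = of_nat k * coord_sum u"
      unfolding sum_\<beta>[OF ver_carrier, symmetric] sum_\<beta>[OF u, symmetric] peval_euler_form_\<beta>[symmetric]
      using that by (simp add: fibre_def)
    then show ?thesis using k_pos by simp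
  qed
  show "{y \<in> ?F. proj_point (ver y) = proj_point (ver x)} \<subseteq> (\<lambda>z j. z * x j) ` {z. z ^ k = 1}"
  proof
    fix y assume "y \<in> {y \<in> ?F. proj_point (ver y) = proj_point (ver x)}"
    then have y: "y \<in> ?F" "proj_point (ver y) = proj_point (ver x)" by auto
    have "ver y \<in> proj_point (ver x)" using proj_point_self[of "ver y"] y(2) by simp
    then obtain t where t: "ver y = t \<cdot>\<^sub>v ver x" by (auto simp: proj_point_def)
    have "coord_sum u = t * coord_sum u"
      using arg_cong[OF t, of coord_sum] S[OF y(1)] S[OF x] by (simp add: coord_sum_smult)
    then have "t = 1" using U by simp
    then have eq: "ver y = ver x" using t by simp
    \<comment> \<open>Comparing the pivotal coordinates determines \<open>y\<close> as the multiple
      of \<open>x\<close> by \<open>z = y 0 / x 0\<close>; the case \<open>j = 0\<close> gives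
      \<open>z ^ k = 1\<close>.\<close>
    have piv: "y 0 ^ (k - 1) * y j = x 0 ^ (k - 1) * x j" if "j < r" for j
      using arg_cong[OF eq, of "\<lambda>v. v $ idx (pivot 0 j)"] that
      by (simp add: ver_idx pivot_comps mono_eval_pivot del: ver_index)
    have x0: "x 0 \<noteq> 0" "y 0 \<noteq> 0" using xnz[OF x] xnz[OF y(1)] by auto
    define z where "z = y 0 / x 0"
    have zk: "z ^ (k - 1) * z = 1"
      using piv[of 0] x0 by (simp add: z_def power_divide)
    have "y j = z * x j" for j
    proof (cases "j < r")
      case True
      have "y 0 = z * x 0" using x0 by (simp add: z_def)
      then have "x 0 ^ (k - 1) * (z ^ (k - 1) * y j) = x 0 ^ (k - 1) * x j"
        using piv[OF True] by (simp add: power_mult_distrib mult_ac)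
      then have "z ^ (k - 1) * y j = x j" using x0 by simp
      moreover have "(z ^ (k - 1) * z) * y j = z * (z ^ (k - 1) * y j)" by (simp only: mult_ac)
      ultimately have "(z ^ (k - 1) * z) * y j = z * x j" by (simp only:)
      then have "1 * y j = z * x j" unfolding zk .
      then show ?thesis by simp
    qed (use x y in \<open>auto simp: fibre_def\<close>)
    moreover have "z ^ k = 1" using zk k_pos by (metis One_nat_def Suc_diff_1 Suc_le_lessD power_Suc2)
    ultimately show "y \<in> (\<lambda>z j. z * x j) ` {z. z ^ k = 1}" by blast
  qed
  show "(\<lambda>z j. z * x j) ` {z. z ^ k = 1} \<subseteq> {y \<in> ?F. proj_point (ver y) = proj_point (ver x)}"
  proof
    fix y assume "y \<in> (\<lambda>z j. z * x j) ` {z. z ^ k = 1}"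
    then obtain z where z: "z ^ k = 1" "y = (\<lambda>j. z * x j)" by blast
    then have "ver y = ver x" by (simp add: ver_scale)
    moreover have "y \<in> ?F"
      using x \<open>ver y = ver x\<close> by (simp add: fibre_def peval_euler_form_\<beta>) (simp add: z)
    ultimately show "y \<in> {y \<in> ?F. proj_point (ver y) = proj_point (ver x)}" by simp
  qed
qed

text \<open>The \<open>k\<close>-th roots of unity act freely on the fibre, as \<open>x 0\<close> is
  non-zero there, so each critical point has exactly \<open>k\<close> preimages.\<close>

lemma card_critical_points:
  assumes u: "u \<in> carrier_vec n" and \<beta>_nz: "\<And>j. j < r \<Longrightarrow> \<beta> u j \<noteq> 0" and U: "coord_sum u \<noteq> 0"
    and card: "card (fibre r (euler_form r k) (\<beta> u)) = k ^ r"
  shows "finite (critical_points n X u) \<and> card (critical_points n X u) = k ^ m"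
proof -
  let ?F = "fibre r (euler_form r k) (\<beta> u)" and ?f = "\<lambda>x. proj_point (ver x)"
  have fin: "finite ?F" using card k_pos by (intro card_ge_0_finite) simp
  have fib: "card {y \<in> ?F. ?f y = P} = k" if P: "P \<in> ?f ` ?F" for P
  proof -
    obtain x where x: "x \<in> ?F" "P = ?f x" using P by blast
    have "x 0 \<noteq> 0" using \<beta>_nz[of 0] euler_form_zero[of 0 x] x(1) by (auto simp: fibre_def)
    then have "inj_on (\<lambda>z j. z * x j) {z. z ^ k = 1}" by (auto simp: inj_on_def fun_eq_iff)
    moreover have "{y \<in> ?F. ?f y = P} = (\<lambda>z j. z * x j) ` {z. z ^ k = 1}"
      unfolding x(2) by (rule fibre_same_point[OF u \<beta>_nz U x(1)])
    ultimately have "card {y \<in> ?F. ?f y = P} = card {z :: complex. z ^ k = 1}"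
      by (simp only: card_image)
    also have "\<dots> = k" using k_pos by (intro card_roots_unity_eq) simp
    finally show ?thesis .
  qed
  have "k ^ r = (\<Sum>x\<in>?F. 1)" using card by simp
  also have "\<dots> = (\<Sum>P\<in>?f ` ?F. \<Sum>x\<in>{y \<in> ?F. ?f y = P}. 1)" by (rule sum.image_gen[OF fin])
  also have "\<dots> = card (?f ` ?F) * k" using fib by simp
  finally have "k ^ r = card (?f ` ?F) * k" .
  moreover have "k ^ r = k ^ m * k" by (simp add: r_def mult.commute)
  ultimately have "card (?f ` ?F) * k = k ^ m * k" by (simp only:)
  then have "card (?f ` ?F) = k ^ m" using k_pos by simp
  moreover have "critical_points n X u = ?f ` ?F" by (rule critical_points_eq[OF u \<beta>_nz U])
  ultimately show ?thesis using fin by simp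
qed

text \<open>Genericity in the target space is pulled back along the linear map
  \<open>\<beta>\<close>. The two extra factors of \<open>E\<close> guarantee that all
  \<open>\<beta> u j\<close> and the coordinate sum of \<open>u\<close> are non-zero.\<close>

lemma generically_card_critical_points:
  "generically n (\<lambda>u. finite (critical_points n X u) \<and> card (critical_points n X u) = k ^ m)"
proof -
  obtain D where D: "D \<in> poly_ring r" "D \<noteq> 0"
    "\<And>b. peval D b \<noteq> 0 \<Longrightarrow> card (fibre r (euler_form r k) b) = k ^ r"
    using euler_forms_generic_fibre_card[OF k_pos, of r] by (auto simp: r_def)
  define B :: "nat \<Rightarrow> nat cpoly" where
    "B j = (\<Sum>i<n. Cst (of_nat (lookup (hexp i) j)) * Var i)" for j
  define E where "E = psubst Cst B D * (\<Prod>j<r. B j) * (\<Sum>j<r. B j)"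
  have B: "B j \<in> poly_ring n" for j
    unfolding B_def by (intro poly_ring_sum poly_ring_mult poly_ring_Var) (auto simp del: single_of_nat)
  have E: "E \<in> poly_ring n"
    unfolding E_def by (intro poly_ring_mult poly_ring_sum poly_ring_prod psubst_Cst_poly_ring[OF D(1)] B)
  have evalB: "evalv (B j) u = \<beta> u j" for j u
    by (simp add: B_def \<beta>_def peval.hom_sum peval.hom_mult mult.commute del: single_of_nat)
  have evalE: "evalv E u = peval D (\<beta> u) * (\<Prod>j<r. \<beta> u j) * (\<Sum>j<r. \<beta> u j)" for u
    by (simp add: E_def peval.hom_mult peval.hom_prod peval.hom_sum peval_psubst evalB)
  have "E \<noteq> 0"
  proof -
    let ?D = "D * (\<Prod>j<r. Var j) * (\<Sum>j<r. Var j)"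
    have "Var j \<noteq> (0 :: nat cpoly)" for j
      by (metis lookup_single_eq lookup_zero zero_neq_one)
    moreover have "(\<Sum>j<r. Var j :: nat cpoly) \<noteq> 0"
    proof
      assume "(\<Sum>j<r. Var j :: nat cpoly) = 0"
      then have "peval (\<Sum>j<r. Var j) (\<lambda>_. 1) = 0" by simp
      then show False using r_simps(1) by (simp add: peval.hom_sum)
    qed
    ultimately have "?D \<noteq> 0" using D(2) by simp
    moreover have "?D \<in> poly_ring r"
      using D(1) by (intro poly_ring_mult poly_ring_sum poly_ring_prod poly_ring_Var) auto
    ultimately obtain b where b: "peval ?D b \<noteq> 0" using poly_ring_nonzero_peval by blast
    \<comment> \<open>\<open>E \<noteq> 0\<close> requires \<open>\<beta>\<close> to be onto: data
      concentrated on the pure powers \<open>k e\<^sub>j\<close>, with entries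
      \<open>b j / k\<close>, are mapped to \<open>b\<close>.\<close>
    define u where "u = vec n (\<lambda>i. \<Sum>j<r. if i = idx (pivot j j) then b j / of_nat k else 0)"
    have \<beta>u: "\<beta> u l = b l" if l: "l < r" for l
    proof -
      have "\<beta> u l = (\<Sum>i<n. \<Sum>j<r. if i = idx (pivot j j) then b j / of_nat k * of_nat (lookup (hexp i) l) else 0)"
        unfolding \<beta>_def u_def by (simp add: sum_distrib_right if_distrib[of "\<lambda>x. x * _"] cong: if_cong)
      also have "\<dots> = (\<Sum>j<r. \<Sum>i<n. if i = idx (pivot j j) then b j / of_nat k * of_nat (lookup (hexp i) l) else 0)"
        by (rule sum.swap)
      also have "\<dots> = (\<Sum>j<r. b j / of_nat k * of_nat (lookup (pivot j j) l))"
      proof (intro sum.cong refl)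
        fix j assume "j \<in> {..<r}"
        then have "idx (pivot j j) < n" "hexp (idx (pivot j j)) = pivot j j"
          using idx[OF pivot_comps[of j j]] by auto
        then show "(\<Sum>i<n. if i = idx (pivot j j) then b j / of_nat k * of_nat (lookup (hexp i) l) else 0) =
            b j / of_nat k * of_nat (lookup (pivot j j) l)" by simp
      qed
      also have "\<dots> = (\<Sum>j<r. if j = l then b j else 0)"
        unfolding pivot_diag using k_pos by (intro sum.cong) (auto simp: lookup_single when_def)
      finally show ?thesis using l by simp
    qed
    have "peval D (\<beta> u) = peval D b"
      using D(1) \<beta>u by (intro peval_cong) (auto dest: poly_ring_pvars)
    then have "evalv E u = peval ?D b"
      unfolding evalE using \<beta>u by (simp add: peval.hom_mult peval.hom_prod peval.hom_sum)
    then show "E \<noteq> 0" using b by auto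
  qed
  moreover have "finite (critical_points n X u) \<and> card (critical_points n X u) = k ^ m"
    if u: "u \<in> carrier_vec n" "evalv E u \<noteq> 0" for u
  proof (rule card_critical_points[OF u(1)])
    have nz: "peval D (\<beta> u) \<noteq> 0" "(\<Prod>j<r. \<beta> u j) \<noteq> 0" "(\<Sum>j<r. \<beta> u j) \<noteq> 0"
      using u(2) by (auto simp: evalE)
    show "\<beta> u j \<noteq> 0" if "j < r" for j using nz(2) that by auto
    show "coord_sum u \<noteq> 0" using nz(3) sum_\<beta>[OF u(1)] by auto
    show "card (fibre r (euler_form r k) (\<beta> u)) = k ^ r" by (rule D(3)[OF nz(1)])
  qed
  ultimately show ?thesis unfolding generically_def using E by blast
qed

end

theorem proposition22:
  fixes d k n :: nat and A :: "int mat" and c :: "complex vec"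
  assumes "1 \<le> d" and "1 \<le> k" and "k \<le> d - 1"
    and "veronese_matrix (d - 1) k A" and "n = dim_col A" and "c = ones_vec n"
  shows "(\<forall>R. is_A_resultant A R \<longrightarrow> c \<notin> Sigma_locus A R) \<and>
         mldeg n (toric_variety A c) = k ^ (d - 1)"
proof -
  interpret veronese "d - 1" k A
    using assms(2,4) by unfold_locales
  show ?thesis
    unfolding assms(5,6) using not_in_Sigma_locus mldeg_eqI[OF generically_card_critical_points] by blast
qed

end
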